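(* Let $\mathbb{F}_\theta^+$ be a $k$-graph on a single vertex. Every atomic $*$-representation $\sigma$ of $\mathbb{F}_\theta^+$ with a connected graph is obtained as the minimal $*$-dilation of a group construction representation $\rho$. Moreover, the symmetry group of $\sigma$ coincides with the full symmetry group of $\rho$.
   Context: $k$-graph on a single vertex: a unital semigroup $\mathbb{F}_\theta^+$ generated by elements $e^i_{s}$ ($1\le i\le k$, $1\le s\le m_i$), with no relations among the $e^i_s$ for fixed $i$, and relations $e^i_s e^j_t=e^j_{t'}e^i_{s'}$ for $i<j$, where $(s',t')=\theta_{ij}(s,t)$ and $\theta_{ij}$ is a permutation of $\{1,\dots,m_i\}\times\{1,\dots,m_j\}$; it is assumed that, with $\deg:\mathbb{F}_\theta^+\to\mathbb{N}_0^k$ the homomorphism with $\deg(e^i_s)=\varepsilon_i$ (standard generator), every $w$ with $\deg(w)=m+n$ factors uniquely as $w=uv$ with $\deg u=m$, $\deg v=n$. Representations: a representation is a semigroup homomorphism $\sigma:\mathbb{F}_\theta^+\to B(\mathcal H)$. It is row contractive if each row $[\sigma(e^i_1)\cdots\sigma(e^i_{m_i})]$ is a contraction, row isometric if each such row is an isometry, and a row contractive representation is defect free if $\sum_{s}\sigma(e^i_s)\sigma(e^i_s)^*=I$ for every $i$. A $*$-representation is a row isometric defect free representation. Every defect free row contractive representation $\sigma$ on $\mathcal H$ has a unique minimal $*$-dilation (up to unitary equivalence fixing $\mathcal H$): a $*$-representation $\pi$ on $\mathcal K\supseteq\mathcal H$ with $\mathcal H$ invariant under all $\pi(w)^*$,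 $\sigma(w)=P_{\mathcal H}\pi(w)|_{\mathcal H}$, and $\mathcal K=\overline{\mathrm{span}}\{\pi(w)\mathcal H\}$. Atomic: a representation by partial isometries is atomic if there is an orthonormal basis $\{\xi_j\}$ (the standard basis) such that for each $w$ and $j$, $\sigma(w)\xi_j=\alpha\xi_l$ for some $l$ and some $\alpha\in\mathbb{T}\cup\{0\}$. Its graph has the basis vectors as vertices and an edge labelled $e^i_s$ from $\xi_a$ to $\xi_b$ whenever $\sigma(e^i_s)\xi_a$ is a unimodular multiple of $\xi_b$; it is connected if any two vertices are joined by an undirected path. Tails: an infinite tail $\tau$ is an infinite word in the generators containing infinitely many letters from each family $\{e^i_1,\dots,e^i_{m_i}\}$; for each $n\in\mathbb{N}_0^k$ it has a unique initial segment $w_n$ of degree $n$ (after refactoring by the commutation relations), and two tails are identified when they have the same initial segments. For $n\in\mathbb{N}_0^k$ define $\Sigma(\tau,-n)=(t^1,\dots,t^k)$ where $w_{n+\varepsilon_i}=w_n e^i_{t^i}$. The tail $\tau$ is eventually $p$-periodic ($p\in\mathbb{Z}^k$) if there is $T\in\mathbb{Z}^k$ with $T\le 0$ and $T+p\le0$ such that $\Sigma(\tau,n)=\Sigma(\tau,n+p)$ for all $n\le T$. The symmetry group of $\tau$ is $H_\tau=\{p\in\mathbb{Z}^k:\tau\text{ is eventually }p\text{-periodic}\}$. Symmetry group of $\sigma$: for an atomic $*$-representation $\sigma$ with connected graph, each standard basis vector $\eta$ determines a unique infinite tail $\tau$ such that $\eta\in\operatorname{Ran}\sigma(w)$ for every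 initial segment $w$ of $\tau$; the subgroup $H_\tau$ does not depend on $\eta$ and is called the symmetry group of $\sigma$. Group construction: let $G$ be a finitely generated abelian group with designated generators $\mathfrak g_1,\dots,\mathfrak g_k$, and let $t^i:G\to\{1,\dots,m_i\}$, $\alpha^i:G\to\mathbb{T}$ ($1\le i\le k$) be functions (values written $t^i_g,\alpha^i_g$) with $e^i_{t^i_g}e^j_{t^j_{g-\mathfrak g_i}}=e^j_{t^j_g}e^i_{t^i_{g-\mathfrak g_j}}$ and $\alpha^i_g\alpha^j_{g-\mathfrak g_i}=\alpha^j_g\alpha^i_{g-\mathfrak g_j}$ for all $g\in G$ and $i<j$. The associated group construction representation $\rho$ on $\ell^2(G)$ (orthonormal basis $\{\xi_g\}$) is $\rho(e^i_t)\xi_{g-\mathfrak g_i}=\delta_{t,t^i_g}\alpha^i_g\xi_g$; it is a defect free atomic representation. Its full symmetry group is the largest subgroup $H\le G$ with $t^i_{g+h}=t^i_g$ and $\alpha^i_{g+h}=\alpha^i_g$ for all $g\in G$, $h\in H$, $1\le i\le k$. *)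

theory Defs
  imports "HOL-Analysis.Analysis" "HOL-Algebra.Generated_Groups" "HOL-Algebra.FiniteProduct"
begin

section \<open>Complex Hilbert spaces\<close>

text \<open>HOL-Analysis only has real inner products.  The inner product below is linear in its
  first argument, and the ambient norm is the one it induces (which also forces definiteness).\<close>

class complex_hilbert = banach +
  fixes scaleC :: "complex \<Rightarrow> 'a \<Rightarrow> 'a" (infixr \<open>*\<^sub>C\<close> 75)
    and cinner :: "'a \<Rightarrow> 'a \<Rightarrow> complex"
  assumes scaleC_add_right: "a *\<^sub>C (x + y) = a *\<^sub>C x + a *\<^sub>C y"
    and scaleC_add_left: "(a + b) *\<^sub>C x = a *\<^sub>C x + b *\<^sub>C x"
    and scaleC_scaleC: "a *\<^sub>C (b *\<^sub>C x) = (a * b) *\<^sub>C x"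
    and scaleC_of_real: "complex_of_real r *\<^sub>C x = r *\<^sub>R x"
    and cinner_commute: "cinner x y = cnj (cinner y x)"
    and cinner_add_left: "cinner (x + y) z = cinner x z + cinner y z"
    and cinner_scaleC_left: "cinner (a *\<^sub>C x) y = a * cinner x y"
    and cinner_self: "cinner x x = complex_of_real ((norm x)\<^sup>2)"

instantiation complex :: complex_hilbert
begin
definition scaleC_complex :: "complex \<Rightarrow> complex \<Rightarrow> complex" where
  "scaleC_complex = (*)"
definition cinner_complex :: "complex \<Rightarrow> complex \<Rightarrow> complex" where
  "cinner_complex x y = x * cnj y"
instance
  by standard
    (auto simp: scaleC_complex_def cinner_complex_def algebra_simps scaleR_conv_of_real
      complex_norm_square simp flip: of_real_power)
end

global_interpretation complex_hilbert:
  vector_space "scaleC :: complex \<Rightarrow> 'a \<Rightarrow> 'a::complex_hilbert"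
  defines csubspace = "complex_hilbert.subspace"
    and cspan = "complex_hilbert.span"
proof
  fix a b :: complex and x y :: 'a
  show "a *\<^sub>C (x + y) = a *\<^sub>C x + a *\<^sub>C y" by (rule scaleC_add_right)
  show "(a + b) *\<^sub>C x = a *\<^sub>C x + b *\<^sub>C x" by (rule scaleC_add_left)
  show "a *\<^sub>C b *\<^sub>C x = (a * b) *\<^sub>C x" by (rule scaleC_scaleC)
  show "1 *\<^sub>C x = x" using scaleC_of_real[of 1 x] by simp
qed

text \<open>A Hilbert space is a closed complex subspace \<open>M\<close> of a type of class
  \<open>complex_hilbert\<close> (possibly \<open>UNIV\<close>); an operator on \<open>M\<close> is a function
  of which only the values on \<open>M\<close> matter.\<close>

definition closed_csubspace :: "'h::complex_hilbert set \<Rightarrow> bool" where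
  "closed_csubspace M \<longleftrightarrow> csubspace M \<and> closed M"

definition bounded_operator :: "'h::complex_hilbert set \<Rightarrow> ('h \<Rightarrow> 'h) \<Rightarrow> bool" where
  "bounded_operator M A \<longleftrightarrow> A ` M \<subseteq> M \<and>
     (\<forall>x\<in>M. \<forall>y\<in>M. A (x + y) = A x + A y) \<and> (\<forall>c. \<forall>x\<in>M. A (c *\<^sub>C x) = c *\<^sub>C A x) \<and>
     (\<exists>K. \<forall>x\<in>M. norm (A x) \<le> K * norm x)"

definition cadjoint :: "'h::complex_hilbert set \<Rightarrow> ('h \<Rightarrow> 'h) \<Rightarrow> 'h \<Rightarrow> 'h" where
  "cadjoint M A x = (THE y. y \<in> M \<and> (\<forall>z\<in>M. cinner (A z) x = cinner z y))"

definition cproj :: "'h::complex_hilbert set \<Rightarrow> 'h \<Rightarrow> 'h" where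
  "cproj M x = (THE y. y \<in> M \<and> (\<forall>z\<in>M. cinner (x - y) z = 0))"

definition partial_isometry :: "('h::complex_hilbert \<Rightarrow> 'h) \<Rightarrow> bool" where
  "partial_isometry A \<longleftrightarrow> bounded_operator UNIV A \<and>
     (\<forall>x. (\<forall>y. A y = 0 \<longrightarrow> cinner x y = 0) \<longrightarrow> norm (A x) = norm x)"

definition orthonormal_basis ::
    "'h::complex_hilbert set \<Rightarrow> 'i set \<Rightarrow> ('i \<Rightarrow> 'h) \<Rightarrow> bool" where
  "orthonormal_basis M I \<xi> \<longleftrightarrow>
     (\<forall>a\<in>I. \<forall>b\<in>I. cinner (\<xi> a) (\<xi> b) = (if a = b then 1 else 0)) \<and>
     closure (cspan (\<xi> ` I)) = M"


section \<open>Single vertex \<open>k\<close>-graphs\<close>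

text \<open>The colours \<open>1, \<dots>, k\<close> are the elements of a finite linearly ordered type \<open>'k\<close>, so
  that \<open>\<int>\<^sup>k\<close> is \<open>int ^ 'k\<close>.  The letter \<open>(i, s)\<close> stands for the generator \<open>e\<^sup>i\<^sub>s\<close>;
  \<open>theta \<Gamma> i j\<close> is only used for \<open>i < j\<close>.\<close>

record 'k presentation =
  num :: "'k \<Rightarrow> nat"
  theta :: "'k \<Rightarrow> 'k \<Rightarrow> nat \<times> nat \<Rightarrow> nat \<times> nat"

type_synonym 'k NNk = "nat ^ 'k"
type_synonym 'k ZZk = "int ^ 'k"
type_synonym 'k word = "('k \<times> nat) list"

definition letters :: "'k presentation \<Rightarrow> ('k \<times> nat) set" where
  "letters \<Gamma> = {(i, s). s \<in> {1..num \<Gamma> i}}"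

inductive_set swaps :: "'k::linorder presentation \<Rightarrow> ('k word \<times> 'k word) set" for \<Gamma> where
  "\<lbrakk>i < j; s \<in> {1..num \<Gamma> i}; t \<in> {1..num \<Gamma> j}; theta \<Gamma> i j (s, t) = (s', t');
    u \<in> lists (letters \<Gamma>); v \<in> lists (letters \<Gamma>)\<rbrakk> \<Longrightarrow>
   (u @ [(i, s), (j, t)] @ v, u @ [(j, t'), (i, s')] @ v) \<in> swaps \<Gamma>"

definition word_eq :: "'k::linorder presentation \<Rightarrow> ('k word \<times> 'k word) set" where
  "word_eq \<Gamma> = Restr ((swaps \<Gamma> \<union> (swaps \<Gamma>)\<inverse>)\<^sup>*) (lists (letters \<Gamma>))"

definition wclass :: "'k::linorder presentation \<Rightarrow> 'k word \<Rightarrow> 'k word set" where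
  "wclass \<Gamma> w = word_eq \<Gamma> `` {w}"

definition FF :: "'k::linorder presentation \<Rightarrow> 'k word set monoid" where
  "FF \<Gamma> = \<lparr>carrier = lists (letters \<Gamma>) // word_eq \<Gamma>,
           mult = (\<lambda>X Y. \<Union>x\<in>X. \<Union>y\<in>Y. wclass \<Gamma> (x @ y)),
           one = wclass \<Gamma> []\<rparr>"

abbreviation gen :: "'k::linorder presentation \<Rightarrow> 'k \<Rightarrow> nat \<Rightarrow> 'k word set" where
  "gen \<Gamma> i s \<equiv> wclass \<Gamma> [(i, s)]"

definition word_deg :: "'k::finite word \<Rightarrow> 'k NNk" where
  "word_deg w = (\<chi> i. length (filter (\<lambda>l. fst l = i) w))"

text \<open>All words in a class have the same degree, so the choice is immaterial.\<close>

definition deg :: "'k::finite word set \<Rightarrow> 'k NNk" where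
  "deg X = word_deg (SOME w. w \<in> X)"

definition single_vertex_kgraph :: "'k::{finite,linorder} presentation \<Rightarrow> bool" where
  "single_vertex_kgraph \<Gamma> \<longleftrightarrow>
     (\<forall>i j. i < j \<longrightarrow> bij_betw (theta \<Gamma> i j) ({1..num \<Gamma> i} \<times> {1..num \<Gamma> j})
                                          ({1..num \<Gamma> i} \<times> {1..num \<Gamma> j})) \<and>
     (\<forall>w \<in> carrier (FF \<Gamma>). \<forall>a b. deg w = a + b \<longrightarrow>
        (\<exists>!p. p \<in> carrier (FF \<Gamma>) \<times> carrier (FF \<Gamma>) \<and>
              w = fst p \<otimes>\<^bsub>FF \<Gamma>\<^esub> snd p \<and> deg (fst p) = a \<and> deg (snd p) = b))"


section \<open>Representations\<close>

definition representation ::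
    "'k::linorder presentation \<Rightarrow> 'h::complex_hilbert set \<Rightarrow> ('k word set \<Rightarrow> 'h \<Rightarrow> 'h) \<Rightarrow> bool" where
  "representation \<Gamma> M \<sigma> \<longleftrightarrow> closed_csubspace M \<and>
     (\<forall>w \<in> carrier (FF \<Gamma>). bounded_operator M (\<sigma> w)) \<and>
     (\<forall>v \<in> carrier (FF \<Gamma>). \<forall>w \<in> carrier (FF \<Gamma>). \<forall>x\<in>M. \<sigma> (v \<otimes>\<^bsub>FF \<Gamma>\<^esub> w) x = \<sigma> v (\<sigma> w x)) \<and>
     (\<forall>x\<in>M. \<sigma> \<one>\<^bsub>FF \<Gamma>\<^esub> x = x)"

text \<open>The row of colour \<open>i\<close> is the operator
  \<open>(x\<^sub>1, \<dots>, x\<^sub>m) \<mapsto> \<sigma>(e\<^sup>i\<^sub>1) x\<^sub>1 + \<dots> + \<sigma>(e\<^sup>i\<^sub>m) x\<^sub>m\<close> from the \<open>m\<close>-fold Hilbert sum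
  \<open>M \<oplus> \<dots> \<oplus> M\<close> to \<open>M\<close>, where \<open>m = num \<Gamma> i\<close>.\<close>

definition row_contractive ::
    "'k::linorder presentation \<Rightarrow> 'h::complex_hilbert set \<Rightarrow> ('k word set \<Rightarrow> 'h \<Rightarrow> 'h) \<Rightarrow> bool" where
  "row_contractive \<Gamma> M \<sigma> \<longleftrightarrow>
     (\<forall>i. \<forall>x \<in> {1..num \<Gamma> i} \<rightarrow> M.
        (norm (\<Sum>s=1..num \<Gamma> i. \<sigma> (gen \<Gamma> i s) (x s)))\<^sup>2 \<le> (\<Sum>s=1..num \<Gamma> i. (norm (x s))\<^sup>2))"

definition row_isometric ::
    "'k::linorder presentation \<Rightarrow> 'h::complex_hilbert set \<Rightarrow> ('k word set \<Rightarrow> 'h \<Rightarrow> 'h) \<Rightarrow> bool" where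
  "row_isometric \<Gamma> M \<sigma> \<longleftrightarrow>
     (\<forall>i. \<forall>x \<in> {1..num \<Gamma> i} \<rightarrow> M.
        (norm (\<Sum>s=1..num \<Gamma> i. \<sigma> (gen \<Gamma> i s) (x s)))\<^sup>2 = (\<Sum>s=1..num \<Gamma> i. (norm (x s))\<^sup>2))"

definition defect_free ::
    "'k::linorder presentation \<Rightarrow> 'h::complex_hilbert set \<Rightarrow> ('k word set \<Rightarrow> 'h \<Rightarrow> 'h) \<Rightarrow> bool" where
  "defect_free \<Gamma> M \<sigma> \<longleftrightarrow>
     (\<forall>i. \<forall>x\<in>M. (\<Sum>s=1..num \<Gamma> i. \<sigma> (gen \<Gamma> i s) (cadjoint M (\<sigma> (gen \<Gamma> i s)) x)) = x)"

definition star_representation ::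
    "'k::linorder presentation \<Rightarrow> 'h::complex_hilbert set \<Rightarrow> ('k word set \<Rightarrow> 'h \<Rightarrow> 'h) \<Rightarrow> bool" where
  "star_representation \<Gamma> M \<sigma> \<longleftrightarrow>
     representation \<Gamma> M \<sigma> \<and> row_isometric \<Gamma> M \<sigma> \<and> defect_free \<Gamma> M \<sigma>"

text \<open>\<open>\<pi>\<close> acts on the whole space \<open>UNIV\<close>, which plays the role of the larger space \<open>K \<supseteq> M\<close>.\<close>

definition minimal_star_dilation ::
    "'k::linorder presentation \<Rightarrow> 'h::complex_hilbert set \<Rightarrow> ('k word set \<Rightarrow> 'h \<Rightarrow> 'h) \<Rightarrow>
     ('k word set \<Rightarrow> 'h \<Rightarrow> 'h) \<Rightarrow> bool" where
  "minimal_star_dilation \<Gamma> M \<rho> \<pi> \<longleftrightarrow>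
     representation \<Gamma> M \<rho> \<and> row_contractive \<Gamma> M \<rho> \<and> defect_free \<Gamma> M \<rho> \<and>
     star_representation \<Gamma> UNIV \<pi> \<and>
     (\<forall>w \<in> carrier (FF \<Gamma>). \<forall>x\<in>M. cadjoint UNIV (\<pi> w) x \<in> M) \<and>
     (\<forall>w \<in> carrier (FF \<Gamma>). \<forall>x\<in>M. \<rho> w x = cproj M (\<pi> w x)) \<and>
     closure (cspan {\<pi> w x |w x. w \<in> carrier (FF \<Gamma>) \<and> x \<in> M}) = UNIV"

definition atomic ::
    "'k::linorder presentation \<Rightarrow> 'h::complex_hilbert set \<Rightarrow> ('k word set \<Rightarrow> 'h \<Rightarrow> 'h) \<Rightarrow> bool" where
  "atomic \<Gamma> B \<sigma> \<longleftrightarrow>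
     (\<forall>w \<in> carrier (FF \<Gamma>). partial_isometry (\<sigma> w)) \<and>
     orthonormal_basis UNIV B (\<lambda>x. x) \<and>
     (\<forall>w \<in> carrier (FF \<Gamma>). \<forall>x\<in>B. \<exists>y\<in>B. \<exists>\<alpha>. (cmod \<alpha> = 1 \<or> \<alpha> = 0) \<and> \<sigma> w x = \<alpha> *\<^sub>C y)"

definition graph_edges ::
    "'k::linorder presentation \<Rightarrow> 'h::complex_hilbert set \<Rightarrow> ('k word set \<Rightarrow> 'h \<Rightarrow> 'h) \<Rightarrow>
     ('h \<times> ('k \<times> nat) \<times> 'h) set" where
  "graph_edges \<Gamma> B \<sigma> =
     {(a, (i, s), b). a \<in> B \<and> b \<in> B \<and> (i, s) \<in> letters \<Gamma> \<and>
        (\<exists>\<alpha>. cmod \<alpha> = 1 \<and> \<sigma> (gen \<Gamma> i s) a = \<alpha> *\<^sub>C b)}"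

text \<open>As usual, a connected graph is nonempty; this only excludes the zero Hilbert space.\<close>

definition connected_graph ::
    "'k::linorder presentation \<Rightarrow> 'h::complex_hilbert set \<Rightarrow> ('k word set \<Rightarrow> 'h \<Rightarrow> 'h) \<Rightarrow> bool" where
  "connected_graph \<Gamma> B \<sigma> \<longleftrightarrow> B \<noteq> {} \<and>
     (\<forall>a\<in>B. \<forall>b\<in>B. (a, b) \<in>
        ({(x, y). \<exists>l. (x, l, y) \<in> graph_edges \<Gamma> B \<sigma> \<or> (y, l, x) \<in> graph_edges \<Gamma> B \<sigma>})\<^sup>*)"


section \<open>Infinite tails and symmetry groups\<close>

definition infinite_word :: "'k presentation \<Rightarrow> (nat \<Rightarrow> 'k \<times> nat) \<Rightarrow> bool" where
  "infinite_word \<Gamma> \<omega> \<longleftrightarrow> range \<omega> \<subseteq> letters \<Gamma> \<and> (\<forall>i. infinite {N. fst (\<omega> N) = i})"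

definition initial_segment ::
    "'k::{finite,linorder} presentation \<Rightarrow> (nat \<Rightarrow> 'k \<times> nat) \<Rightarrow> 'k NNk \<Rightarrow> 'k word set" where
  "initial_segment \<Gamma> \<omega> n =
     (THE w. w \<in> carrier (FF \<Gamma>) \<and> deg w = n \<and>
        (\<exists>N. \<exists>v \<in> carrier (FF \<Gamma>). wclass \<Gamma> (map \<omega> [0..<N]) = w \<otimes>\<^bsub>FF \<Gamma>\<^esub> v))"

text \<open>Infinite words with the same initial segments are identified: a tail is the function
  sending \<open>n\<close> to the initial segment of degree \<open>n\<close>.\<close>

type_synonym 'k tail = "'k NNk \<Rightarrow> 'k word set"

definition tails :: "'k::{finite,linorder} presentation \<Rightarrow> 'k tail set" where
  "tails \<Gamma> = initial_segment \<Gamma> ` {\<omega>. infinite_word \<Gamma> \<omega>}"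

text \<open>\<open>Sig \<Gamma> \<tau> z\<close> is \<open>\<Sigma>(\<tau>, z)\<close>, meaningful for \<open>z \<le> 0\<close>.\<close>

definition Sig :: "'k::{finite,linorder} presentation \<Rightarrow> 'k tail \<Rightarrow> 'k ZZk \<Rightarrow> 'k NNk" where
  "Sig \<Gamma> \<tau> z = (let n = (\<chi> i. nat (- (z $ i))) in
     \<chi> i. THE t. t \<in> {1..num \<Gamma> i} \<and> \<tau> (n + axis i 1) = \<tau> n \<otimes>\<^bsub>FF \<Gamma>\<^esub> gen \<Gamma> i t)"

definition eventually_periodic ::
    "'k::{finite,linorder} presentation \<Rightarrow> 'k tail \<Rightarrow> 'k ZZk \<Rightarrow> bool" where
  "eventually_periodic \<Gamma> \<tau> p \<longleftrightarrow>
     (\<exists>T. T \<le> 0 \<and> T + p \<le> 0 \<and> (\<forall>n \<le> T. Sig \<Gamma> \<tau> n = Sig \<Gamma> \<tau> (n + p)))"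

definition tail_symmetry_group ::
    "'k::{finite,linorder} presentation \<Rightarrow> 'k tail \<Rightarrow> 'k ZZk set" where
  "tail_symmetry_group \<Gamma> \<tau> = {p. eventually_periodic \<Gamma> \<tau> p}"

definition tail_of ::
    "'k::{finite,linorder} presentation \<Rightarrow> ('k word set \<Rightarrow> 'h \<Rightarrow> 'h) \<Rightarrow> 'h \<Rightarrow> 'k tail" where
  "tail_of \<Gamma> \<sigma> \<eta> = (THE \<tau>. \<tau> \<in> tails \<Gamma> \<and> (\<forall>n. \<eta> \<in> range (\<sigma> (\<tau> n))))"

text \<open>The symmetry group of \<open>\<sigma>\<close>, computed from the standard basis vector \<open>\<eta>\<close>.\<close>

definition symmetry_group ::
    "'k::{finite,linorder} presentation \<Rightarrow> ('k word set \<Rightarrow> 'h \<Rightarrow> 'h) \<Rightarrow> 'h \<Rightarrow> 'k ZZk set" where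
  "symmetry_group \<Gamma> \<sigma> \<eta> = tail_symmetry_group \<Gamma> (tail_of \<Gamma> \<sigma> \<eta>)"


section \<open>The group construction\<close>

text \<open>The abelian group \<open>G\<close> is written multiplicatively, so \<open>g - \<gg>\<^sub>i\<close> is rendered as
  \<open>g \<otimes>\<^bsub>G\<^esub> inv\<^bsub>G\<^esub> \<gg> i\<close>.\<close>

definition group_construction_data ::
    "'k::{finite,linorder} presentation \<Rightarrow> 'g monoid \<Rightarrow> ('k \<Rightarrow> 'g) \<Rightarrow> ('k \<Rightarrow> 'g \<Rightarrow> nat) \<Rightarrow>
     ('k \<Rightarrow> 'g \<Rightarrow> complex) \<Rightarrow> bool" where
  "group_construction_data \<Gamma> G \<gg> t \<alpha> \<longleftrightarrow>
     comm_group G \<and> range \<gg> \<subseteq> carrier G \<and> generate G (range \<gg>) = carrier G \<and>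
     (\<forall>i. \<forall>g \<in> carrier G. t i g \<in> {1..num \<Gamma> i} \<and> cmod (\<alpha> i g) = 1) \<and>
     (\<forall>i j. \<forall>g \<in> carrier G. i < j \<longrightarrow>
        gen \<Gamma> i (t i g) \<otimes>\<^bsub>FF \<Gamma>\<^esub> gen \<Gamma> j (t j (g \<otimes>\<^bsub>G\<^esub> inv\<^bsub>G\<^esub> \<gg> i)) =
          gen \<Gamma> j (t j g) \<otimes>\<^bsub>FF \<Gamma>\<^esub> gen \<Gamma> i (t i (g \<otimes>\<^bsub>G\<^esub> inv\<^bsub>G\<^esub> \<gg> j)) \<and>
        \<alpha> i g * \<alpha> j (g \<otimes>\<^bsub>G\<^esub> inv\<^bsub>G\<^esub> \<gg> i) = \<alpha> j g * \<alpha> i (g \<otimes>\<^bsub>G\<^esub> inv\<^bsub>G\<^esub> \<gg> j))"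

text \<open>\<open>M\<close> with the orthonormal basis \<open>\<xi>\<close> indexed by \<open>G\<close> is the copy of \<open>\<ell>\<^sup>2(G)\<close> on which
  \<open>\<rho>\<close> acts; the bounded operators \<open>\<rho> w\<close> are determined on \<open>M\<close> by the formula for generators.\<close>

definition group_construction_rep ::
    "'k::{finite,linorder} presentation \<Rightarrow> 'g monoid \<Rightarrow> ('k \<Rightarrow> 'g) \<Rightarrow> ('k \<Rightarrow> 'g \<Rightarrow> nat) \<Rightarrow>
     ('k \<Rightarrow> 'g \<Rightarrow> complex) \<Rightarrow> 'h::complex_hilbert set \<Rightarrow> ('g \<Rightarrow> 'h) \<Rightarrow>
     ('k word set \<Rightarrow> 'h \<Rightarrow> 'h) \<Rightarrow> bool" where
  "group_construction_rep \<Gamma> G \<gg> t \<alpha> M \<xi> \<rho> \<longleftrightarrow>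
     group_construction_data \<Gamma> G \<gg> t \<alpha> \<and>
     orthonormal_basis M (carrier G) \<xi> \<and> representation \<Gamma> M \<rho> \<and>
     (\<forall>i. \<forall>s \<in> {1..num \<Gamma> i}. \<forall>g \<in> carrier G.
        \<rho> (gen \<Gamma> i s) (\<xi> (g \<otimes>\<^bsub>G\<^esub> inv\<^bsub>G\<^esub> \<gg> i)) = (if s = t i g then \<alpha> i g *\<^sub>C \<xi> g else 0))"

definition full_symmetry_group ::
    "'g monoid \<Rightarrow> ('k \<Rightarrow> 'g \<Rightarrow> nat) \<Rightarrow> ('k \<Rightarrow> 'g \<Rightarrow> complex) \<Rightarrow> 'g set" where
  "full_symmetry_group G t \<alpha> =
     (GREATEST H. subgroup H G \<and>
        (\<forall>h\<in>H. \<forall>g \<in> carrier G. \<forall>i. t i (g \<otimes>\<^bsub>G\<^esub> h) = t i g \<and> \<alpha> i (g \<otimes>\<^bsub>G\<^esub> h) = \<alpha> i g))"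

text \<open>The canonical homomorphism from \<open>\<int>\<^sup>k\<close> onto \<open>G\<close> taking the \<open>i\<close>-th standard generator
  to \<open>\<gg>\<^sub>i\<close>.\<close>

definition canonical_hom :: "'g monoid \<Rightarrow> ('k::finite \<Rightarrow> 'g) \<Rightarrow> 'k ZZk \<Rightarrow> 'g" where
  "canonical_hom G \<gg> n = (\<Otimes>\<^bsub>G\<^esub>i\<in>UNIV. \<gg> i [^]\<^bsub>G\<^esub> (n $ i))"

end

theory Submission
  imports Defs
begin

text \<open>Row isometry and defect freeness make every standard basis vector \<open>b\<close> the image, up to a scalar
  of modulus one, of exactly one basis vector under exactly one word of each degree \<open>n\<close>.  This gives
  commuting maps \<open>shift n\<close> on the basis, that is, a backward action of \<open>\<nat>\<^sup>k\<close>; the words \<open>seg n b\<close> are the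
  initial segments of the tail of \<open>b\<close>, and connectedness says that any two basis vectors have a common
  backward shift.  The symmetry group of \<open>\<sigma>\<close> is therefore the group \<open>H\<close> of the differences \<open>m - n\<close> for
  which \<open>shift m b\<close> and \<open>shift n b\<close> have the same tail (\<open>symmetry_group_eq_periods\<close>).

  A group construction on a space inside the given one is the same thing as an orbit of the shifts
  indexed by a whole quotient of \<open>\<int>\<^sup>k\<close>.  The crux is to find a map \<open>x\<close> from \<open>\<int>\<^sup>k\<close> to the basis with
  \<open>shift n (x g) = x (g - n)\<close> such that the tail of \<open>x g\<close> depends on \<open>g\<close> only modulo \<open>H\<close>
  (\<open>lattice_orbit_exists\<close>).  Going backwards is deterministic; going forwards every basis vector has many
  preimages, and a careless choice destroys the symmetry.  As \<open>H\<close> is finitely generated, some backward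
  shift of a basis vector has a tail that is symmetric from the start.  Whether prepending a word to a
  symmetric tail keeps it symmetric depends only on the word and on a bounded initial segment of the
  tail (\<open>prepend_tail_symmetric\<close>).  There are finitely many segments of that size, so one recurs along
  the backward orbit, and the word between two recurrences can be prepended again and again
  (\<open>tail_symmetric_ascent\<close>).

  Let \<open>K \<subseteq> H\<close> be the group of the periods of \<open>x\<close> itself, \<open>G = \<int>\<^sup>k / K\<close>, and \<open>M\<close> the closed span of the
  orbit.  Rescaling along \<open>\<int>\<^sup>k\<close> removes all phases, but the scalars involved are \<open>K\<close>-periodic only up
  to a character of \<open>K\<close>; dividing by an extension of that character to \<open>\<int>\<^sup>k\<close>
  (\<open>unit_character_extends\<close>) makes them functions on \<open>G\<close> and leaves phases that depend on the colour
  alone.  Hence the full symmetry group is that of the labels, which is \<open>H / K\<close>.  The space \<open>M\<close> is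
  invariant under all adjoints, so the compression of \<open>\<sigma>\<close> to it is a representation with \<open>\<sigma>\<close> as a
  dilation, and the dilation is minimal by connectedness.\<close>

section \<open>Geometry of complex Hilbert spaces\<close>

lemma cinner_zero_left [simp]: "cinner 0 y = 0"
  using cinner_add_left[of 0 0 y] by simp

lemma cinner_add_right: "cinner x (y + z) = cinner x y + cinner x z"
  by (metis cinner_add_left cinner_commute complex_cnj_add)

lemma cinner_zero_right [simp]: "cinner x 0 = 0"
  using cinner_add_right[of x 0 0] by simp

lemma cinner_scaleC_right: "cinner x (a *\<^sub>C y) = cnj a * cinner x y"
  by (metis cinner_commute cinner_scaleC_left complex_cnj_mult)

lemma cinner_minus_left: "cinner (- x) y = - cinner x y"
  using cinner_add_left[of x "- x" y] by (simp add: add_eq_0_iff)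

lemma cinner_minus_right: "cinner x (- y) = - cinner x y"
  using cinner_add_right[of x y "- y"] by (simp add: add_eq_0_iff)

lemma cinner_diff_left: "cinner (x - y) z = cinner x z - cinner y z"
  using cinner_add_left[of x "- y" z] by (simp add: cinner_minus_left)

lemma cinner_diff_right: "cinner x (y - z) = cinner x y - cinner x z"
  using cinner_add_right[of x y "- z"] by (simp add: cinner_minus_right)

lemma cinner_eq_zero_iff [simp]: "cinner x x = 0 \<longleftrightarrow> x = 0"
  by (simp add: cinner_self)

lemma cinner_zero_commute: "cinner x y = 0 \<longleftrightarrow> cinner y x = 0"
  by (metis cinner_commute complex_cnj_zero)

lemma norm_scaleC: "norm (a *\<^sub>C x) = cmod a * norm (x :: 'h::complex_hilbert)"
proof -
  have "complex_of_real ((norm (a *\<^sub>C x))\<^sup>2) = (a * cnj a) * complex_of_real ((norm x)\<^sup>2)"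
    unfolding cinner_self[symmetric] by (simp add: cinner_scaleC_left cinner_scaleC_right)
  also have "\<dots> = complex_of_real ((cmod a * norm x)\<^sup>2)"
    by (simp add: complex_norm_square[symmetric] power_mult_distrib)
  finally have "(norm (a *\<^sub>C x))\<^sup>2 = (cmod a * norm x)\<^sup>2"
    using of_real_eq_iff by blast
  then show ?thesis by simp
qed

lemma scaleC_minus1: "(- 1) *\<^sub>C x = - (x :: 'h::complex_hilbert)"
  using scaleC_of_real[of "-1" x] by simp

lemma norm_add_square:
  "(norm (x + y :: 'h::complex_hilbert))\<^sup>2 = (norm x)\<^sup>2 + (norm y)\<^sup>2 + 2 * Re (cinner x y)"
proof -
  have "complex_of_real ((norm (x + y))\<^sup>2)
      = complex_of_real ((norm x)\<^sup>2) + complex_of_real ((norm y)\<^sup>2) + (cinner x y + cnj (cinner x y))"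
    unfolding cinner_self[symmetric] cinner_commute[of x y, symmetric]
    by (simp add: cinner_add_left cinner_add_right cinner_commute[of y x])
  also have "\<dots> = complex_of_real ((norm x)\<^sup>2 + (norm y)\<^sup>2 + 2 * Re (cinner x y))"
    by (simp add: complex_add_cnj)
  finally show ?thesis using of_real_eq_iff by blast
qed

lemma norm_diff_square:
  "(norm (x - y :: 'h::complex_hilbert))\<^sup>2 = (norm x)\<^sup>2 + (norm y)\<^sup>2 - 2 * Re (cinner x y)"
  using norm_add_square[of x "- y"] by (simp add: cinner_minus_right)

text \<open>Pythagoras for the component of \<open>r\<close> along \<open>z\<close>: this one identity yields both the
  Cauchy-Schwarz inequality and the orthogonality of a nearest point.\<close>

lemma norm_diff_component:
  assumes "z \<noteq> (0 :: 'h::complex_hilbert)"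
  shows "(norm (r - (cinner r z / (norm z)\<^sup>2) *\<^sub>C z))\<^sup>2
           = (norm r)\<^sup>2 - (cmod (cinner r z))\<^sup>2 / (norm z)\<^sup>2"
proof -
  let ?c = "cinner r z / complex_of_real ((norm z)\<^sup>2)"
  have nz: "(norm z)\<^sup>2 \<noteq> 0" using assms by simp
  have re: "Re (cinner r (?c *\<^sub>C z)) = (cmod (cinner r z))\<^sup>2 / (norm z)\<^sup>2"
  proof -
    have "cinner r (?c *\<^sub>C z) = (cinner r z * cnj (cinner r z)) / complex_of_real ((norm z)\<^sup>2)"
      by (simp add: cinner_scaleC_right)
    also have "\<dots> = complex_of_real ((cmod (cinner r z))\<^sup>2 / (norm z)\<^sup>2)"
      by (simp add: complex_norm_square[symmetric])
    finally show ?thesis by (metis Re_complex_of_real)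
  qed
  have nn: "(norm (?c *\<^sub>C z))\<^sup>2 = (cmod (cinner r z))\<^sup>2 / (norm z)\<^sup>2"
  proof -
    have "cmod ?c = cmod (cinner r z) / (norm z)\<^sup>2"
      by (simp add: norm_divide norm_power)
    then show ?thesis
      using nz unfolding norm_scaleC \<open>cmod ?c = _\<close> by (simp add: power2_eq_square field_simps)
  qed
  show ?thesis
    using norm_diff_square[of r "?c *\<^sub>C z"] re nn by simp
qed

lemma cinner_Cauchy_Schwarz: "cmod (cinner x y) \<le> norm x * norm (y :: 'h::complex_hilbert)"
proof (cases "y = 0")
  case False
  then have "0 \<le> (norm x)\<^sup>2 - (cmod (cinner x y))\<^sup>2 / (norm y)\<^sup>2"
    using norm_diff_component[of y x] by (metis zero_le_power2)
  then have "(cmod (cinner x y))\<^sup>2 \<le> (norm x * norm y)\<^sup>2"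
    using False by (simp add: field_simps power_mult_distrib)
  then show ?thesis by (rule power2_le_imp_le) simp
qed simp

lemma bounded_bilinear_cinner: "bounded_bilinear (cinner :: 'h::complex_hilbert \<Rightarrow> 'h \<Rightarrow> complex)"
proof
  fix a b x y :: 'h and r :: real
  show "cinner (r *\<^sub>R x) y = r *\<^sub>R cinner x y"
    using cinner_scaleC_left[of "complex_of_real r" x y]
    by (simp add: scaleC_of_real scaleR_conv_of_real)
  show "cinner x (r *\<^sub>R y) = r *\<^sub>R cinner x y"
    using cinner_scaleC_right[of x "complex_of_real r" y]
    by (simp add: scaleC_of_real scaleR_conv_of_real)
  show "\<exists>K. \<forall>x y :: 'h. cmod (cinner x y) \<le> norm x * norm y * K"
    by (rule exI[of _ 1]) (simp add: cinner_Cauchy_Schwarz)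
qed (simp_all add: cinner_add_left cinner_add_right)

lemma bounded_linear_scaleC: "bounded_linear (\<lambda>x :: 'h::complex_hilbert. a *\<^sub>C x)"
proof
  fix x y :: 'h and r :: real
  show "a *\<^sub>C (x + y) = a *\<^sub>C x + a *\<^sub>C y" by (rule scaleC_add_right)
  show "a *\<^sub>C r *\<^sub>R x = r *\<^sub>R a *\<^sub>C x"
    by (simp add: scaleC_of_real[symmetric] scaleC_scaleC mult.commute)
  show "\<exists>K. \<forall>x. norm (a *\<^sub>C x :: 'h) \<le> norm x * K"
    by (rule exI[of _ "cmod a"]) (simp add: norm_scaleC mult.commute)
qed

lemma csubspace_iff:
  "csubspace M \<longleftrightarrow> 0 \<in> M \<and> (\<forall>x\<in>M. \<forall>y\<in>M. x + y \<in> M) \<and> (\<forall>c. \<forall>x\<in>M. c *\<^sub>C x \<in> M)"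
  by (rule complex_hilbert.subspace_def)

lemma csubspace_diff: "csubspace M \<Longrightarrow> x \<in> M \<Longrightarrow> y \<in> M \<Longrightarrow> x - y \<in> M"
  by (rule complex_hilbert.subspace_diff)

lemma csubspace_cspan: "csubspace (cspan X)"
  by (rule complex_hilbert.subspace_span)

lemma closed_csubspace_closure_cspan: "closed_csubspace (closure (cspan X))"
  unfolding closed_csubspace_def csubspace_iff
proof (intro conjI ballI allI)
  have s: "csubspace (cspan X)" by (rule csubspace_cspan)
  show "0 \<in> closure (cspan X)"
    using s closure_subset unfolding csubspace_iff by blast
  show "x + y \<in> closure (cspan X)" if "x \<in> closure (cspan X)" "y \<in> closure (cspan X)" for x y
  proof -
    obtain f g where "\<And>n. f n \<in> cspan X" "f \<longlonglongrightarrow> x" "\<And>n. g n \<in> cspan X" "g \<longlonglongrightarrow> y"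
      using \<open>x \<in> _\<close> \<open>y \<in> _\<close> unfolding closure_sequential by blast
    then show ?thesis
      unfolding closure_sequential using s
      by (intro exI[of _ "\<lambda>n. f n + g n"]) (auto simp: csubspace_iff intro: tendsto_add)
  qed
  show "c *\<^sub>C x \<in> closure (cspan X)" if x: "x \<in> closure (cspan X)" for c x
  proof -
    obtain f where "\<And>n. f n \<in> cspan X" "f \<longlonglongrightarrow> x"
      using x unfolding closure_sequential by blast
    then show ?thesis
      unfolding closure_sequential using s bounded_linear.tendsto[OF bounded_linear_scaleC[of c]]
      by (intro exI[of _ "\<lambda>n. c *\<^sub>C f n"]) (auto simp: csubspace_iff)
  qed
qed simp

lemma closure_cspan_minimal:
  "closed_csubspace S \<Longrightarrow> X \<subseteq> S \<Longrightarrow> closure (cspan X) \<subseteq> S"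
  unfolding closed_csubspace_def
  by (intro closure_minimal complex_hilbert.span_minimal) auto

lemma closure_cspan_superset: "X \<subseteq> closure (cspan X)"
  using complex_hilbert.span_superset closure_subset by blast

lemma closed_csubspace_orthogonal:
  "closed_csubspace {x :: 'h::complex_hilbert. \<forall>y\<in>Y. cinner x y = 0}"
proof -
  have "closed {x :: 'h. cinner x y = 0}" for y
    using linear_continuous_on[OF bounded_bilinear.bounded_linear_left[OF bounded_bilinear_cinner]]
      closed_Collect_eq continuous_on_const by blast
  then have "closed (\<Inter>y\<in>Y. {x :: 'h. cinner x y = 0})" by blast
  moreover have "(\<Inter>y\<in>Y. {x :: 'h. cinner x y = 0}) = {x. \<forall>y\<in>Y. cinner x y = 0}" by auto
  ultimately show ?thesis
    unfolding closed_csubspace_def csubspace_iff by (auto simp: cinner_add_left cinner_scaleC_left)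
qed

lemma orthogonal_closure_cspan:
  assumes "\<And>b. b \<in> X \<Longrightarrow> cinner b y = 0" and "x \<in> closure (cspan X)"
  shows "cinner x y = 0"
  using closure_cspan_minimal[OF closed_csubspace_orthogonal[of "{y}"], of X] assms by auto

text \<open>A minimising sequence for the distance from \<open>x\<close> to \<open>M\<close> is Cauchy by the parallelogram law;
  its limit is the nearest point, and moving from it within \<open>M\<close> cannot shorten the difference,
  which is orthogonality.\<close>

lemma projection_exists:
  fixes M :: "'h::complex_hilbert set"
  assumes M: "closed_csubspace M"
  shows "\<exists>y\<in>M. \<forall>z\<in>M. cinner (x - y) z = 0"
proof -
  have sM: "csubspace M" and cM: "closed M" using M by (auto simp: closed_csubspace_def)
  define e where "e = (INF y\<in>M. (norm (x - y))\<^sup>2)"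
  have bdd: "bdd_below ((\<lambda>y. (norm (x - y))\<^sup>2) ` M)" by (rule bdd_belowI[of _ 0]) auto
  have M0: "0 \<in> M" using sM by (simp add: csubspace_iff)
  have e_le: "e \<le> (norm (x - y))\<^sup>2" if "y \<in> M" for y
    unfolding e_def by (rule cINF_lower[OF bdd that])
  have "\<exists>y\<in>M. (norm (x - y))\<^sup>2 < e + 1 / real (Suc n)" for n
  proof -
    have "M \<noteq> {}" using M0 by blast
    from cINF_less_iff[OF this bdd, of "e + 1 / real (Suc n)"] show ?thesis
      unfolding e_def by simp
  qed
  then have "\<forall>n. \<exists>y. y \<in> M \<and> (norm (x - y))\<^sup>2 < e + 1 / real (Suc n)" by blast
  from choice[OF this] obtain Y where
    Y: "\<And>n. Y n \<in> M" "\<And>n. (norm (x - Y n))\<^sup>2 < e + 1 / real (Suc n)" by blast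
  have close: "(norm (Y n - Y m))\<^sup>2 \<le> 2 / real (Suc n) + 2 / real (Suc m)" for m n
  proof -
    have half: "(1/2) *\<^sub>R (Y n + Y m) \<in> M"
      unfolding scaleC_of_real[symmetric] using sM Y(1) by (simp add: csubspace_iff)
    have "(x - Y n) + (x - Y m) = 2 *\<^sub>R (x - (1/2) *\<^sub>R (Y n + Y m))"
      by (simp add: algebra_simps scaleR_2)
    then have "(norm ((x - Y n) + (x - Y m)))\<^sup>2 = 4 * (norm (x - (1/2) *\<^sub>R (Y n + Y m)))\<^sup>2"
      by (simp add: power_mult_distrib)
    then have big: "(norm ((x - Y n) + (x - Y m)))\<^sup>2 \<ge> 4 * e"
      using e_le[OF half] by linarith
    have "(norm (Y n - Y m))\<^sup>2 = (norm ((x - Y m) - (x - Y n)))\<^sup>2" by simp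
    also have "\<dots> = 2 * (norm (x - Y n))\<^sup>2 + 2 * (norm (x - Y m))\<^sup>2 - (norm ((x - Y n) + (x - Y m)))\<^sup>2"
      using norm_diff_square[of "x - Y m" "x - Y n"] norm_add_square[of "x - Y m" "x - Y n"]
      by (simp add: add.commute)
    finally show ?thesis using big Y(2)[of n] Y(2)[of m] by simp
  qed
  have "Cauchy Y"
  proof (rule metric_CauchyI)
    fix d :: real assume "d > 0"
    obtain N where "4 / d\<^sup>2 < real N" using reals_Archimedean2 by blast
    then have N: "4 / d\<^sup>2 < real (Suc N)" by simp
    have "dist (Y m) (Y n) < d" if "m \<ge> N" "n \<ge> N" for m n
    proof -
      have "(norm (Y m - Y n))\<^sup>2 \<le> 2 / real (Suc m) + 2 / real (Suc n)" by (rule close)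
      also have "\<dots> \<le> 2 / real (Suc N) + 2 / real (Suc N)"
        using that by (intro add_mono divide_left_mono) auto
      also have "\<dots> = 4 / real (Suc N)" by (simp add: add_divide_distrib[symmetric])
      also have "\<dots> < d\<^sup>2" using N \<open>d > 0\<close> by (simp add: field_simps del: of_nat_Suc)
      finally have "(norm (Y m - Y n)) < d" using power2_less_imp_less[of "norm (Y m - Y n)" d] \<open>d > 0\<close> by simp
      then show ?thesis by (simp add: dist_norm)
    qed
    then show "\<exists>M. \<forall>m\<ge>M. \<forall>n\<ge>M. dist (Y m) (Y n) < d" by blast
  qed
  then obtain y where lim: "Y \<longlonglongrightarrow> y" by (auto simp: Cauchy_convergent_iff convergent_def)
  have yM: "y \<in> M" by (rule closed_sequentially[OF cM Y(1) lim])
  have "(\<lambda>n. (norm (x - Y n))\<^sup>2) \<longlonglongrightarrow> (norm (x - y))\<^sup>2" by (intro tendsto_intros lim)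
  moreover have "(\<lambda>n. e + 1 / real (Suc n)) \<longlonglongrightarrow> e + 0"
    by (intro tendsto_intros LIMSEQ_Suc[OF lim_1_over_n])
  ultimately have y_min: "(norm (x - y))\<^sup>2 \<le> e"
    using LIMSEQ_le[of "\<lambda>n. (norm (x - Y n))\<^sup>2" _ "\<lambda>n. e + 1 / real (Suc n)" "e + 0"] Y(2)
    by (auto intro: less_imp_le)
  have orth: "cinner (x - y) z = 0" if z: "z \<in> M" for z
  proof (cases "z = 0")
    case False
    let ?c = "cinner (x - y) z / complex_of_real ((norm z)\<^sup>2)"
    have "y + ?c *\<^sub>C z \<in> M" using sM yM z by (simp add: csubspace_iff)
    then have "e \<le> (norm ((x - y) - ?c *\<^sub>C z))\<^sup>2" using e_le[of "y + ?c *\<^sub>C z"] by (simp add: diff_diff_eq)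
    then have "(cmod (cinner (x - y) z))\<^sup>2 / (norm z)\<^sup>2 \<le> 0"
      using norm_diff_component[OF False, of "x - y"] y_min by simp
    then show ?thesis using False by (simp add: divide_le_0_iff)
  qed simp
  show ?thesis by (intro bexI[OF _ yM] ballI orth)
qed

lemma cproj_unique:
  assumes "csubspace M" "y \<in> M" "\<And>z. z \<in> M \<Longrightarrow> cinner (x - y) z = 0"
  shows "cproj M x = y"
  unfolding cproj_def
proof (rule the_equality)
  show "y \<in> M \<and> (\<forall>z\<in>M. cinner (x - y) z = 0)" using assms by blast
  fix y' assume y': "y' \<in> M \<and> (\<forall>z\<in>M. cinner (x - y') z = 0)"
  have d: "y - y' \<in> M" using y' csubspace_diff[OF assms(1,2), of y'] by blast
  have "cinner (y - y') (y - y') = cinner (x - y') (y - y') - cinner (x - y) (y - y')"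
    by (simp add: cinner_diff_left)
  also have "\<dots> = 0" using y' d assms(3)[OF d] by simp
  finally show "y' = y" by simp
qed

lemma cproj:
  assumes "closed_csubspace M"
  shows "cproj M x \<in> M" and "z \<in> M \<Longrightarrow> cinner (x - cproj M x) z = 0"
proof -
  obtain y where y: "y \<in> M" "\<And>z. z \<in> M \<Longrightarrow> cinner (x - y) z = 0"
    using projection_exists[OF assms] by blast
  have "csubspace M" using assms by (simp add: closed_csubspace_def)
  then have eq: "cproj M x = y" using y by (rule cproj_unique)
  show "cproj M x \<in> M" unfolding eq by (rule y(1))
  show "cinner (x - cproj M x) z = 0" if "z \<in> M" unfolding eq by (rule y(2)[OF that])
qed

lemma cinner_cproj: "closed_csubspace M \<Longrightarrow> z \<in> M \<Longrightarrow> cinner (cproj M x) z = cinner x z"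
  using cproj(2)[of M z x] by (simp add: cinner_diff_left)

lemma cproj_eqI:
  assumes "closed_csubspace M" "y \<in> M" "\<And>z. z \<in> M \<Longrightarrow> cinner x z = cinner y z"
  shows "cproj M x = y"
proof (rule cproj_unique)
  show "csubspace M" using assms(1) by (simp add: closed_csubspace_def)
  show "cinner (x - y) z = 0" if "z \<in> M" for z
    using assms(3)[OF that] by (simp add: cinner_diff_left)
qed (rule assms(2))

lemma cproj_id: "closed_csubspace M \<Longrightarrow> x \<in> M \<Longrightarrow> cproj M x = x"
  by (rule cproj_eqI) auto

lemma closed_csubspaceD:
  assumes "closed_csubspace M"
  shows "0 \<in> M" and "x \<in> M \<Longrightarrow> y \<in> M \<Longrightarrow> x + y \<in> M" and "x \<in> M \<Longrightarrow> c *\<^sub>C x \<in> M"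
    and "x \<in> M \<Longrightarrow> y \<in> M \<Longrightarrow> x - y \<in> M"
proof -
  have M: "csubspace M" using assms by (simp add: closed_csubspace_def)
  then show "0 \<in> M" "x \<in> M \<Longrightarrow> y \<in> M \<Longrightarrow> x + y \<in> M" "x \<in> M \<Longrightarrow> c *\<^sub>C x \<in> M"
    unfolding csubspace_iff by blast+
  show "x \<in> M \<Longrightarrow> y \<in> M \<Longrightarrow> x - y \<in> M" using M by (rule csubspace_diff)
qed

lemma cproj_orthogonal:
  assumes "closed_csubspace M" "\<And>z. z \<in> M \<Longrightarrow> cinner x z = 0"
  shows "cproj M x = 0"
  using assms(1) closed_csubspaceD(1)[OF assms(1)] by (rule cproj_eqI) (simp add: assms(2))

lemma cproj_add:
  assumes "closed_csubspace M"
  shows "cproj M (x + y) = cproj M x + cproj M y"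
  using assms closed_csubspaceD(2)[OF assms cproj(1)[OF assms] cproj(1)[OF assms]]
  by (rule cproj_eqI) (simp add: cinner_add_left cinner_cproj[OF assms])

lemma cproj_scaleC:
  assumes "closed_csubspace M"
  shows "cproj M (c *\<^sub>C x) = c *\<^sub>C cproj M x"
  using assms closed_csubspaceD(3)[OF assms cproj(1)[OF assms]]
  by (rule cproj_eqI) (simp add: cinner_scaleC_left cinner_cproj[OF assms])

lemma cproj_sum:
  assumes "closed_csubspace M"
  shows "cproj M (\<Sum>a\<in>A. f a) = (\<Sum>a\<in>A. cproj M (f a))"
  by (induction A rule: infinite_finite_induct)
    (simp_all add: cproj_add[OF assms] cproj_id[OF assms] closed_csubspaceD(1)[OF assms])

lemma norm_cproj_le: 
  assumes "closed_csubspace M"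
  shows "norm (cproj M x) \<le> norm x"
proof -
  have "(norm x)\<^sup>2 = (norm ((x - cproj M x) + cproj M x))\<^sup>2" by simp
  also have "\<dots> = (norm (x - cproj M x))\<^sup>2 + (norm (cproj M x))\<^sup>2"
    unfolding norm_add_square by (simp add: cproj[OF assms])
  finally have "(norm (cproj M x))\<^sup>2 \<le> (norm x)\<^sup>2" by simp
  then show ?thesis by (rule power2_le_imp_le) simp
qed

lemma cadjoint_eq:
  assumes "csubspace M" "y \<in> M" "\<And>z. z \<in> M \<Longrightarrow> cinner (A z) x = cinner z y"
  shows "cadjoint M A x = y"
  unfolding cadjoint_def
proof (rule the_equality)
  show "y \<in> M \<and> (\<forall>z\<in>M. cinner (A z) x = cinner z y)" using assms by blast
  fix y' assume y': "y' \<in> M \<and> (\<forall>z\<in>M. cinner (A z) x = cinner z y')"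
  have d: "y' - y \<in> M" using y' csubspace_diff[OF assms(1) _ assms(2), of y'] by blast
  then have "cinner (y' - y) y' = cinner (y' - y) y" using y' assms(3)[OF d] by simp
  then have "cinner (y' - y) (y' - y) = 0" by (simp add: cinner_diff_right)
  then show "y' = y" by simp
qed

definition isometry :: "('h::complex_hilbert \<Rightarrow> 'h) \<Rightarrow> bool" where
  "isometry V \<longleftrightarrow> bounded_operator UNIV V \<and> (\<forall>x. norm (V x) = norm x)"

lemma bounded_operatorD:
  assumes "bounded_operator UNIV V"
  shows "V (x + y) = V x + V y" and "V (c *\<^sub>C x) = c *\<^sub>C V x" and "V 0 = 0"
    and "bounded_linear V"
proof -
  show add: "V (x + y) = V x + V y" for x y using assms by (simp add: bounded_operator_def)
  show sc: "V (c *\<^sub>C x) = c *\<^sub>C V x" for c x using assms by (simp add: bounded_operator_def)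
  show "V 0 = 0" using add[of 0 0] by simp
  obtain K where K: "\<And>x. norm (V x) \<le> K * norm x" using assms by (auto simp: bounded_operator_def)
  show "bounded_linear V"
  proof (rule bounded_linear_intro)
    show "V (r *\<^sub>R x) = r *\<^sub>R V x" for r x using sc[of "complex_of_real r" x] by (simp add: scaleC_of_real)
    show "norm (V x) \<le> norm x * K" for x using K[of x] by (simp add: mult.commute)
  qed (rule add)
qed

lemma isometry_cinner:
  assumes "isometry V"
  shows "cinner (V x) (V y) = cinner x y"
proof -
  have V: "bounded_operator UNIV V" and n: "\<And>x. norm (V x) = norm x"
    using assms by (auto simp: isometry_def)
  note D = bounded_operatorD[OF V]
  have Re: "Re (cinner (V x) (V y)) = Re (cinner x y)" for x y
    using norm_add_square[of x y] norm_add_square[of "V x" "V y"] n[of x] n[of y] n[of "x + y"]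
    by (simp add: D(1))
  \<comment> \<open>The real part determines the imaginary part, by rotating one argument by \<open>\<i>\<close>.\<close>
  have "Im (cinner (V x) (V y)) = Im (cinner x y)"
    using Re[of x "\<i> *\<^sub>C y"] by (simp add: D(2) cinner_scaleC_right)
  then show ?thesis using Re by (simp add: complex_eq_iff)
qed

text \<open>Completeness makes the range of an isometry closed; projecting onto it and then inverting the
  isometry there gives the vector that witnesses the adjoint.\<close>

lemma isometry_adjoint:
  assumes "isometry V"
  shows "cinner (V z) x = cinner z (cadjoint UNIV V x)"
proof -
  have V: "bounded_operator UNIV V" and n: "\<And>x. norm (V x) = norm x"
    using assms by (auto simp: isometry_def)
  note D = bounded_operatorD[OF V]
  have "complete (range V)"
    using complete_isometric_image[of 1 UNIV V] D(4) n complete_UNIV by simp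
  moreover have "csubspace (range V)"
    unfolding csubspace_iff by (auto simp: D(1,2)[symmetric] intro: rev_image_eqI[of 0] D(3)[symmetric])
  ultimately have R: "closed_csubspace (range V)"
    by (simp add: closed_csubspace_def complete_eq_closed)
  then obtain y where y: "cproj (range V) x = V y" using cproj(1) by blast
  have *: "cinner (V z) x = cinner z y" for z
  proof -
    have "cinner (V z) x = cinner (V z) (V y)"
      using cinner_cproj[OF R, of "V z" x] unfolding y
      by (metis cinner_commute rangeI)
    then show ?thesis by (simp add: isometry_cinner[OF assms])
  qed
  then have "cadjoint UNIV V x = y" by (intro cadjoint_eq) (auto simp: csubspace_iff)
  then show ?thesis using * by simp
qed

section \<open>The semigroup of a single vertex k-graph\<close>

lemma length_eq_sum_word_deg: "length w = (\<Sum>i\<in>UNIV. word_deg w $ i)"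
  for w :: "'k::finite word"
proof (induction w)
  case (Cons l w)
  have "(\<Sum>i\<in>UNIV. word_deg (l # w) $ i)
      = (\<Sum>i\<in>UNIV. (if i = fst l then 1 else 0) + word_deg w $ i)"
    by (intro sum.cong) (auto simp: word_deg_def)
  then show ?case using Cons by (simp add: sum.distrib)
qed (simp add: word_deg_def)

lemma word_deg_append: "word_deg (u @ v) = word_deg u + word_deg v"
  by (simp add: word_deg_def vec_eq_iff)

lemma word_deg_Nil [simp]: "word_deg [] = 0"
  by (simp add: word_deg_def vec_eq_iff)

lemma word_deg_single [simp]: "word_deg [(i, s)] = axis i 1"
  by (auto simp: word_deg_def vec_eq_iff axis_def)

lemma finite_letters: "finite (letters (\<Gamma> :: 'k::finite presentation))"
proof -
  have "letters \<Gamma> = (SIGMA i:UNIV. {1..num \<Gamma> i})" by (auto simp: letters_def)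
  then show ?thesis by simp
qed

lemma swaps_word_deg: "(x, y) \<in> swaps \<Gamma> \<Longrightarrow> word_deg x = word_deg y"
  by (induction rule: swaps.induct) (auto simp: word_deg_def vec_eq_iff)

lemma swaps_length: "(x, y) \<in> swaps \<Gamma> \<Longrightarrow> length x \<ge> 2 \<and> length y \<ge> 2"
  by (induction rule: swaps.induct) auto

lemma swaps_context:
  assumes "(x, y) \<in> swaps \<Gamma>" "a \<in> lists (letters \<Gamma>)" "b \<in> lists (letters \<Gamma>)"
  shows "(a @ x @ b, a @ y @ b) \<in> swaps \<Gamma>"
  using assms(1)
proof cases
  case (1 i j s t s' t' u v)
  have "((a @ u) @ [(i, s), (j, t)] @ (v @ b), (a @ u) @ [(j, t'), (i, s')] @ (v @ b)) \<in> swaps \<Gamma>"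
    by (rule swaps.intros[OF 1(3-6)]) (use 1(7,8) assms(2,3) in \<open>simp_all only: append_in_lists_conv\<close>)
  then show ?thesis unfolding 1(1,2) by (simp only: append_assoc)
qed

lemma word_eq_context:
  assumes "(x, y) \<in> word_eq \<Gamma>" "a \<in> lists (letters \<Gamma>)" "b \<in> lists (letters \<Gamma>)"
  shows "(a @ x @ b, a @ y @ b) \<in> word_eq \<Gamma>"
proof -
  let ?S = "swaps \<Gamma> \<union> (swaps \<Gamma>)\<inverse>"
  have "(x, y) \<in> ?S\<^sup>*" using assms(1) by (auto simp: word_eq_def)
  then have "(a @ x @ b, a @ y @ b) \<in> ?S\<^sup>*"
  proof (induction rule: rtrancl_induct)
    case (step y z)
    have "(a @ y @ b, a @ z @ b) \<in> ?S"
      using step(2) swaps_context[OF _ assms(2,3)] by auto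
    then show ?case using step(3) by (rule rtrancl_into_rtrancl[rotated])
  qed simp
  then show ?thesis using assms by (auto simp: word_eq_def)
qed

lemma equiv_word_eq: "equiv (lists (letters \<Gamma>)) (word_eq \<Gamma>)"
proof (rule equivI)
  have "sym ((swaps \<Gamma> \<union> (swaps \<Gamma>)\<inverse>)\<^sup>*)"
    by (intro sym_rtrancl) (auto simp: sym_def)
  then show "sym (word_eq \<Gamma>)" unfolding word_eq_def by (auto simp: sym_def)
  show "trans (word_eq \<Gamma>)" unfolding word_eq_def by (auto simp: trans_def intro: rtrancl_trans)
qed (auto simp: word_eq_def refl_on_def)

lemma wclass_eq_iff:
  "x \<in> lists (letters \<Gamma>) \<Longrightarrow> y \<in> lists (letters \<Gamma>) \<Longrightarrow>
     wclass \<Gamma> x = wclass \<Gamma> y \<longleftrightarrow> (x, y) \<in> word_eq \<Gamma>"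
  unfolding wclass_def by (rule eq_equiv_class_iff[OF equiv_word_eq])

lemma wclass_carrier: "x \<in> lists (letters \<Gamma>) \<Longrightarrow> wclass \<Gamma> x \<in> carrier (FF \<Gamma>)"
  by (simp add: FF_def wclass_def quotientI)

lemma FF_cases:
  assumes "X \<in> carrier (FF \<Gamma>)"
  obtains x where "x \<in> lists (letters \<Gamma>)" "X = wclass \<Gamma> x"
  using assms by (auto simp: FF_def wclass_def elim!: quotientE)

lemma wclass_mult:
  assumes "x \<in> lists (letters \<Gamma>)" "y \<in> lists (letters \<Gamma>)"
  shows "wclass \<Gamma> x \<otimes>\<^bsub>FF \<Gamma>\<^esub> wclass \<Gamma> y = wclass \<Gamma> (x @ y)"
proof -
  have "congruent2 (word_eq \<Gamma>) (word_eq \<Gamma>) (\<lambda>x y. wclass \<Gamma> (x @ y))"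
  proof (rule congruent2I')
    fix y1 z1 y2 z2 assume "(y1, z1) \<in> word_eq \<Gamma>" "(y2, z2) \<in> word_eq \<Gamma>"
    moreover from this have l: "y1 \<in> lists (letters \<Gamma>)" "z1 \<in> lists (letters \<Gamma>)"
        "y2 \<in> lists (letters \<Gamma>)" "z2 \<in> lists (letters \<Gamma>)"
      by (auto simp: word_eq_def)
    ultimately have "(y1 @ y2, z1 @ y2) \<in> word_eq \<Gamma>" "(z1 @ y2, z1 @ z2) \<in> word_eq \<Gamma>"
      using word_eq_context[of y1 z1 \<Gamma> "[]" y2] word_eq_context[of y2 z2 \<Gamma> z1 "[]"] by auto
    then have "(y1 @ y2, z1 @ z2) \<in> word_eq \<Gamma>"
      using equiv_word_eq[of \<Gamma>] by (meson equiv_def transD)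
    then show "wclass \<Gamma> (y1 @ y2) = wclass \<Gamma> (z1 @ z2)"
      using l by (subst wclass_eq_iff) auto
  qed
  from UN_equiv_class2[OF equiv_word_eq equiv_word_eq this assms]
  show ?thesis by (simp add: FF_def wclass_def)
qed

lemma FF_one: "\<one>\<^bsub>FF \<Gamma>\<^esub> = wclass \<Gamma> []" by (simp add: FF_def)

lemma monoid_FF: "monoid (FF \<Gamma>)"
proof
  fix x y z assume x: "x \<in> carrier (FF \<Gamma>)"
  obtain x' where x': "x' \<in> lists (letters \<Gamma>)" "x = wclass \<Gamma> x'" using x by (rule FF_cases)
  show "\<one>\<^bsub>FF \<Gamma>\<^esub> \<otimes>\<^bsub>FF \<Gamma>\<^esub> x = x" "x \<otimes>\<^bsub>FF \<Gamma>\<^esub> \<one>\<^bsub>FF \<Gamma>\<^esub> = x"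
    using x' by (simp_all add: FF_one wclass_mult)
  assume "y \<in> carrier (FF \<Gamma>)"
  then obtain y' where y': "y' \<in> lists (letters \<Gamma>)" "y = wclass \<Gamma> y'" by (rule FF_cases)
  show "x \<otimes>\<^bsub>FF \<Gamma>\<^esub> y \<in> carrier (FF \<Gamma>)"
    using x' y' by (simp add: wclass_mult wclass_carrier)
  assume "z \<in> carrier (FF \<Gamma>)"
  then obtain z' where z': "z' \<in> lists (letters \<Gamma>)" "z = wclass \<Gamma> z'" by (rule FF_cases)
  show "x \<otimes>\<^bsub>FF \<Gamma>\<^esub> y \<otimes>\<^bsub>FF \<Gamma>\<^esub> z = x \<otimes>\<^bsub>FF \<Gamma>\<^esub> (y \<otimes>\<^bsub>FF \<Gamma>\<^esub> z)"
    using x' y' z' by (simp add: wclass_mult)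
qed (simp add: FF_one wclass_carrier)

lemma word_eq_word_deg: "(x, y) \<in> word_eq \<Gamma> \<Longrightarrow> word_deg x = word_deg y"
proof -
  assume "(x, y) \<in> word_eq \<Gamma>"
  then have "(x, y) \<in> (swaps \<Gamma> \<union> (swaps \<Gamma>)\<inverse>)\<^sup>*" by (simp add: word_eq_def)
  then show ?thesis by (induction rule: rtrancl_induct) (auto dest: swaps_word_deg)
qed

lemma deg_wclass:
  assumes "x \<in> lists (letters \<Gamma>)"
  shows "deg (wclass \<Gamma> x) = word_deg x"
proof -
  have "x \<in> wclass \<Gamma> x" using assms by (auto simp: wclass_def word_eq_def)
  then have "(SOME w. w \<in> wclass \<Gamma> x) \<in> wclass \<Gamma> x" by (metis someI)
  then show ?thesis by (auto simp: deg_def wclass_def dest: word_eq_word_deg)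
qed

lemma gen_carrier: "s \<in> {1..num \<Gamma> i} \<Longrightarrow> gen \<Gamma> i s \<in> carrier (FF \<Gamma>)"
  by (rule wclass_carrier) (simp add: letters_def)

lemma deg_gen: "s \<in> {1..num \<Gamma> i} \<Longrightarrow> deg (gen \<Gamma> i s) = axis i 1"
  by (subst deg_wclass) (auto simp: letters_def)

lemma deg_mult:
  assumes "X \<in> carrier (FF \<Gamma>)" "Y \<in> carrier (FF \<Gamma>)"
  shows "deg (X \<otimes>\<^bsub>FF \<Gamma>\<^esub> Y) = deg X + deg Y"
proof -
  obtain x y where "x \<in> lists (letters \<Gamma>)" "X = wclass \<Gamma> x" "y \<in> lists (letters \<Gamma>)" "Y = wclass \<Gamma> y"
    using assms by (meson FF_cases)
  then show ?thesis by (simp add: wclass_mult deg_wclass word_deg_append)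
qed

lemma deg_one: "deg \<one>\<^bsub>FF \<Gamma>\<^esub> = 0"
  unfolding FF_one by (subst deg_wclass) auto

lemma deg_zero_imp_one:
  assumes "X \<in> carrier (FF \<Gamma>)" "deg X = 0"
  shows "X = \<one>\<^bsub>FF \<Gamma>\<^esub>"
proof -
  obtain x where x: "x \<in> lists (letters \<Gamma>)" "X = wclass \<Gamma> x" using assms(1) by (rule FF_cases)
  then have "word_deg x = 0" using assms by (simp add: deg_wclass)
  then have "length x = 0" by (simp add: length_eq_sum_word_deg)
  then show ?thesis using x by (simp add: FF_one)
qed

lemma deg_axis_imp_gen:
  assumes "X \<in> carrier (FF \<Gamma>)" "deg X = axis i 1"
  shows "\<exists>s\<in>{1..num \<Gamma> i}. X = gen \<Gamma> i s"
proof -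
  obtain x where x: "x \<in> lists (letters \<Gamma>)" "X = wclass \<Gamma> x" using assms(1) by (rule FF_cases)
  then have d: "word_deg x = axis i 1" using assms by (simp add: deg_wclass)
  then have "length x = 1" by (simp add: length_eq_sum_word_deg axis_def sum.delta)
  then obtain j s where js: "x = [(j, s)]" by (cases x) auto
  with d have "axis j (1::nat) = axis i 1" by simp
  then have "j = i" by (simp add: axis_eq_axis)
  then show ?thesis using x js by (auto simp: letters_def)
qed

text \<open>A defining relation needs two letters, so it cannot identify generators.\<close>

lemma gen_inject:
  assumes "s \<in> {1..num \<Gamma> i}" "t \<in> {1..num \<Gamma> i}" "gen \<Gamma> i s = gen \<Gamma> i t"
  shows "s = t"
proof -
  have "([(i, s)], [(i, t)]) \<in> word_eq \<Gamma>"
    using assms by (subst wclass_eq_iff[symmetric]) (auto simp: letters_def)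
  then have "([(i, s)], [(i, t)]) \<in> (swaps \<Gamma> \<union> (swaps \<Gamma>)\<inverse>)\<^sup>*" by (simp add: word_eq_def)
  then have "[(i, t)] = [(i, s)]"
    by (cases rule: converse_rtranclE) (auto dest: swaps_length)
  then show ?thesis by simp
qed

lemma finite_degree: "finite {X \<in> carrier (FF \<Gamma>). deg X = n}"
proof (rule finite_subset)
  show "{X \<in> carrier (FF \<Gamma>). deg X = n}
      \<subseteq> wclass \<Gamma> ` {w. set w \<subseteq> letters \<Gamma> \<and> length w = (\<Sum>i\<in>UNIV. n $ i)}"
  proof
    fix X assume X: "X \<in> {X \<in> carrier (FF \<Gamma>). deg X = n}"
    then obtain x where x: "x \<in> lists (letters \<Gamma>)" "X = wclass \<Gamma> x" by (auto elim: FF_cases)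
    then show "X \<in> wclass \<Gamma> ` {w. set w \<subseteq> letters \<Gamma> \<and> length w = (\<Sum>i\<in>UNIV. n $ i)}"
      using X by (auto simp: deg_wclass length_eq_sum_word_deg)
  qed
  show "finite (wclass \<Gamma> ` {w. set w \<subseteq> letters \<Gamma> \<and> length w = (\<Sum>i\<in>UNIV. n $ i)})"
    by (intro finite_imageI finite_lists_length_eq finite_letters)
qed

lemma factorization_exists:
  assumes "single_vertex_kgraph \<Gamma>" "w \<in> carrier (FF \<Gamma>)" "deg w = a + b"
  obtains u v where "u \<in> carrier (FF \<Gamma>)" "v \<in> carrier (FF \<Gamma>)" "w = u \<otimes>\<^bsub>FF \<Gamma>\<^esub> v" "deg u = a" "deg v = b"
  using assms unfolding single_vertex_kgraph_def by (metis mem_Times_iff)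

text \<open>Equal total degree forces the right factors to have equal degrees too.\<close>

lemma factorization_unique:
  assumes "single_vertex_kgraph \<Gamma>"
    and "u \<in> carrier (FF \<Gamma>)" "v \<in> carrier (FF \<Gamma>)" "u' \<in> carrier (FF \<Gamma>)" "v' \<in> carrier (FF \<Gamma>)"
    and "u \<otimes>\<^bsub>FF \<Gamma>\<^esub> v = u' \<otimes>\<^bsub>FF \<Gamma>\<^esub> v'" and "deg u = deg u'"
  shows "u = u'" "v = v'"
proof -
  interpret monoid "FF \<Gamma>" by (rule monoid_FF)
  have "deg u + deg v = deg u' + deg v'"
    using deg_mult[OF assms(2,3)] deg_mult[OF assms(4,5)] assms(6) by simp
  then have dv: "deg v = deg v'" using assms by simp
  let ?w = "u \<otimes>\<^bsub>FF \<Gamma>\<^esub> v"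
  have "?w \<in> carrier (FF \<Gamma>)" using assms(2,3) by (rule m_closed)
  moreover have "deg ?w = deg u + deg v" using assms(2,3) by (rule deg_mult)
  ultimately have "\<exists>!p. p \<in> carrier (FF \<Gamma>) \<times> carrier (FF \<Gamma>) \<and>
      ?w = fst p \<otimes>\<^bsub>FF \<Gamma>\<^esub> snd p \<and> deg (fst p) = deg u \<and> deg (snd p) = deg v"
    using assms(1) unfolding single_vertex_kgraph_def by blast
  then have "(u, v) = (u', v')"
    by (rule ex1E) (metis (no_types, lifting) assms dv fst_conv mem_Sigma_iff snd_conv)
  then show "u = u'" "v = v'" by auto
qed

lemma FF_induct [consumes 1, case_names one gen_mult]:
  assumes "X \<in> carrier (FF \<Gamma>)" and one: "P \<one>\<^bsub>FF \<Gamma>\<^esub>"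
    and step: "\<And>i s Y. s \<in> {1..num \<Gamma> i} \<Longrightarrow> Y \<in> carrier (FF \<Gamma>) \<Longrightarrow> P Y \<Longrightarrow>
      P (gen \<Gamma> i s \<otimes>\<^bsub>FF \<Gamma>\<^esub> Y)"
  shows "P X"
proof -
  have "P (wclass \<Gamma> w)" if "w \<in> lists (letters \<Gamma>)" for w
    using that
  proof (induction w)
    case Nil
    then show ?case using one by (simp add: FF_one)
  next
    case (Cons l w)
    obtain i s where l: "l = (i, s)" by fastforce
    have s: "s \<in> {1..num \<Gamma> i}" using Cons(1) l by (auto simp: letters_def)
    have w: "wclass \<Gamma> w \<in> carrier (FF \<Gamma>)" using Cons(2) by (rule wclass_carrier)
    have "gen \<Gamma> i s \<otimes>\<^bsub>FF \<Gamma>\<^esub> wclass \<Gamma> w = wclass \<Gamma> (l # w)"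
      using wclass_mult[of "[l]" \<Gamma> w] Cons(1,2) unfolding l by simp
    then show ?case using step[OF s w Cons(3)] by simp
  qed
  moreover obtain w where "w \<in> lists (letters \<Gamma>)" "X = wclass \<Gamma> w"
    using assms(1) by (rule FF_cases)
  ultimately show ?thesis by simp
qed

lemma NNk_induct [case_names zero add]:
  fixes n :: "'k::finite NNk"
  assumes "P 0" and step: "\<And>n i. P n \<Longrightarrow> P (n + axis i 1)"
  shows "P n"
proof (induction "\<Sum>i\<in>UNIV. n $ i" arbitrary: n)
  case 0
  then have "n = 0" by (simp add: vec_eq_iff)
  then show ?case using assms(1) by simp
next
  case (Suc N)
  then obtain i where i: "n $ i \<noteq> 0" by (metis nat.distinct(1) sum.neutral)
  define n' where "n' = (\<chi> j. if j = i then n $ i - 1 else n $ j)"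
  have n: "n = n' + axis i 1" using i by (auto simp: vec_eq_iff n'_def axis_def)
  have "(\<Sum>j\<in>UNIV. n $ j) = (\<Sum>j\<in>UNIV. n' $ j + (if j = i then 1 else 0))"
    unfolding n by (intro sum.cong) (auto simp: axis_def)
  then have "N = (\<Sum>j\<in>UNIV. n' $ j)" using Suc(2) by (simp add: sum.distrib)
  then show ?case unfolding n by (intro step Suc(1))
qed

section \<open>Subgroups of lattices and their characters\<close>

definition additive_subgroup :: "'a::ab_group_add set \<Rightarrow> bool" where
  "additive_subgroup A \<longleftrightarrow> 0 \<in> A \<and> (\<forall>x\<in>A. \<forall>y\<in>A. x - y \<in> A)"

lemma additive_subgroupD:
  assumes "additive_subgroup A"
  shows "0 \<in> A" and "x \<in> A \<Longrightarrow> y \<in> A \<Longrightarrow> x - y \<in> A" and "x \<in> A \<Longrightarrow> - x \<in> A"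
    and "x \<in> A \<Longrightarrow> y \<in> A \<Longrightarrow> x + y \<in> A"
proof -
  show "0 \<in> A" and d: "x \<in> A \<Longrightarrow> y \<in> A \<Longrightarrow> x - y \<in> A" for x y
    using assms by (auto simp: additive_subgroup_def)
  show n: "x \<in> A \<Longrightarrow> - x \<in> A" for x using d[of 0 x] \<open>0 \<in> A\<close> by simp
  show "x \<in> A \<Longrightarrow> y \<in> A \<Longrightarrow> x + y \<in> A" using d[of x "- y"] n[of y] by simp
qed

lemma additive_subgroup_smult:
  assumes "additive_subgroup A" "x \<in> A"
  shows "(n :: int) *s x \<in> A"
proof (induction n rule: int_induct[where k = 0])
  case base
  then show ?case using additive_subgroupD(1)[OF assms(1)] by simp
next
  case (step1 n)
  have "(n + 1) *s x = n *s x + x" by (simp add: vec_eq_iff algebra_simps)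
  then show ?case using step1 assms additive_subgroupD(4) by metis
next
  case (step2 n)
  have "(n - 1) *s x = n *s x - x" by (simp add: vec_eq_iff algebra_simps)
  then show ?case using step2 assms additive_subgroupD(2) by metis
qed

lemma additive_subgroup_sum:
  "additive_subgroup A \<Longrightarrow> (\<And>i. i \<in> I \<Longrightarrow> f i \<in> A) \<Longrightarrow> sum f I \<in> A"
  by (induction I rule: infinite_finite_induct) (auto simp: additive_subgroupD)

lemma int_subgroup_generator:
  assumes A: "additive_subgroup (A :: int set)"
  shows "\<exists>d\<in>A. d \<ge> 0 \<and> (\<forall>a\<in>A. d dvd a)"
proof (cases "A = {0}")
  case False
  define d where "d = (LEAST n :: nat. n > 0 \<and> int n \<in> A)"
  obtain a where "a \<in> A" "a \<noteq> 0" using False additive_subgroupD(1)[OF A] by blast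
  then have "nat \<bar>a\<bar> > 0 \<and> int (nat \<bar>a\<bar>) \<in> A"
    using additive_subgroupD(3)[OF A, of a] by (auto simp: abs_if)
  then have d: "d > 0 \<and> int d \<in> A" unfolding d_def by (rule LeastI)
  have "int d dvd a" if "a \<in> A" for a
  proof -
    have "q * int d \<in> A" for q
    proof (induction q rule: int_induct[where k = 0])
      case base then show ?case using additive_subgroupD(1)[OF A] by simp
    next
      case (step1 i)
      then show ?case using d additive_subgroupD(4)[OF A, of "i * int d" "int d"]
        by (simp add: algebra_simps)
    next
      case (step2 i)
      then show ?case using d additive_subgroupD(2)[OF A, of "i * int d" "int d"]
        by (simp add: algebra_simps)
    qed
    then have "a - (a div int d) * int d \<in> A" using additive_subgroupD(2)[OF A that] by blast
    then have m: "a mod int d \<in> A" by (simp add: minus_div_mult_eq_mod)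
    have "a mod int d = 0"
    proof (rule ccontr)
      assume "a mod int d \<noteq> 0"
      then have "nat (a mod int d) > 0 \<and> int (nat (a mod int d)) \<in> A"
        using m d by (simp add: order_le_neq_trans)
      then have "d \<le> nat (a mod int d)" unfolding d_def by (rule Least_le)
      then show False using pos_mod_bound[of "int d" a] d by linarith
    qed
    then show ?thesis by auto
  qed
  then show ?thesis using d by (intro bexI[of _ "int d"]) auto
qed auto

text \<open>Subgroups of \<open>\<int>\<^sup>k\<close> are finitely generated, by induction on the coordinates: the values of
  one coordinate form a cyclic group, and a vector attaining its generator reduces everything to the
  vectors vanishing in that coordinate.\<close>

lemma additive_subgroup_finitely_generated:
  assumes "additive_subgroup (A :: (int ^ 'k::finite) set)"
  obtains F where "finite F" "F \<subseteq> A" "\<And>P. additive_subgroup P \<Longrightarrow> F \<subseteq> P \<Longrightarrow> A \<subseteq> P"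
proof -
  have "\<forall>A. additive_subgroup A \<longrightarrow> A \<subseteq> {v :: int ^ 'k. \<forall>i. i \<notin> S \<longrightarrow> v $ i = 0} \<longrightarrow>
      (\<exists>F. finite F \<and> F \<subseteq> A \<and> (\<forall>P. additive_subgroup P \<longrightarrow> F \<subseteq> P \<longrightarrow> A \<subseteq> P))"
    if "finite S" for S
    using that
  proof (induction S rule: finite_induct)
    case empty
    show ?case
    proof (intro allI impI)
      fix A :: "(int ^ 'k) set"
      assume "A \<subseteq> {v. \<forall>i. i \<notin> {} \<longrightarrow> v $ i = 0}"
      then have "A \<subseteq> {0}" by (auto simp: vec_eq_iff)
      then show "\<exists>F. finite F \<and> F \<subseteq> A \<and> (\<forall>P. additive_subgroup P \<longrightarrow> F \<subseteq> P \<longrightarrow> A \<subseteq> P)"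
        by (intro exI[of _ "{}"]) (auto dest: additive_subgroupD(1))
    qed
  next
    case (insert i S)
    show ?case
    proof (intro allI impI)
      fix A :: "(int ^ 'k) set"
      assume A: "additive_subgroup A" and sub: "A \<subseteq> {v. \<forall>j. j \<notin> insert i S \<longrightarrow> v $ j = 0}"
      define A0 where "A0 = {v \<in> A. v $ i = 0}"
      have A0: "additive_subgroup A0"
        using additive_subgroupD(1,2)[OF A] by (auto simp: A0_def additive_subgroup_def)
      have sub0: "A0 \<subseteq> {v. \<forall>j. j \<notin> S \<longrightarrow> v $ j = 0}" using sub by (auto simp: A0_def)
      obtain F where F: "finite F" "F \<subseteq> A0" "\<And>P. additive_subgroup P \<Longrightarrow> F \<subseteq> P \<Longrightarrow> A0 \<subseteq> P"
        using insert.IH[THEN spec, THEN mp, OF A0, THEN mp, OF sub0] by blast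
      have "additive_subgroup ((\<lambda>v. v $ i) ` A)"
        unfolding additive_subgroup_def
      proof (intro conjI ballI)
        show "0 \<in> (\<lambda>v. v $ i) ` A"
          using additive_subgroupD(1)[OF A] by (intro image_eqI[of _ _ 0]) auto
        fix x y assume "x \<in> (\<lambda>v. v $ i) ` A" "y \<in> (\<lambda>v. v $ i) ` A"
        then obtain v w where "v \<in> A" "w \<in> A" "x = v $ i" "y = w $ i" by blast
        then show "x - y \<in> (\<lambda>v. v $ i) ` A"
          using additive_subgroupD(2)[OF A, of v w] by (intro image_eqI[of _ _ "v - w"]) auto
      qed
      from int_subgroup_generator[OF this]
      obtain a where a: "a \<in> A" "\<And>v. v \<in> A \<Longrightarrow> a $ i dvd v $ i" by blast
      have "A \<subseteq> P" if P: "additive_subgroup P" "insert a F \<subseteq> P" for P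
      proof
        fix v assume v: "v \<in> A"
        obtain q where q: "v $ i = a $ i * q" using a(2)[OF v] by (auto simp: dvd_def)
        have "v - q *s a \<in> A0"
          using additive_subgroupD(2)[OF A v additive_subgroup_smult[OF A a(1)]] q
          by (simp add: A0_def)
        moreover have "A0 \<subseteq> P" using F(3)[OF P(1)] P(2) by blast
        ultimately have "v - q *s a \<in> P" by blast
        moreover have "q *s a \<in> P" using P(2) by (intro additive_subgroup_smult[OF P(1)]) auto
        ultimately have "(v - q *s a) + q *s a \<in> P" by (rule additive_subgroupD(4)[OF P(1)])
        then show "v \<in> P" by simp
      qed
      then show "\<exists>F. finite F \<and> F \<subseteq> A \<and> (\<forall>P. additive_subgroup P \<longrightarrow> F \<subseteq> P \<longrightarrow> A \<subseteq> P)"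
        using F a(1) by (intro exI[of _ "insert a F"]) (auto simp: A0_def)
    qed
  qed
  from this[of UNIV] obtain F where "finite F" "F \<subseteq> A"
      "\<forall>P. additive_subgroup P \<longrightarrow> F \<subseteq> P \<longrightarrow> A \<subseteq> P"
    using assms by auto
  then show ?thesis by (intro that[of F]) auto
qed

lemma additive_subgroup_UNIV:
  fixes A :: "(int ^ 'k::finite) set"
  assumes "additive_subgroup A" "\<And>i. axis i 1 \<in> A"
  shows "v \<in> A"
proof -
  have "(\<Sum>i\<in>UNIV. (v $ i) *s axis i 1) \<in> A"
    using assms by (intro additive_subgroup_sum additive_subgroup_smult)
  then show ?thesis by (simp add: basis_expansion)
qed

definition unit_character_on :: "'a::ab_group_add set \<Rightarrow> ('a \<Rightarrow> complex) \<Rightarrow> bool" where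
  "unit_character_on K c \<longleftrightarrow>
     (\<forall>p\<in>K. cmod (c p) = 1) \<and> (\<forall>p\<in>K. \<forall>q\<in>K. c (p + q) = c p * c q)"

lemma unit_character_zero:
  "additive_subgroup K \<Longrightarrow> unit_character_on K c \<Longrightarrow> c 0 = 1"
  unfolding unit_character_on_def
  by (metis add_0 additive_subgroupD(1) mult_cancel_left2 norm_zero zero_neq_one)

text \<open>The multiples of \<open>e\<close> in \<open>K\<close> are those of some \<open>d *s e\<close>, so the only constraint on the value at
  \<open>e\<close> is that its \<open>d\<close>-th power is prescribed.  The circle is divisible, hence such a value exists.\<close>

lemma unit_character_extend_step:
  fixes K :: "(int ^ 'k::finite) set"
  assumes K: "additive_subgroup K" and c: "unit_character_on K c"
  obtains L where "unit_character_on {v. \<exists>n. v - n *s e \<in> K} L" "\<And>p. p \<in> K \<Longrightarrow> L p = c p"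
proof -
  have mult: "c (p + q) = c p * c q" if "p \<in> K" "q \<in> K" for p q
    using c that by (auto simp: unit_character_on_def)
  have cmod1: "cmod (c p) = 1" if "p \<in> K" for p using c that by (auto simp: unit_character_on_def)
  have "additive_subgroup {n. n *s e \<in> K}"
    using additive_subgroupD(1,2)[OF K]
    by (auto simp: additive_subgroup_def vector_ssub_ldistrib vec.scale_left_diff_distrib)
  then obtain d where d: "d *s e \<in> K" "d \<ge> 0" "\<And>n. n *s e \<in> K \<Longrightarrow> d dvd n"
    using int_subgroup_generator by blast
  define \<theta> where "\<theta> = Arg (c (d *s e)) / of_int d"
  have cis_d: "c (d *s e) = cis (of_int d * \<theta>)"
  proof (cases "d = 0")
    case True
    then show ?thesis using unit_character_zero[OF K c] by simp
  next
    case False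
    have "c (d *s e) \<noteq> 0" using cmod1[OF d(1)] by auto
    then have "cis (Arg (c (d *s e))) = c (d *s e)"
      using cmod1[OF d(1)] by (simp add: cis_Arg sgn_div_norm)
    then show ?thesis using False by (simp add: \<theta>_def)
  qed
  have cis_qd: "c ((q * d) *s e) = cis (of_int (q * d) * \<theta>)" for q
  proof (induction q rule: int_induct[where k = 0])
    case base
    then show ?case using unit_character_zero[OF K c] by simp
  next
    case (step1 q)
    have "((q + 1) * d) *s e = (q * d) *s e + d *s e" by (simp add: vec_eq_iff algebra_simps)
    moreover have "(q * d) *s e \<in> K"
      using additive_subgroup_smult[OF K d(1), of q] by (simp add: vector_smult_assoc)
    ultimately show ?case using mult[of "(q * d) *s e" "d *s e"] step1 d(1) cis_d
      by (simp add: cis_mult algebra_simps)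
  next
    case (step2 q)
    have "(q * d) *s e = ((q - 1) * d) *s e + d *s e" by (simp add: vec_eq_iff algebra_simps)
    moreover have "((q - 1) * d) *s e \<in> K"
      using additive_subgroup_smult[OF K d(1), of "q - 1"] by (simp add: vector_smult_assoc)
    ultimately have "c ((q - 1) * d *s e) * cis (of_int d * \<theta>) = cis (of_int (q * d) * \<theta>)"
      using mult[of "((q - 1) * d) *s e" "d *s e"] step2 d(1) cis_d by simp
    also have "\<dots> = cis (of_int ((q - 1) * d) * \<theta>) * cis (of_int d * \<theta>)"
      by (simp add: cis_mult algebra_simps)
    finally show ?case by simp
  qed
  have cis_n: "c (n *s e) = cis (of_int n * \<theta>)" if "n *s e \<in> K" for n
    using d(3)[OF that] cis_qd by (metis dvd_div_mult_self)
  define L where "L v = (let n = SOME n. v - n *s e \<in> K in c (v - n *s e) * cis (of_int n * \<theta>))" for v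
  have L: "L v = c (v - n *s e) * cis (of_int n * \<theta>)" if n: "v - n *s e \<in> K" for v n
  proof -
    define m where "m = (SOME n. v - n *s e \<in> K)"
    have m: "v - m *s e \<in> K" unfolding m_def using n by (rule someI)
    have "(v - m *s e) - (v - n *s e) = (n - m) *s e" by (simp add: vec_eq_iff algebra_simps)
    then have nm: "(n - m) *s e \<in> K" using additive_subgroupD(2)[OF K m n] by simp
    have "v - m *s e = (v - n *s e) + (n - m) *s e" by (simp add: vec_eq_iff algebra_simps)
    then have "c (v - m *s e) = c (v - n *s e) * cis (of_int (n - m) * \<theta>)"
      using mult[OF n nm] cis_n[OF nm] by simp
    then have "L v = c (v - n *s e) * (cis (of_int (n - m) * \<theta>) * cis (of_int m * \<theta>))"
      by (simp add: L_def m_def[symmetric])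
    also have "cis (of_int (n - m) * \<theta>) * cis (of_int m * \<theta>) = cis (of_int n * \<theta>)"
      by (simp add: cis_mult algebra_simps)
    finally show ?thesis .
  qed
  show ?thesis
  proof (rule that[of L])
    show "L p = c p" if "p \<in> K" for p using L[of p 0] that by simp
    show "unit_character_on {v. \<exists>n. v - n *s e \<in> K} L"
      unfolding unit_character_on_def
    proof (intro conjI ballI)
      fix p q assume "p \<in> {v. \<exists>n. v - n *s e \<in> K}" "q \<in> {v. \<exists>n. v - n *s e \<in> K}"
      then obtain n m where nm: "p - n *s e \<in> K" "q - m *s e \<in> K" by blast
      show "cmod (L p) = 1" using L[OF nm(1)] cmod1[OF nm(1)] by (simp add: norm_mult)
      have eq: "p + q - (n + m) *s e = (p - n *s e) + (q - m *s e)"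
        by (simp add: vec_eq_iff algebra_simps)
      have "p + q - (n + m) *s e \<in> K" unfolding eq by (rule additive_subgroupD(4)[OF K nm])
      then have "L (p + q) = c (p + q - (n + m) *s e) * cis (of_int (n + m) * \<theta>)" by (rule L)
      then show "L (p + q) = L p * L q"
        unfolding eq mult[OF nm] L[OF nm(1)] L[OF nm(2)] by (simp add: cis_mult[symmetric] distrib_right)
    qed
  qed
qed

lemma unit_character_extends:
  fixes K :: "(int ^ 'k::finite) set"
  assumes "additive_subgroup K" "unit_character_on K c"
  obtains L where "unit_character_on UNIV L" "\<And>p. p \<in> K \<Longrightarrow> L p = c p"
proof -
  have "\<exists>K' L. additive_subgroup K' \<and> K \<subseteq> K' \<and> (\<forall>i\<in>S. axis i 1 \<in> K') \<and>
      unit_character_on K' L \<and> (\<forall>p\<in>K. L p = c p)" if "finite S" for S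
    using that
  proof (induction S rule: finite_induct)
    case empty
    then show ?case using assms by (intro exI[of _ K] exI[of _ c]) simp
  next
    case (insert i S)
    then obtain K' L where IH: "additive_subgroup K'" "K \<subseteq> K'" "\<forall>i\<in>S. axis i 1 \<in> K'"
        "unit_character_on K' L" "\<forall>p\<in>K. L p = c p" by blast
    let ?e = "axis i 1 :: int ^ 'k"
    let ?K = "{v. \<exists>n. v - n *s ?e \<in> K'}"
    obtain L' where L': "unit_character_on ?K L'" "\<And>p. p \<in> K' \<Longrightarrow> L' p = L p"
      using unit_character_extend_step[OF IH(1,4)] by blast
    have "additive_subgroup ?K"
      unfolding additive_subgroup_def
    proof (intro conjI ballI)
      show "0 \<in> ?K" using additive_subgroupD(1)[OF IH(1)] by (auto intro: exI[of _ 0])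
      fix x y assume "x \<in> ?K" "y \<in> ?K"
      then obtain n m where nm: "x - n *s ?e \<in> K'" "y - m *s ?e \<in> K'" by blast
      have eq: "x - y - (n - m) *s ?e = (x - n *s ?e) - (y - m *s ?e)"
        by (simp add: vec_eq_iff algebra_simps)
      have "x - y - (n - m) *s ?e \<in> K'"
        unfolding eq by (rule additive_subgroupD(2)[OF IH(1) nm])
      then show "x - y \<in> ?K" by blast
    qed
    moreover have "K' \<subseteq> ?K" by (auto intro: exI[of _ 0])
    moreover have "?e \<in> ?K" using additive_subgroupD(1)[OF IH(1)] by (auto intro: exI[of _ 1])
    ultimately show ?case
      using IH L' by (intro exI[of _ ?K] exI[of _ L']) (auto simp: subset_iff)
  qed
  from this[of UNIV] obtain K' L where K': "additive_subgroup K'" "\<And>i. axis i 1 \<in> K'"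
      "unit_character_on K' L" "\<forall>p\<in>K. L p = c p" by auto
  have "v \<in> K'" for v using K'(1,2) by (rule additive_subgroup_UNIV)
  then have "K' = UNIV" by blast
  then have "unit_character_on UNIV L" using K'(3) by simp
  moreover have "L p = c p" if "p \<in> K" for p using K'(4) that by blast
  ultimately show ?thesis by (rule that)
qed

section \<open>The backward shift on the standard basis\<close>

locale atomic_star_rep =
  fixes \<Gamma> :: "'k::{finite,linorder} presentation"
    and B :: "'h::complex_hilbert set"
    and \<sigma> :: "'k word set \<Rightarrow> 'h \<Rightarrow> 'h"
  assumes kgraph: "single_vertex_kgraph \<Gamma>"
    and star: "star_representation \<Gamma> UNIV \<sigma>"
    and atomic: "atomic \<Gamma> B \<sigma>"
    and connected: "connected_graph \<Gamma> B \<sigma>"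
begin

abbreviation F where "F \<equiv> carrier (FF \<Gamma>)"
abbreviation mul (infixl \<open>\<star>\<close> 70) where "u \<star> v \<equiv> u \<otimes>\<^bsub>FF \<Gamma>\<^esub> v"

lemma mul_closed: "u \<in> F \<Longrightarrow> v \<in> F \<Longrightarrow> u \<star> v \<in> F"
  by (rule monoid.m_closed[OF monoid_FF])

lemma one_closed: "\<one>\<^bsub>FF \<Gamma>\<^esub> \<in> F"
  by (rule monoid.one_closed[OF monoid_FF])

lemma rep: "representation \<Gamma> UNIV \<sigma>" and row_iso: "row_isometric \<Gamma> UNIV \<sigma>"
  and defect: "defect_free \<Gamma> UNIV \<sigma>"
  using star by (auto simp: star_representation_def)

lemma bounded_op: "w \<in> F \<Longrightarrow> bounded_operator UNIV (\<sigma> w)"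
  using rep by (simp add: representation_def)

lemma \<sigma>_mult: "v \<in> F \<Longrightarrow> w \<in> F \<Longrightarrow> \<sigma> (v \<star> w) x = \<sigma> v (\<sigma> w x)"
  using rep by (simp add: representation_def)

lemma \<sigma>_one: "\<sigma> \<one>\<^bsub>FF \<Gamma>\<^esub> x = x"
  using rep by (simp add: representation_def)

lemma \<sigma>_scaleC: "w \<in> F \<Longrightarrow> \<sigma> w (c *\<^sub>C x) = c *\<^sub>C \<sigma> w x"
  using bounded_operatorD(2)[OF bounded_op] .

lemma \<sigma>_zero: "w \<in> F \<Longrightarrow> \<sigma> w 0 = 0"
  using bounded_operatorD(3)[OF bounded_op] .

lemma row_norm: "(norm (\<Sum>s=1..num \<Gamma> i. \<sigma> (gen \<Gamma> i s) (x s)))\<^sup>2 = (\<Sum>s=1..num \<Gamma> i. (norm (x s))\<^sup>2)"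
  using row_iso by (simp add: row_isometric_def)

lemma isometry_gen:
  assumes s: "s \<in> {1..num \<Gamma> i}"
  shows "isometry (\<sigma> (gen \<Gamma> i s))"
proof -
  have "norm (\<sigma> (gen \<Gamma> i s) x) = norm x" for x
  proof -
    have "(\<Sum>r=1..num \<Gamma> i. \<sigma> (gen \<Gamma> i r) (if r = s then x else 0))
        = (\<Sum>r=1..num \<Gamma> i. if r = s then \<sigma> (gen \<Gamma> i s) x else 0)"
      by (rule sum.cong) (auto simp: \<sigma>_zero[OF gen_carrier])
    moreover have "(\<Sum>r=1..num \<Gamma> i. (norm (if r = s then x else 0))\<^sup>2)
        = (\<Sum>r=1..num \<Gamma> i. if r = s then (norm x)\<^sup>2 else 0)"
      by (rule sum.cong) auto
    ultimately have "(norm (\<sigma> (gen \<Gamma> i s) x))\<^sup>2 = (norm x)\<^sup>2"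
      using row_norm[of i "\<lambda>r. if r = s then x else 0"] s by simp
    then show ?thesis by simp
  qed
  then show ?thesis by (simp add: isometry_def bounded_op[OF gen_carrier[OF s]])
qed

lemma isometry_\<sigma>: "w \<in> F \<Longrightarrow> isometry (\<sigma> w)"
proof (induction rule: FF_induct)
  case one
  show ?case unfolding isometry_def using bounded_op[OF one_closed] by (intro conjI allI) (auto simp: \<sigma>_one)
next
  case (gen_mult i s Y)
  have g: "gen \<Gamma> i s \<in> F" using gen_mult(1) by (rule gen_carrier)
  have "norm (\<sigma> (gen \<Gamma> i s \<star> Y) x) = norm x" for x
    using isometry_gen[OF gen_mult(1)] gen_mult(3)
    by (simp add: isometry_def \<sigma>_mult[OF g gen_mult(2)])
  then show ?case
    unfolding isometry_def using bounded_op[OF mul_closed[OF g gen_mult(2)]] by blast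
qed

lemmas cinner_\<sigma> = isometry_cinner[OF isometry_\<sigma>]

lemma \<sigma>_inject:
  assumes "w \<in> F" "\<sigma> w x = \<sigma> w y"
  shows "x = y"
proof -
  note D = bounded_operatorD[OF bounded_op[OF assms(1)]]
  have "\<sigma> w (x + (- 1) *\<^sub>C y) = 0"
    unfolding D(1,2) assms(2) by (simp add: scaleC_minus1)
  then have "norm (x + (- 1) *\<^sub>C y) = 0"
    using isometry_\<sigma>[OF assms(1)] by (metis isometry_def norm_zero)
  then show ?thesis by (simp add: scaleC_minus1)
qed

lemma row_orthogonal:
  assumes s: "s \<in> {1..num \<Gamma> i}" "t \<in> {1..num \<Gamma> i}" "s \<noteq> t"
  shows "cinner (\<sigma> (gen \<Gamma> i s) x) (\<sigma> (gen \<Gamma> i t) y) = 0"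
proof -
  have Re: "Re (cinner (\<sigma> (gen \<Gamma> i s) x) (\<sigma> (gen \<Gamma> i t) y)) = 0" for y
  proof -
    let ?f = "\<lambda>r. if r = s then x else if r = t then y else 0"
    have "(\<Sum>r=1..num \<Gamma> i. \<sigma> (gen \<Gamma> i r) (?f r))
        = (\<Sum>r=1..num \<Gamma> i. (if r = s then \<sigma> (gen \<Gamma> i s) x else 0)
            + (if r = t then \<sigma> (gen \<Gamma> i t) y else 0))"
      using s(3) by (intro sum.cong) (auto simp: \<sigma>_zero[OF gen_carrier])
    also have "\<dots> = \<sigma> (gen \<Gamma> i s) x + \<sigma> (gen \<Gamma> i t) y"
      using s(1,2) by (simp add: sum.distrib)
    finally have 1: "(\<Sum>r=1..num \<Gamma> i. \<sigma> (gen \<Gamma> i r) (?f r)) = \<dots>" .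
    have "(\<Sum>r=1..num \<Gamma> i. (norm (?f r))\<^sup>2)
        = (\<Sum>r=1..num \<Gamma> i. (if r = s then (norm x)\<^sup>2 else 0) + (if r = t then (norm y)\<^sup>2 else 0))"
      using s(3) by (intro sum.cong) auto
    also have "\<dots> = (norm x)\<^sup>2 + (norm y)\<^sup>2"
      using s(1,2) by (simp add: sum.distrib)
    finally have 2: "(\<Sum>r=1..num \<Gamma> i. (norm (?f r))\<^sup>2) = \<dots>" .
    have n: "norm (\<sigma> (gen \<Gamma> i s) x) = norm x" "norm (\<sigma> (gen \<Gamma> i t) y) = norm y"
      using isometry_gen[OF s(1)] isometry_gen[OF s(2)] by (auto simp: isometry_def)
    show ?thesis
      using row_norm[of i ?f] unfolding 1 2 norm_add_square n by simp
  qed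
  have "Im (cinner (\<sigma> (gen \<Gamma> i s) x) (\<sigma> (gen \<Gamma> i t) y)) = 0"
    using Re[of "\<i> *\<^sub>C y"] by (simp add: \<sigma>_scaleC[OF gen_carrier[OF s(2)]] cinner_scaleC_right)
  then show ?thesis using Re[of y] by (simp add: complex_eq_iff)
qed

text \<open>By unique factorization two words of the same degree can be compared letter by letter; the
  first difference is within one row, whose operators have orthogonal ranges.\<close>

lemma ranges_orthogonal:
  assumes "w \<in> F" "w' \<in> F" "deg w = deg w'" "w \<noteq> w'"
  shows "cinner (\<sigma> w x) (\<sigma> w' y) = 0"
  using assms
proof (induction w arbitrary: w' rule: FF_induct)
  case one
  then have "w' = \<one>\<^bsub>FF \<Gamma>\<^esub>" by (intro deg_zero_imp_one) (auto simp: deg_one)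
  then show ?case using one by simp
next
  case (gen_mult i s v)
  have g: "gen \<Gamma> i s \<in> F" using gen_mult(1) by (rule gen_carrier)
  have "deg w' = axis i 1 + deg v"
    using gen_mult(5) deg_mult[OF g gen_mult(2)] deg_gen[OF gen_mult(1)] by simp
  then obtain u v' where uv: "u \<in> F" "v' \<in> F" "w' = u \<star> v'" "deg u = axis i 1" "deg v' = deg v"
    by (rule factorization_exists[OF kgraph gen_mult(4)])
  obtain s' where s': "s' \<in> {1..num \<Gamma> i}" "u = gen \<Gamma> i s'"
    using deg_axis_imp_gen[OF uv(1,4)] by blast
  show ?case
  proof (cases "s = s'")
    case True
    then have "v \<noteq> v'" using gen_mult(6) uv s' by auto
    then have "cinner (\<sigma> v x) (\<sigma> v' y) = 0" using gen_mult(3)[OF uv(2)] uv(5) by simp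
    moreover have "w' = gen \<Gamma> i s \<star> v'" using uv(3) s'(2) True by simp
    ultimately show ?thesis
      by (simp only: \<sigma>_mult[OF g gen_mult(2)] \<sigma>_mult[OF g uv(2)] cinner_\<sigma>[OF g])
  next
    case False
    then show ?thesis
      using row_orthogonal[OF gen_mult(1) s'(1)] uv(1,2) unfolding uv(3)
      by (simp add: \<sigma>_mult g gen_mult(2)) (simp add: s'(2))
  qed
qed

lemma range_determines_word:
  assumes "w \<in> F" "w' \<in> F" "deg w = deg w'" "y \<in> range (\<sigma> w)" "y \<in> range (\<sigma> w')" "y \<noteq> 0"
  shows "w = w'"
proof (rule ccontr)
  assume "w \<noteq> w'"
  moreover obtain a b where "y = \<sigma> w a" "y = \<sigma> w' b" using assms(4,5) by blast
  ultimately have "cinner y y = 0" using ranges_orthogonal[OF assms(1-3)] by metis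
  then show False using assms(6) by simp
qed

lemma B_orthonormal: "a \<in> B \<Longrightarrow> b \<in> B \<Longrightarrow> cinner a b = (if a = b then 1 else 0)"
  using atomic by (simp add: atomic_def orthonormal_basis_def)

lemma B_norm: "b \<in> B \<Longrightarrow> norm b = 1"
proof -
  assume "b \<in> B"
  then have "complex_of_real ((norm b)\<^sup>2) = 1"
    using B_orthonormal[of b b] unfolding cinner_self[symmetric] by simp
  then have "(norm b)\<^sup>2 = 1" by (simp only: of_real_eq_1_iff)
  then have "norm b = 1 \<or> norm b = - 1" by (simp only: power2_eq_1_iff)
  then show "norm b = 1" using norm_ge_zero[of b] by linarith
qed

lemma B_nonzero: "b \<in> B \<Longrightarrow> b \<noteq> 0"
  using B_norm[of b] by auto

lemma B_dense: "closure (cspan B) = UNIV"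
  using atomic by (simp add: atomic_def orthonormal_basis_def)

lemma B_total:
  assumes "\<And>b. b \<in> B \<Longrightarrow> cinner b y = 0"
  shows "y = 0"
proof -
  have "y \<in> closure (cspan B)" unfolding B_dense by simp
  then have "cinner y y = 0" using orthogonal_closure_cspan[OF assms] by blast
  then show ?thesis by simp
qed

lemma scaled_basis_eq:
  assumes "a \<in> B" "b \<in> B" "cmod \<alpha> = 1" "\<alpha> *\<^sub>C a = \<beta> *\<^sub>C b"
  shows "a = b \<and> \<alpha> = \<beta>"
proof -
  have "\<alpha> = cinner (\<alpha> *\<^sub>C a) a" using B_orthonormal[OF assms(1,1)] by (simp add: cinner_scaleC_left)
  also have "\<dots> = \<beta> * cinner b a" unfolding assms(4) by (simp add: cinner_scaleC_left)
  finally have "\<alpha> = \<beta> * cinner b a" .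
  then show ?thesis using B_orthonormal[OF assms(2,1)] assms(3) by (auto split: if_splits)
qed

lemma \<sigma>_basis:
  assumes "w \<in> F" "b \<in> B"
  obtains a \<alpha> where "a \<in> B" "cmod \<alpha> = 1" "\<sigma> w b = \<alpha> *\<^sub>C a"
proof -
  obtain a \<alpha> where a: "a \<in> B" "cmod \<alpha> = 1 \<or> \<alpha> = 0" "\<sigma> w b = \<alpha> *\<^sub>C a"
    using atomic assms unfolding atomic_def by blast
  have "norm (\<sigma> w b) = 1" using isometry_\<sigma>[OF assms(1)] B_norm[OF assms(2)] by (simp add: isometry_def)
  then have "cmod \<alpha> = 1" using a B_norm[OF a(1)] by (simp add: norm_scaleC)
  then show ?thesis using that a by blast
qed

text \<open>Defect freeness: a basis vector missed by a whole row would be annihilated by all adjoints of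
  that row, hence be zero.\<close>

lemma basis_in_row_range:
  assumes b: "b \<in> B"
  obtains s a \<alpha> where "s \<in> {1..num \<Gamma> i}" "a \<in> B" "cmod \<alpha> = 1" "\<sigma> (gen \<Gamma> i s) a = \<alpha> *\<^sub>C b"
proof (rule ccontr)
  assume none: "\<not> thesis"
  note found = that
  have "cadjoint UNIV (\<sigma> (gen \<Gamma> i s)) b = 0" if s: "s \<in> {1..num \<Gamma> i}" for s
  proof (rule B_total)
    fix a assume a: "a \<in> B"
    obtain c \<alpha> where c: "c \<in> B" "cmod \<alpha> = 1" "\<sigma> (gen \<Gamma> i s) a = \<alpha> *\<^sub>C c"
      by (rule \<sigma>_basis[OF gen_carrier[OF s] a])
    have "c \<noteq> b" using none found[OF s a c(2)] c(3) by blast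
    then have "cinner (\<sigma> (gen \<Gamma> i s) a) b = 0"
      using c B_orthonormal[OF c(1) b] by (simp add: cinner_scaleC_left)
    then show "cinner a (cadjoint UNIV (\<sigma> (gen \<Gamma> i s)) b) = 0"
      by (simp add: isometry_adjoint[OF isometry_gen[OF s], symmetric])
  qed
  then have "(\<Sum>s=1..num \<Gamma> i. \<sigma> (gen \<Gamma> i s) (cadjoint UNIV (\<sigma> (gen \<Gamma> i s)) b)) = 0"
    by (intro sum.neutral) (simp add: \<sigma>_zero[OF gen_carrier])
  moreover have "(\<Sum>s=1..num \<Gamma> i. \<sigma> (gen \<Gamma> i s) (cadjoint UNIV (\<sigma> (gen \<Gamma> i s)) b)) = b"
    using defect by (simp add: defect_free_def)
  ultimately show False using B_nonzero[OF b] by simp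
qed

definition comes_from :: "'k NNk \<Rightarrow> 'h \<Rightarrow> 'k word set \<Rightarrow> 'h \<Rightarrow> complex \<Rightarrow> bool" where
  "comes_from n b w a \<alpha> \<longleftrightarrow> w \<in> F \<and> deg w = n \<and> a \<in> B \<and> cmod \<alpha> = 1 \<and> \<sigma> w a = \<alpha> *\<^sub>C b"

lemma comes_from_unique:
  assumes b: "b \<in> B" and 1: "comes_from n b w a \<alpha>" and 2: "comes_from n b w' a' \<alpha>'"
  shows "w = w'" "a = a'" "\<alpha> = \<alpha>'"
proof -
  have w: "w \<in> F" "w' \<in> F" "deg w = deg w'" and a: "a \<in> B" "a' \<in> B" "cmod \<alpha> = 1" "cmod \<alpha>' = 1"
    and eq: "\<sigma> w a = \<alpha> *\<^sub>C b" "\<sigma> w' a' = \<alpha>' *\<^sub>C b"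
    using 1 2 by (auto simp: comes_from_def)
  have "b = \<sigma> w ((1/\<alpha>) *\<^sub>C a)" "b = \<sigma> w' ((1/\<alpha>') *\<^sub>C a')"
    using a(3,4) unfolding \<sigma>_scaleC[OF w(1)] \<sigma>_scaleC[OF w(2)] eq by (auto simp: scaleC_scaleC)
  then show ww: "w = w'" using range_determines_word[OF w _ _ B_nonzero[OF b]] by blast
  have "\<sigma> w (\<alpha>' *\<^sub>C a) = \<sigma> w (\<alpha> *\<^sub>C a')"
    unfolding \<sigma>_scaleC[OF w(1)] eq(1) unfolding ww eq(2) by (simp add: scaleC_scaleC mult.commute)
  then have "\<alpha>' *\<^sub>C a = \<alpha> *\<^sub>C a'" by (rule \<sigma>_inject[OF w(1)])
  then show "a = a'" "\<alpha> = \<alpha>'" using scaled_basis_eq[OF a(1,2,4)] by auto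
qed

lemma comes_from_mult:
  assumes "comes_from m b v a \<alpha>" "comes_from n a w c \<beta>"
  shows "comes_from (m + n) b (v \<star> w) c (\<alpha> * \<beta>)"
  using assms deg_mult[of v \<Gamma> w]
  by (auto simp: comes_from_def mul_closed \<sigma>_mult \<sigma>_scaleC scaleC_scaleC norm_mult mult.commute)

lemma comes_from_zero: "b \<in> B \<Longrightarrow> comes_from 0 b \<one>\<^bsub>FF \<Gamma>\<^esub> b 1"
  by (simp add: comes_from_def one_closed deg_one \<sigma>_one)

lemma comes_from_exists: "b \<in> B \<Longrightarrow> \<exists>w a \<alpha>. comes_from n b w a \<alpha>"
proof (induction n rule: NNk_induct)
  case zero
  then show ?case using comes_from_zero by blast
next
  case (add n i)
  then obtain w a \<alpha> where w: "comes_from n b w a \<alpha>" by blast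
  then have "a \<in> B" by (simp add: comes_from_def)
  then obtain s c \<beta> where s: "s \<in> {1..num \<Gamma> i}" "c \<in> B" "cmod \<beta> = 1" "\<sigma> (gen \<Gamma> i s) c = \<beta> *\<^sub>C a"
    by (rule basis_in_row_range)
  then have "comes_from (axis i 1) a (gen \<Gamma> i s) c \<beta>"
    by (simp add: comes_from_def gen_carrier deg_gen del: atLeastAtMost_iff)
  with w show ?case by (blast intro: comes_from_mult)
qed

text \<open>Every basis vector \<open>b\<close> is reached by a unique word of each degree \<open>n\<close>, namely \<open>seg n b\<close>,
  from a unique basis vector \<open>shift n b\<close>, with a unique scalar \<open>phase n b\<close>.\<close>

definition seg :: "'k NNk \<Rightarrow> 'h \<Rightarrow> 'k word set" where
  "seg n b = (SOME w. \<exists>a \<alpha>. comes_from n b w a \<alpha>)"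

definition shift :: "'k NNk \<Rightarrow> 'h \<Rightarrow> 'h" where
  "shift n b = (SOME a. \<exists>w \<alpha>. comes_from n b w a \<alpha>)"

definition phase :: "'k NNk \<Rightarrow> 'h \<Rightarrow> complex" where
  "phase n b = (SOME \<alpha>. \<exists>w a. comes_from n b w a \<alpha>)"

lemma comes_from_iff:
  assumes "b \<in> B"
  shows "comes_from n b w a \<alpha> \<longleftrightarrow> w = seg n b \<and> a = shift n b \<and> \<alpha> = phase n b"
proof -
  obtain w0 a0 \<alpha>0 where 0: "comes_from n b w0 a0 \<alpha>0" using comes_from_exists[OF assms] by blast
  note u = comes_from_unique[OF assms 0]
  have "seg n b = w0" unfolding seg_def
    by (rule some_equality) (use 0 u(1) in blast)+
  moreover have "shift n b = a0" unfolding shift_def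
    by (rule some_equality) (use 0 u(2) in blast)+
  moreover have "phase n b = \<alpha>0" unfolding phase_def
    by (rule some_equality) (use 0 u(3) in blast)+
  ultimately show ?thesis using 0 u by blast
qed

lemma comes_from_seg: "b \<in> B \<Longrightarrow> comes_from n b (seg n b) (shift n b) (phase n b)"
  by (simp add: comes_from_iff)

lemma seg_closed: "b \<in> B \<Longrightarrow> seg n b \<in> F" and deg_seg: "b \<in> B \<Longrightarrow> deg (seg n b) = n"
  and shift_closed: "b \<in> B \<Longrightarrow> shift n b \<in> B" and phase_unit: "b \<in> B \<Longrightarrow> cmod (phase n b) = 1"
  and \<sigma>_seg: "b \<in> B \<Longrightarrow> \<sigma> (seg n b) (shift n b) = phase n b *\<^sub>C b"
  using comes_from_seg unfolding comes_from_def by blast+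

lemma cocycle:
  assumes "b \<in> B"
  shows "seg (m + n) b = seg m b \<star> seg n (shift m b)"
    and "shift (m + n) b = shift n (shift m b)"
    and "phase (m + n) b = phase m b * phase n (shift m b)"
  using comes_from_mult[OF comes_from_seg[OF assms] comes_from_seg[OF shift_closed[OF assms]]]
  by (auto simp: comes_from_iff[OF assms])

lemma at_zero:
  assumes "b \<in> B"
  shows "seg 0 b = \<one>\<^bsub>FF \<Gamma>\<^esub>" "shift 0 b = b" "phase 0 b = 1"
  using comes_from_zero[OF assms] by (auto simp: comes_from_iff[OF assms])

lemma shift_commute: "b \<in> B \<Longrightarrow> shift m (shift n b) = shift n (shift m b)"
  using cocycle(2)[of b m n] cocycle(2)[of b n m] by (simp add: add.commute)

lemma prepend:
  assumes "w \<in> F" "b \<in> B"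
  obtains a where "a \<in> B" "seg (deg w) a = w" "shift (deg w) a = b"
proof -
  obtain a \<alpha> where a: "a \<in> B" "cmod \<alpha> = 1" "\<sigma> w b = \<alpha> *\<^sub>C a" by (rule \<sigma>_basis[OF assms])
  then have "comes_from (deg w) a w b \<alpha>" using assms by (simp add: comes_from_def)
  then show ?thesis using that[OF a(1)] by (simp add: comes_from_iff[OF a(1)])
qed

lemma seg_shift_inject:
  assumes "a \<in> B" "b \<in> B" "seg n a = seg n b" "shift n a = shift n b"
  shows "a = b"
proof -
  have "phase n a *\<^sub>C a = phase n b *\<^sub>C b"
    using \<sigma>_seg[OF assms(1), of n] \<sigma>_seg[OF assms(2), of n] assms(3,4) by simp
  then show ?thesis using scaled_basis_eq[OF assms(1,2) phase_unit[OF assms(1)]] by blast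
qed

lemma seg_eq_iff_range:
  assumes "b \<in> B" "w \<in> F"
  shows "b \<in> range (\<sigma> w) \<longleftrightarrow> w = seg (deg w) b"
proof -
  have r: "b \<in> range (\<sigma> (seg n b))" for n
  proof -
    have "phase n b \<noteq> 0" using phase_unit[OF assms(1), of n] by auto
    then have "b = \<sigma> (seg n b) ((1 / phase n b) *\<^sub>C shift n b)"
      by (simp add: \<sigma>_scaleC[OF seg_closed[OF assms(1)]] \<sigma>_seg[OF assms(1)] scaleC_scaleC)
    then show ?thesis by blast
  qed
  show ?thesis
    using range_determines_word[OF assms(2) seg_closed[OF assms(1)] _ _ r B_nonzero[OF assms(1)]]
      deg_seg[OF assms(1)] r by metis
qed

text \<open>Undirected paths become common forward orbits because the shifts commute.\<close>

lemma shifts_meet: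
  assumes "a \<in> B" "b \<in> B"
  obtains m n where "shift m a = shift n b"
proof -
  let ?R = "{(x, y). \<exists>l. (x, l, y) \<in> graph_edges \<Gamma> B \<sigma> \<or> (y, l, x) \<in> graph_edges \<Gamma> B \<sigma>}"
  have edge: "x \<in> B \<and> y \<in> B \<and> (\<exists>n. shift n y = x)" if xly: "(x, l, y) \<in> graph_edges \<Gamma> B \<sigma>" for x y l
  proof -
    obtain i s \<alpha> where e: "l = (i, s)" "x \<in> B" "y \<in> B" "s \<in> {1..num \<Gamma> i}" "cmod \<alpha> = 1"
        "\<sigma> (gen \<Gamma> i s) x = \<alpha> *\<^sub>C y"
      using xly by (auto simp: graph_edges_def letters_def)
    then have "comes_from (axis i 1) y (gen \<Gamma> i s) x \<alpha>"
      by (simp add: comes_from_def gen_carrier deg_gen del: atLeastAtMost_iff)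
    then have "shift (axis i 1) y = x" by (simp add: comes_from_iff[OF e(3)])
    then show ?thesis using e by blast
  qed
  have "(a, b) \<in> ?R\<^sup>*" using connected assms by (simp add: connected_graph_def)
  then have "b \<in> B \<and> (\<exists>m n. shift m a = shift n b)"
  proof (induction rule: rtrancl_induct)
    case base
    then show ?case using assms by blast
  next
    case (step y z)
    then obtain m n where mn: "shift m a = shift n y" by blast
    have y: "y \<in> B" using step by blast
    from step(2) obtain l where "(y, l, z) \<in> graph_edges \<Gamma> B \<sigma> \<or> (z, l, y) \<in> graph_edges \<Gamma> B \<sigma>" by blast
    then show ?case
    proof
      assume "(y, l, z) \<in> graph_edges \<Gamma> B \<sigma>"
      then obtain r where r: "z \<in> B" "shift r z = y" using edge by blast
      then have "shift m a = shift (r + n) z" using mn cocycle(2)[OF r(1)] by simp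
      then show ?thesis using r by blast
    next
      assume "(z, l, y) \<in> graph_edges \<Gamma> B \<sigma>"
      then obtain r where r: "z \<in> B" "shift r y = z" using edge by blast
      have "shift (m + r) a = shift r (shift n y)" using mn cocycle(2)[OF assms(1)] by simp
      also have "\<dots> = shift n z" using shift_commute[OF y] r by simp
      finally show ?thesis using r by blast
    qed
  qed
  then show ?thesis using that by blast
qed

end

section \<open>Tails\<close>

definition zvec :: "'k::finite NNk \<Rightarrow> 'k ZZk" where "zvec n = (\<chi> i. int (n $ i))"

definition nvec :: "'k::finite ZZk \<Rightarrow> 'k NNk" where "nvec z = (\<chi> i. nat (z $ i))"

lemma zvec_nth [simp]: "zvec n $ i = int (n $ i)" by (simp add: zvec_def)

lemma zvec_add: "zvec (m + n) = zvec m + zvec n" by (simp add: vec_eq_iff)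

lemma zvec_zero [simp]: "zvec 0 = 0" by (simp add: vec_eq_iff)

lemma zvec_axis: "zvec (axis i 1) = axis i 1" by (simp add: vec_eq_iff axis_def)

lemma zvec_inject: "zvec m = zvec n \<longleftrightarrow> m = n" by (simp add: vec_eq_iff)

lemma zvec_nvec: "0 \<le> z \<Longrightarrow> zvec (nvec z) = z"
  by (simp add: vec_eq_iff less_eq_vec_def nvec_def)

lemma word_deg_prefix:
  "word_deg (map \<omega> [0..<N]) $ i = card {M. M < N \<and> fst (\<omega> M) = i}"
  by (simp add: word_deg_def length_filter_conv_card) (intro arg_cong[where f = card], auto)

text \<open>Every colour occurs infinitely often, so the prefixes eventually dominate any given degree.\<close>

lemma infinite_word_prefix:
  assumes "infinite_word \<Gamma> \<omega>"
  obtains N r where "word_deg (map \<omega> [0..<N]) = n + r"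
proof -
  have "\<exists>N. n $ i \<le> card {M. M < N \<and> fst (\<omega> M) = i}" for i
  proof -
    have "infinite {N. fst (\<omega> N) = i}" using assms by (simp add: infinite_word_def)
    then obtain A where A: "finite A" "card A = n $ i" "A \<subseteq> {N. fst (\<omega> N) = i}"
      using infinite_arbitrarily_large by blast
    obtain N where "A \<subseteq> {..<N}" using finite_nat_bounded[OF A(1)] by blast
    then have "A \<subseteq> {M. M < N \<and> fst (\<omega> M) = i}" using A(3) by auto
    then have "card A \<le> card {M. M < N \<and> fst (\<omega> M) = i}" by (intro card_mono) auto
    then show ?thesis using A(2) by auto
  qed
  then obtain f where f: "\<And>i. n $ i \<le> card {M. M < f i \<and> fst (\<omega> M) = i}" by metis
  define N where "N = Max (range f)"
  have le: "n $ i \<le> word_deg (map \<omega> [0..<N]) $ i" for i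
  proof -
    have "f i \<le> N" unfolding N_def by (rule Max_ge) auto
    then have "card {M. M < f i \<and> fst (\<omega> M) = i} \<le> card {M. M < N \<and> fst (\<omega> M) = i}"
      by (intro card_mono) auto
    then show ?thesis using f[of i] unfolding word_deg_prefix by linarith
  qed
  have "word_deg (map \<omega> [0..<N]) = n + (word_deg (map \<omega> [0..<N]) - n)"
    using le by (simp add: vec_eq_iff)
  then show ?thesis by (rule that)
qed

lemma infinite_word_prefix_letters:
  assumes "infinite_word \<Gamma> \<omega>"
  shows "map \<omega> xs \<in> lists (letters \<Gamma>)"
proof -
  have "range \<omega> \<subseteq> letters \<Gamma>" using assms by (simp add: infinite_word_def)
  then show ?thesis unfolding lists_eq_set set_map mem_Collect_eq by blast
qed

text \<open>Two prefixes of a word are comparable, so factorizations of both are factorizations of the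
  longer one, where the left factor is determined by its degree.\<close>

lemma initial_segment_eq:
  assumes \<Gamma>: "single_vertex_kgraph \<Gamma>" and \<omega>: "infinite_word \<Gamma> \<omega>"
    and w: "w \<in> carrier (FF \<Gamma>)" "deg w = n"
    and v: "v \<in> carrier (FF \<Gamma>)" "wclass \<Gamma> (map \<omega> [0..<N]) = w \<otimes>\<^bsub>FF \<Gamma>\<^esub> v"
  shows "initial_segment \<Gamma> \<omega> n = w"
proof -
  interpret monoid "FF \<Gamma>" by (rule monoid_FF)
  have later: "w = w'" if "N \<le> N'" "w \<in> carrier (FF \<Gamma>)" "v \<in> carrier (FF \<Gamma>)" "w' \<in> carrier (FF \<Gamma>)"
      "v' \<in> carrier (FF \<Gamma>)" "deg w = deg w'" "wclass \<Gamma> (map \<omega> [0..<N]) = w \<otimes>\<^bsub>FF \<Gamma>\<^esub> v"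
      "wclass \<Gamma> (map \<omega> [0..<N']) = w' \<otimes>\<^bsub>FF \<Gamma>\<^esub> v'" for N N' w v w' v'
  proof -
    have "map \<omega> [0..<N'] = map \<omega> [0..<N] @ map \<omega> [N..<N']"
      using upt_add_eq_append[of 0 N "N' - N"] that(1) by simp
    then have "w' \<otimes>\<^bsub>FF \<Gamma>\<^esub> v' = (w \<otimes>\<^bsub>FF \<Gamma>\<^esub> v) \<otimes>\<^bsub>FF \<Gamma>\<^esub> wclass \<Gamma> (map \<omega> [N..<N'])"
      unfolding that(7,8)[symmetric] by (simp only: wclass_mult infinite_word_prefix_letters[OF \<omega>])
    also have "\<dots> = w \<otimes>\<^bsub>FF \<Gamma>\<^esub> (v \<otimes>\<^bsub>FF \<Gamma>\<^esub> wclass \<Gamma> (map \<omega> [N..<N']))"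
      using that by (intro m_assoc wclass_carrier infinite_word_prefix_letters[OF \<omega>])
    finally have eq: "w \<otimes>\<^bsub>FF \<Gamma>\<^esub> (v \<otimes>\<^bsub>FF \<Gamma>\<^esub> wclass \<Gamma> (map \<omega> [N..<N'])) = w' \<otimes>\<^bsub>FF \<Gamma>\<^esub> v'" by simp
    have "v \<otimes>\<^bsub>FF \<Gamma>\<^esub> wclass \<Gamma> (map \<omega> [N..<N']) \<in> carrier (FF \<Gamma>)"
      using that by (intro m_closed wclass_carrier infinite_word_prefix_letters[OF \<omega>])
    from factorization_unique(1)[OF \<Gamma> that(2) this that(4,5) eq that(6)] show ?thesis .
  qed
  show ?thesis
    unfolding initial_segment_def
  proof (rule the_equality)
    show "w \<in> carrier (FF \<Gamma>) \<and> deg w = n \<and>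
        (\<exists>N. \<exists>v\<in>carrier (FF \<Gamma>). wclass \<Gamma> (map \<omega> [0..<N]) = w \<otimes>\<^bsub>FF \<Gamma>\<^esub> v)"
      using w v by blast
    fix w' assume "w' \<in> carrier (FF \<Gamma>) \<and> deg w' = n \<and>
        (\<exists>N. \<exists>v\<in>carrier (FF \<Gamma>). wclass \<Gamma> (map \<omega> [0..<N]) = w' \<otimes>\<^bsub>FF \<Gamma>\<^esub> v)"
    then obtain N' v' where w': "w' \<in> carrier (FF \<Gamma>)" "deg w' = n" "v' \<in> carrier (FF \<Gamma>)"
        "wclass \<Gamma> (map \<omega> [0..<N']) = w' \<otimes>\<^bsub>FF \<Gamma>\<^esub> v'" by blast
    show "w' = w"
    proof (cases "N \<le> N'")
      case True
      from later[OF this w(1) v(1) w'(1,3) _ v(2) w'(4)] show ?thesis using w(2) w'(2) by simp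
    next
      case False
      then have "N' \<le> N" by simp
      from later[OF this w'(1,3) w(1) v(1) _ w'(4) v(2)] show ?thesis using w(2) w'(2) by simp
    qed
  qed
qed

lemma initial_segment_closed:
  assumes \<Gamma>: "single_vertex_kgraph \<Gamma>" and \<omega>: "infinite_word \<Gamma> \<omega>"
  shows "initial_segment \<Gamma> \<omega> n \<in> carrier (FF \<Gamma>)" "deg (initial_segment \<Gamma> \<omega> n) = n"
proof -
  obtain N r where "word_deg (map \<omega> [0..<N]) = n + r" by (rule infinite_word_prefix[OF \<omega>])
  then have "deg (wclass \<Gamma> (map \<omega> [0..<N])) = n + r"
    using infinite_word_prefix_letters[OF \<omega>] by (simp only: deg_wclass)
  then obtain w v where w: "w \<in> carrier (FF \<Gamma>)" "v \<in> carrier (FF \<Gamma>)"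
      "wclass \<Gamma> (map \<omega> [0..<N]) = w \<otimes>\<^bsub>FF \<Gamma>\<^esub> v" "deg w = n" "deg v = r"
    by (rule factorization_exists[OF \<Gamma> wclass_carrier[OF infinite_word_prefix_letters[OF \<omega>]]])
  then have "initial_segment \<Gamma> \<omega> n = w" by (intro initial_segment_eq[OF \<Gamma> \<omega>])
  then show "initial_segment \<Gamma> \<omega> n \<in> carrier (FF \<Gamma>)" "deg (initial_segment \<Gamma> \<omega> n) = n"
    using w by auto
qed

lemma recurrent_colouring:
  "\<exists>c :: nat \<Rightarrow> 'k::finite. \<forall>i. infinite {N. c N = i}"
proof -
  obtain h where h: "bij_betw h {0..<CARD('k)} (UNIV :: 'k set)"
    using ex_bij_betw_nat_finite[of "UNIV :: 'k set"] by auto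
  have "infinite {N. h (N mod CARD('k)) = i}" for i
    unfolding infinite_nat_iff_unbounded_le
  proof
    fix m
    obtain j where j: "j < CARD('k)" "h j = i"
      using h unfolding bij_betw_def by (metis UNIV_I atLeastLessThan_iff image_iff)
    then have "m \<le> j + m * CARD('k)" "h ((j + m * CARD('k)) mod CARD('k)) = i"
      by (simp_all add: trans_le_add2)
    then show "\<exists>n\<ge>m. n \<in> {N. h (N mod CARD('k)) = i}" by blast
  qed
  then show ?thesis by (intro exI[of _ "\<lambda>N. h (N mod CARD('k))"] allI)
qed

context atomic_star_rep
begin

definition label :: "'k \<Rightarrow> 'h \<Rightarrow> nat" where
  "label i b = (SOME s. s \<in> {1..num \<Gamma> i} \<and> seg (axis i 1) b = gen \<Gamma> i s)"

lemma label:
  assumes "b \<in> B"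
  shows "label i b \<in> {1..num \<Gamma> i}" "seg (axis i 1) b = gen \<Gamma> i (label i b)"
proof -
  have "\<exists>s. s \<in> {1..num \<Gamma> i} \<and> seg (axis i 1) b = gen \<Gamma> i s"
    using deg_axis_imp_gen[OF seg_closed[OF assms] deg_seg[OF assms]] by blast
  then have "label i b \<in> {1..num \<Gamma> i} \<and> seg (axis i 1) b = gen \<Gamma> i (label i b)"
    unfolding label_def by (rule someI_ex)
  then show "label i b \<in> {1..num \<Gamma> i}" "seg (axis i 1) b = gen \<Gamma> i (label i b)" by auto
qed

lemma seg_add_axis:
  "b \<in> B \<Longrightarrow> seg (n + axis i 1) b = seg n b \<star> gen \<Gamma> i (label i (shift n b))"
  by (simp only: cocycle(1) label(2)[OF shift_closed])

lemma seg_prefix: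
  assumes "a \<in> B" "b \<in> B" "seg (m + n) a = seg (m + n) b"
  shows "seg m a = seg m b" "seg n (shift m a) = seg n (shift m b)"
proof -
  have "seg m a \<star> seg n (shift m a) = seg m b \<star> seg n (shift m b)"
    using assms(3) unfolding cocycle(1)[OF assms(1)] cocycle(1)[OF assms(2)] .
  from factorization_unique[OF kgraph seg_closed[OF assms(1)] seg_closed[OF shift_closed[OF assms(1)]]
      seg_closed[OF assms(2)] seg_closed[OF shift_closed[OF assms(2)]] this]
  show "seg m a = seg m b" "seg n (shift m a) = seg n (shift m b)"
    by (simp_all add: deg_seg assms(1,2))
qed

definition same_tail :: "'h \<Rightarrow> 'h \<Rightarrow> bool" where
  "same_tail a b \<longleftrightarrow> (\<forall>n. seg n a = seg n b)"

lemma same_tail_shift: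
  "a \<in> B \<Longrightarrow> b \<in> B \<Longrightarrow> same_tail a b \<Longrightarrow> same_tail (shift n a) (shift n b)"
  unfolding same_tail_def using seg_prefix(2) by blast

lemma same_tail_from_head:
  assumes "a \<in> B" "b \<in> B" "seg n a = seg n b" "same_tail (shift n a) (shift n b)"
  shows "same_tail a b"
  unfolding same_tail_def
proof
  fix m
  have "seg (n + m) a = seg (n + m) b"
    using assms by (simp add: cocycle(1) same_tail_def)
  then show "seg m a = seg m b" using seg_prefix(1)[OF assms(1,2), of m n] by (simp add: add.commute)
qed

lemma same_tail_shift_inject:
  "a \<in> B \<Longrightarrow> b \<in> B \<Longrightarrow> same_tail a b \<Longrightarrow> shift n a = shift n b \<Longrightarrow> a = b"
  unfolding same_tail_def using seg_shift_inject by blast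

text \<open>The labels along the orbit determine all segments one letter at a time, and conversely each
  label is the last letter of a segment.\<close>

lemma same_tail_iff_label:
  assumes a: "a \<in> B" and b: "b \<in> B"
  shows "same_tail a b \<longleftrightarrow> (\<forall>n i. label i (shift n a) = label i (shift n b))"
proof
  assume st: "same_tail a b"
  show "\<forall>n i. label i (shift n a) = label i (shift n b)"
  proof (intro allI)
    fix n i
    have "seg (n + axis i 1) a = seg (n + axis i 1) b" using st by (simp add: same_tail_def)
    then have "seg (axis i 1) (shift n a) = seg (axis i 1) (shift n b)" by (rule seg_prefix(2)[OF a b])
    then show "label i (shift n a) = label i (shift n b)"
      using gen_inject[of "label i (shift n a)" \<Gamma> i "label i (shift n b)"]
        label[OF shift_closed[OF a]] label[OF shift_closed[OF b]] by simp
  qed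
next
  assume l: "\<forall>n i. label i (shift n a) = label i (shift n b)"
  have "seg n a = seg n b" for n
    by (induction n rule: NNk_induct)
      (simp_all add: at_zero a b seg_add_axis l del: One_nat_def)
  then show "same_tail a b" by (simp add: same_tail_def)
qed

text \<open>Reading the letters of the backward orbit of \<open>b\<close> in any order of the colours that uses each of
  them infinitely often spells an infinite word whose prefixes are among the segments of \<open>b\<close>.\<close>

lemma seg_in_tails:
  assumes b: "b \<in> B"
  shows "(\<lambda>n. seg n b) \<in> tails \<Gamma>"
proof -
  obtain c :: "nat \<Rightarrow> 'k" where c: "\<And>i. infinite {N. c N = i}"
    using recurrent_colouring by blast
  define D where "D N = word_deg (map (\<lambda>M. (c M, 0::nat)) [0..<N])" for N
  define \<omega> where "\<omega> N = (c N, label (c N) (shift (D N) b))" for N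
  have D: "word_deg (map \<omega> [0..<N]) = D N" for N
    unfolding D_def vec_eq_iff word_deg_prefix by (simp add: \<omega>_def)
  have inf: "infinite_word \<Gamma> \<omega>"
    using c label(1)[OF shift_closed[OF b]] by (auto simp: infinite_word_def \<omega>_def letters_def)
  have prefix: "wclass \<Gamma> (map \<omega> [0..<N]) = seg (D N) b" for N
  proof (induction N)
    case 0
    then show ?case by (simp add: D_def at_zero[OF b] FF_one)
  next
    case (Suc N)
    have "D (Suc N) = D N + axis (c N) 1"
      by (simp add: D_def word_deg_append del: One_nat_def)
    then have "seg (D (Suc N)) b = wclass \<Gamma> (map \<omega> [0..<N]) \<star> wclass \<Gamma> [\<omega> N]"
      by (simp add: seg_add_axis[OF b] Suc \<omega>_def del: One_nat_def)
    also have "\<dots> = wclass \<Gamma> (map \<omega> [0..<N] @ map \<omega> [N])"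
      using wclass_mult[OF infinite_word_prefix_letters[OF inf] infinite_word_prefix_letters[OF inf],
          of "[0..<N]" "[N]"] by simp
    finally show ?case by simp
  qed
  have "seg n b = initial_segment \<Gamma> \<omega> n" for n
  proof -
    obtain N r where "word_deg (map \<omega> [0..<N]) = n + r" by (rule infinite_word_prefix[OF inf])
    then have "wclass \<Gamma> (map \<omega> [0..<N]) = seg n b \<star> seg r (shift n b)"
      using prefix[of N] by (simp add: D cocycle(1)[OF b])
    then show ?thesis
      by (rule initial_segment_eq[OF kgraph inf seg_closed[OF b] deg_seg[OF b]
            seg_closed[OF shift_closed[OF b]], symmetric])
  qed
  then show ?thesis using inf unfolding tails_def by auto
qed

lemma tail_of_eq:
  assumes b: "b \<in> B"
  shows "tail_of \<Gamma> \<sigma> b = (\<lambda>n. seg n b)"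
  unfolding tail_of_def
proof (rule the_equality)
  have "b \<in> range (\<sigma> (seg n b))" for n
    using seg_eq_iff_range[OF b seg_closed[OF b]] by (simp add: deg_seg[OF b])
  then show "(\<lambda>n. seg n b) \<in> tails \<Gamma> \<and> (\<forall>n. b \<in> range (\<sigma> (seg n b)))"
    using seg_in_tails[OF b] by blast
  fix \<tau> assume \<tau>: "\<tau> \<in> tails \<Gamma> \<and> (\<forall>n. b \<in> range (\<sigma> (\<tau> n)))"
  show "\<tau> = (\<lambda>n. seg n b)"
  proof
    fix n
    have "\<tau> n \<in> F" "deg (\<tau> n) = n"
      using \<tau> initial_segment_closed[OF kgraph] by (auto simp: tails_def)
    then show "\<tau> n = seg n b" using seg_eq_iff_range[OF b] \<tau> by metis
  qed
qed

lemma Sig_seg: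
  assumes b: "b \<in> B"
  shows "Sig \<Gamma> (\<lambda>n. seg n b) (- zvec n) = (\<chi> i. label i (shift n b))"
proof -
  have "(THE t. t \<in> {1..num \<Gamma> i} \<and> seg (n + axis i 1) b = seg n b \<star> gen \<Gamma> i t)
      = label i (shift n b)" for i
  proof (rule the_equality)
    show "label i (shift n b) \<in> {1..num \<Gamma> i} \<and>
        seg (n + axis i 1) b = seg n b \<star> gen \<Gamma> i (label i (shift n b))"
      using label(1)[OF shift_closed[OF b]] seg_add_axis[OF b] by blast
    fix t assume t: "t \<in> {1..num \<Gamma> i} \<and> seg (n + axis i 1) b = seg n b \<star> gen \<Gamma> i t"
    then have eq: "seg n b \<star> gen \<Gamma> i t = seg n b \<star> gen \<Gamma> i (label i (shift n b))"
      using seg_add_axis[OF b] by metis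
    have g: "gen \<Gamma> i t \<in> F" "gen \<Gamma> i (label i (shift n b)) \<in> F"
      using t label(1)[OF shift_closed[OF b]] gen_carrier by blast+
    from factorization_unique(2)[OF kgraph seg_closed[OF b] g(1) seg_closed[OF b] g(2) eq refl]
    show "t = label i (shift n b)"
      using gen_inject t label(1)[OF shift_closed[OF b]] by blast
  qed
  moreover have "(\<chi> i. nat (- ((- zvec n) $ i))) = n" by (simp add: vec_eq_iff)
  ultimately show ?thesis unfolding Sig_def Let_def by (simp only:)
qed

text \<open>The relation \<open>R\<close> will be equality, giving the periods of the orbit itself, or equality of
  tails, giving the symmetry group.\<close>

definition periods :: "('h \<Rightarrow> 'h \<Rightarrow> bool) \<Rightarrow> 'h \<Rightarrow> 'k ZZk set" where
  "periods R b = {zvec m - zvec n |m n. R (shift m b) (shift n b)}"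

definition shift_congruence :: "('h \<Rightarrow> 'h \<Rightarrow> bool) \<Rightarrow> bool" where
  "shift_congruence R \<longleftrightarrow> (\<forall>a\<in>B. R a a) \<and> (\<forall>a\<in>B. \<forall>b\<in>B. R a b \<longrightarrow> R b a) \<and>
     (\<forall>a\<in>B. \<forall>b\<in>B. \<forall>c\<in>B. R a b \<longrightarrow> R b c \<longrightarrow> R a c) \<and>
     (\<forall>a\<in>B. \<forall>b\<in>B. \<forall>n. R a b \<longrightarrow> R (shift n a) (shift n b))"

lemma shift_congruence_eq: "shift_congruence (=)"
  by (auto simp: shift_congruence_def)

lemma shift_congruence_same_tail: "shift_congruence same_tail"
  unfolding shift_congruence_def
proof (intro conjI ballI allI impI)
  show "same_tail (shift n a) (shift n b)" if "a \<in> B" "b \<in> B" "same_tail a b" for a b n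
    using that by (rule same_tail_shift)
qed (auto simp: same_tail_def)

lemma additive_subgroup_periods:
  assumes R: "shift_congruence R" and b: "b \<in> B"
  shows "additive_subgroup (periods R b)"
  unfolding additive_subgroup_def
proof (intro conjI ballI)
  have "R (shift 0 b) (shift 0 b)" using R shift_closed[OF b] by (simp add: shift_congruence_def)
  then show "0 \<in> periods R b" unfolding periods_def by (auto intro!: exI[of _ 0])
  fix p q assume "p \<in> periods R b" "q \<in> periods R b"
  then obtain m n m' n' where p: "p = zvec m - zvec n" "R (shift m b) (shift n b)"
      and q: "q = zvec m' - zvec n'" "R (shift m' b) (shift n' b)"
    unfolding periods_def by blast
  note S = shift_closed[OF b] and SS = shift_closed[OF shift_closed[OF b]]
  have "R (shift n' (shift m b)) (shift n' (shift n b))"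
    using R p(2) S by (simp add: shift_congruence_def)
  moreover have "R (shift n (shift n' b)) (shift n (shift m' b))"
    using R q(2) S by (simp add: shift_congruence_def)
  ultimately have "R (shift n' (shift m b)) (shift n (shift m' b))"
    using R SS unfolding shift_commute[OF b, of n' n] shift_congruence_def by blast
  then have "R (shift (m + n') b) (shift (m' + n) b)"
    by (simp add: cocycle(2)[OF b] shift_commute[OF b, of n m'])
  moreover have "p - q = zvec (m + n') - zvec (m' + n)" by (simp add: p q zvec_add)
  ultimately show "p - q \<in> periods R b" unfolding periods_def by blast
qed

lemma periods_shift:
  assumes R: "shift_congruence R" and b: "b \<in> B"
  shows "periods R (shift r b) = periods R b"
proof
  show "periods R (shift r b) \<subseteq> periods R b"
  proof
    fix p assume "p \<in> periods R (shift r b)"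
    then obtain m n where p: "p = zvec m - zvec n" "R (shift m (shift r b)) (shift n (shift r b))"
      unfolding periods_def by blast
    then have "R (shift (r + m) b) (shift (r + n) b)" by (simp add: cocycle(2)[OF b])
    moreover have "p = zvec (r + m) - zvec (r + n)" by (simp add: p zvec_add)
    ultimately show "p \<in> periods R b" unfolding periods_def by blast
  qed
  show "periods R b \<subseteq> periods R (shift r b)"
  proof
    fix p assume "p \<in> periods R b"
    then obtain m n where p: "p = zvec m - zvec n" "R (shift m b) (shift n b)"
      unfolding periods_def by blast
    then have "R (shift r (shift m b)) (shift r (shift n b))"
      using R shift_closed[OF b] by (simp add: shift_congruence_def)
    then have "R (shift m (shift r b)) (shift n (shift r b))"
      unfolding shift_commute[OF b, of r] .
    then show "p \<in> periods R (shift r b)" unfolding periods_def using p by blast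
  qed
qed

lemma periods_independent:
  assumes R: "shift_congruence R" and ab: "a \<in> B" "b \<in> B"
  shows "periods R a = periods R b"
proof -
  obtain m n where "shift m a = shift n b" by (rule shifts_meet[OF ab])
  then show ?thesis using periods_shift[OF R ab(1), of m] periods_shift[OF R ab(2), of n] by simp
qed

text \<open>\<open>\<Sigma>\<close> at \<open>- n\<close> lists the labels of \<open>shift n b\<close>.  An eventual period \<open>p\<close> with bound \<open>T\<close> thus compares
  the tails of the shifts of \<open>b\<close> by \<open>- T\<close> and by \<open>- (T + p)\<close>, and the condition for all \<open>n \<le> T\<close> says
  that these tails agree in all labels.\<close>

lemma symmetry_group_eq_periods:
  assumes b: "b \<in> B"
  shows "symmetry_group \<Gamma> \<sigma> b = periods same_tail b"
proof -
  let ?S = "Sig \<Gamma> (\<lambda>n. seg n b)"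
  have Sig: "?S (- zvec (m + r)) = ?S (- zvec (n + r)) \<longleftrightarrow>
      (\<forall>i. label i (shift r (shift m b)) = label i (shift r (shift n b)))" for m n r
    by (simp add: Sig_seg[OF b] vec_eq_iff cocycle(2)[OF b])
  have st: "same_tail (shift m b) (shift n b) \<longleftrightarrow> (\<forall>r. ?S (- zvec (m + r)) = ?S (- zvec (n + r)))" for m n
    unfolding Sig by (rule same_tail_iff_label[OF shift_closed[OF b] shift_closed[OF b]])
  show ?thesis
  proof (intro equalityI subsetI)
    fix p assume "p \<in> symmetry_group \<Gamma> \<sigma> b"
    then obtain T where T: "T \<le> 0" "T + p \<le> 0" "\<And>n. n \<le> T \<Longrightarrow> ?S n = ?S (n + p)"
      by (auto simp: symmetry_group_def tail_symmetry_group_def eventually_periodic_def tail_of_eq[OF b])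
    define m where "m = nvec (- T)"
    define n where "n = nvec (- (T + p))"
    have m: "zvec m = - T" unfolding m_def by (rule zvec_nvec) (use T(1) in \<open>simp add: less_eq_vec_def\<close>)
    have n: "zvec n = - (T + p)"
      unfolding n_def
    proof (rule zvec_nvec)
      have "T $ i + p $ i \<le> 0" for i using T(2) by (simp add: less_eq_vec_def)
      then show "0 \<le> - (T + p)" unfolding less_eq_vec_def
        by (metis neg_0_le_iff_le vector_add_component vector_uminus_component zero_index)
    qed
    have "?S (- zvec (m + r)) = ?S (- zvec (n + r))" for r
    proof -
      have "- zvec (m + r) \<le> T" by (simp add: zvec_add m) (simp add: less_eq_vec_def)
      from T(3)[OF this] show ?thesis by (simp add: zvec_add m n algebra_simps)
    qed
    then have "same_tail (shift m b) (shift n b)" unfolding st by blast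
    moreover have "p = zvec m - zvec n" by (simp add: m n)
    ultimately show "p \<in> periods same_tail b" unfolding periods_def by blast
  next
    fix p assume "p \<in> periods same_tail b"
    then obtain m n where p: "p = zvec m - zvec n" and mn: "same_tail (shift m b) (shift n b)"
      unfolding periods_def by blast
    have "?S z = ?S (z + p)" if z: "z \<le> - zvec m" for z
    proof -
      define r where "r = nvec (- zvec m - z)"
      have "zvec r = - zvec m - z" unfolding r_def
        by (rule zvec_nvec) (use z in \<open>simp add: less_eq_vec_def algebra_simps\<close>)
      then have z1: "z = - zvec (m + r)" and z2: "z + p = - zvec (n + r)"
        by (simp_all add: zvec_add p)
      show ?thesis unfolding z2 using mn[unfolded st] z1 by simp
    qed
    moreover have "- zvec m \<le> 0" "- zvec m + p \<le> 0" by (simp_all add: p less_eq_vec_def)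
    ultimately show "p \<in> symmetry_group \<Gamma> \<sigma> b"
      unfolding symmetry_group_def tail_symmetry_group_def eventually_periodic_def tail_of_eq[OF b]
      by blast
  qed
qed

end

section \<open>Extending a backward orbit to all of the lattice\<close>

lemma zvec_parts: "zvec (nvec h) - zvec (nvec (- h)) = h"
  by (simp add: vec_eq_iff nvec_def)

lemma common_part:
  fixes m n :: "'k::finite NNk"
  assumes "zvec m - zvec n = h"
  obtains c where "m = nvec h + c" "n = nvec (- h) + c"
proof
  have h: "h $ i = int (m $ i) - int (n $ i)" for i using assms by (auto simp: vec_eq_iff)
  show "m = nvec h + (\<chi> i. min (m $ i) (n $ i))" "n = nvec (- h) + (\<chi> i. min (m $ i) (n $ i))"
    by (auto simp: vec_eq_iff nvec_def h)
qed

context atomic_star_rep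
begin

text \<open>The positive and negative parts of \<open>h\<close> give the smallest pair of shifts with difference \<open>h\<close>, so
  this says that the tail has the periods in \<open>S\<close> from the start rather than eventually.\<close>

definition tail_symmetric :: "'k ZZk set \<Rightarrow> 'h \<Rightarrow> bool" where
  "tail_symmetric S b \<longleftrightarrow> (\<forall>h\<in>S. same_tail (shift (nvec h) b) (shift (nvec (- h)) b))"

lemma tail_symmetric_shift:
  assumes "b \<in> B" "tail_symmetric S b"
  shows "tail_symmetric S (shift r b)"
  unfolding tail_symmetric_def
proof
  fix h assume "h \<in> S"
  then have "same_tail (shift (nvec h) b) (shift (nvec (- h)) b)"
    using assms(2) by (simp add: tail_symmetric_def)
  then have "same_tail (shift r (shift (nvec h) b)) (shift r (shift (nvec (- h)) b))"
    by (intro same_tail_shift shift_closed assms(1))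
  then show "same_tail (shift (nvec h) (shift r b)) (shift (nvec (- h)) (shift r b))"
    unfolding shift_commute[OF assms(1), of r] .
qed

text \<open>A period \<open>h\<close> relates shifts by \<open>m\<close> and \<open>n\<close>; after shifting by the common part of \<open>m\<close> and \<open>n\<close> it
  relates those by the positive and negative parts of \<open>h\<close>.  Finitely many such shifts can be combined.\<close>

lemma eventually_tail_symmetric:
  assumes b: "b \<in> B" and "finite S" "S \<subseteq> periods same_tail b"
  shows "\<exists>r. tail_symmetric S (shift r b)"
  using assms(2,3)
proof (induction S rule: finite_induct)
  case empty
  then show ?case by (simp add: tail_symmetric_def)
next
  case (insert h S)
  then obtain r where r: "tail_symmetric S (shift r b)" by blast
  obtain m n where mn: "h = zvec m - zvec n" "same_tail (shift m b) (shift n b)"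
    using insert(4) unfolding periods_def by blast
  obtain c where c: "m = nvec h + c" "n = nvec (- h) + c"
    by (rule common_part[OF mn(1)[symmetric]])
  have "same_tail (shift (nvec h) (shift c b)) (shift (nvec (- h)) (shift c b))"
    using mn(2) unfolding c by (simp add: cocycle(2)[OF b] shift_commute[OF b, of c])
  then have "tail_symmetric {h} (shift c b)" by (simp add: tail_symmetric_def)
  then have "tail_symmetric {h} (shift r (shift c b))" by (rule tail_symmetric_shift[OF shift_closed[OF b]])
  moreover have "tail_symmetric S (shift c (shift r b))"
    by (rule tail_symmetric_shift[OF shift_closed[OF b] r])
  ultimately have "tail_symmetric (insert h S) (shift (c + r) b)"
    unfolding cocycle(2)[OF b] shift_commute[OF b, of c r] by (simp add: tail_symmetric_def)
  then show ?case by blast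
qed

text \<open>Prepending a word \<open>W\<close> of degree \<open>d\<close> to the symmetric tail of \<open>x\<close> keeps it symmetric if this
  holds for some other tail with the same segment of degree \<open>c\<close>.  Indeed the two tails to be compared
  agree after removing degree \<open>d\<close>, because \<open>x\<close> is symmetric, so only their segments of degree \<open>d\<close>
  matter; these lie within \<open>W\<close> followed by a segment of \<open>x\<close> of degree at most \<open>c\<close>.  The segment of
  degree \<open>c\<close> is determined in the same way, which allows the step to be iterated.  Here \<open>W\<close> is the
  segment \<open>seg d y = seg d y0\<close>.\<close>

lemma prepend_tail_symmetric:
  assumes B: "x \<in> B" "y \<in> B" "y0 \<in> B"
    and sym: "tail_symmetric S x" "tail_symmetric S y0"
    and W: "shift d y = x" "seg d y = seg d y0" "seg c x = seg c (shift d y0)"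
    and c: "\<And>h. h \<in> S \<Longrightarrow> \<exists>r. c = nvec h + r" "\<And>h. h \<in> S \<Longrightarrow> \<exists>r. c = nvec (- h) + r"
  shows "tail_symmetric S y" and "seg c y = seg c y0"
proof -
  have dc: "seg (d + c) y = seg (d + c) y0" using W by (simp add: cocycle(1) B)
  then show "seg c y = seg c y0"
    using seg_prefix(1)[OF B(2,3), of c d] by (simp add: add.commute)
  have head: "seg d (shift a y) = seg d (shift a y0)" if "c = a + r" for a r
  proof -
    have "seg (a + (d + r)) y = seg (a + (d + r)) y0"
      using dc unfolding that by (simp add: ac_simps)
    then have "seg (d + r) (shift a y) = seg (d + r) (shift a y0)" by (rule seg_prefix(2)[OF B(2,3)])
    then show ?thesis by (rule seg_prefix(1)[OF shift_closed[OF B(2)] shift_closed[OF B(3)]])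
  qed
  show "tail_symmetric S y"
    unfolding tail_symmetric_def
  proof
    fix h assume h: "h \<in> S"
    obtain r r' where r: "c = nvec h + r" "c = nvec (- h) + r'" using c[OF h] by blast
    show "same_tail (shift (nvec h) y) (shift (nvec (- h)) y)"
    proof (rule same_tail_from_head[of _ _ d])
      have "seg d (shift (nvec h) y0) = seg d (shift (nvec (- h)) y0)"
        using sym(2) h by (simp add: tail_symmetric_def same_tail_def)
      then show "seg d (shift (nvec h) y) = seg d (shift (nvec (- h)) y)"
        unfolding head[OF r(1)] head[OF r(2)] .
      have "same_tail (shift (nvec h) x) (shift (nvec (- h)) x)"
        using sym(1) h by (simp add: tail_symmetric_def)
      then show "same_tail (shift d (shift (nvec h) y)) (shift d (shift (nvec (- h)) y))"
        unfolding shift_commute[OF B(2), of d] W(1) .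
    qed (simp_all add: shift_closed B)
  qed
qed

definition const_vec :: "nat \<Rightarrow> 'k NNk" where "const_vec n = (\<chi> i. n)"

lemma const_vec_add: "const_vec (m + n) = const_vec m + const_vec n"
  by (simp add: const_vec_def vec_eq_iff)

text \<open>The degree \<open>c\<close> bounds all parts of elements of \<open>S\<close>.  There are finitely many words of degree \<open>c\<close>,
  so the shifts of \<open>b\<close> by constant vectors repeat a segment of degree \<open>c\<close>, at \<open>y n\<close> and \<open>y m\<close>, say.  The
  word leading from \<open>y m\<close> to \<open>y n\<close> can then be prepended to any symmetric tail with that segment and
  reproduces the segment.\<close>

lemma tail_symmetric_ascent:
  assumes b: "b \<in> B" and S: "finite S" "tail_symmetric S b"
  obtains d z where "d > 0" "\<And>j. z j \<in> B" "\<And>j. tail_symmetric S (z j)"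
    "\<And>j. shift (const_vec d) (z (Suc j)) = z j"
proof -
  define c where "c = (\<Sum>h\<in>S. nvec h + nvec (- h))"
  have c: "\<exists>r. c = nvec h + r" "\<exists>r. c = nvec (- h) + r" if "h \<in> S" for h
  proof -
    have "c = (nvec h + nvec (- h)) + (\<Sum>h\<in>S - {h}. nvec h + nvec (- h))"
      unfolding c_def using S(1) that by (rule sum.remove)
    then have "c = nvec h + (nvec (- h) + (\<Sum>h\<in>S - {h}. nvec h + nvec (- h)))"
        "c = nvec (- h) + (nvec h + (\<Sum>h\<in>S - {h}. nvec h + nvec (- h)))"
      by (simp_all add: ac_simps)
    then show "\<exists>r. c = nvec h + r" "\<exists>r. c = nvec (- h) + r" by blast+
  qed
  define y where "y n = shift (const_vec n) b" for n
  have y: "y n \<in> B" "tail_symmetric S (y n)" for n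
    unfolding y_def using shift_closed[OF b] tail_symmetric_shift[OF b S(2)] by auto
  have "finite (range (\<lambda>n. seg c (y n)))"
    by (rule finite_subset[OF _ finite_degree[of \<Gamma> c]]) (auto simp: seg_closed deg_seg y)
  then have "\<not> inj (\<lambda>n. seg c (y n))" using range_inj_infinite by blast
  then obtain n m where nm: "n < m" "seg c (y n) = seg c (y m)"
    unfolding inj_def by (metis linorder_neqE_nat)
  define d where "d = m - n"
  have y_nm: "shift (const_vec d) (y n) = y m"
    using nm(1) cocycle(2)[OF b, of "const_vec n" "const_vec d"]
    by (simp add: y_def d_def const_vec_add[symmetric])
  have "\<exists>z. \<forall>j. (z j \<in> B \<and> tail_symmetric S (z j) \<and> seg c (z j) = seg c (y m)) \<and>
      shift (const_vec d) (z (Suc j)) = z j"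
  proof (rule dependent_nat_choice)
    show "\<exists>x. x \<in> B \<and> tail_symmetric S x \<and> seg c x = seg c (y m)" using y by blast
    fix x and j :: nat assume x: "x \<in> B \<and> tail_symmetric S x \<and> seg c x = seg c (y m)"
    obtain a where a: "a \<in> B" "seg (const_vec d) a = seg (const_vec d) (y n)" "shift (const_vec d) a = x"
      using prepend[OF seg_closed[OF y(1)], of x "const_vec d" n] x by (auto simp: deg_seg[OF y(1)])
    have sx: "x \<in> B" "tail_symmetric S x" "seg c x = seg c (shift (const_vec d) (y n))"
      using x by (auto simp: y_nm)
    note P = prepend_tail_symmetric[OF sx(1) a(1) y(1) sx(2) y(2) a(3,2) sx(3) c]
    show "\<exists>a. (a \<in> B \<and> tail_symmetric S a \<and> seg c a = seg c (y m)) \<and> shift (const_vec d) a = x"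
      using a(1,3) P nm(2) by auto
  qed
  then obtain z where "\<And>j. z j \<in> B" "\<And>j. tail_symmetric S (z j)"
      "\<And>j. shift (const_vec d) (z (Suc j)) = z j" by blast
  moreover have "d > 0" using nm(1) by (simp add: d_def)
  ultimately show ?thesis using that by blast
qed

text \<open>Every lattice point lies below some multiple of \<open>const_vec d\<close>, so shifting the ascending
  sequence \<open>z\<close> backwards defines \<open>x\<close> everywhere.  The periods of the tails along \<open>x\<close> that hold at all
  points form a group, so it suffices to check generators.\<close>

lemma lattice_orbit_exists:
  assumes b: "b \<in> B"
  obtains x where "\<And>g. x g \<in> B" "\<And>g n. shift n (x g) = x (g - zvec n)"
    "\<And>g p. p \<in> periods same_tail b \<Longrightarrow> same_tail (x (g + p)) (x g)"
proof -
  have "additive_subgroup (periods same_tail b)"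
    by (rule additive_subgroup_periods[OF shift_congruence_same_tail b])
  then obtain S where S: "finite S" "S \<subseteq> periods same_tail b"
      "\<And>P. additive_subgroup P \<Longrightarrow> S \<subseteq> P \<Longrightarrow> periods same_tail b \<subseteq> P"
    using additive_subgroup_finitely_generated by metis
  obtain r where "tail_symmetric S (shift r b)" using eventually_tail_symmetric[OF b S(1,2)] by blast
  then obtain d z where z: "d > 0" "\<And>j. z j \<in> B" "\<And>j. tail_symmetric S (z j)"
      "\<And>j. shift (const_vec d) (z (Suc j)) = z j"
    using tail_symmetric_ascent[OF shift_closed[OF b] S(1)] by metis
  have descend: "shift (const_vec (d * k)) (z (j + k)) = z j" for j k
  proof (induction k)
    case 0
    have "const_vec 0 = 0" by (simp add: const_vec_def vec_eq_iff)
    then show ?case by (simp add: at_zero z(2))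
  next
    case (Suc k)
    have "const_vec (d * Suc k) = const_vec d + const_vec (d * k)" by (simp add: const_vec_add)
    then show ?case using Suc z(4)[of "j + k"] by (simp add: cocycle(2)[OF z(2)])
  qed
  have agree: "shift a (z j) = shift a' (z j')"
    if "zvec (const_vec (d * j)) = g + zvec a" "zvec (const_vec (d * j')) = g + zvec a'" "j \<le> j'" for g a a' j j'
  proof -
    have "d * j + d * (j' - j) = d * j'" using that(3) by (simp add: distrib_left[symmetric])
    then have "const_vec (d * j') = const_vec (d * j) + const_vec (d * (j' - j))"
      by (simp add: const_vec_add[symmetric])
    then have "zvec a' = zvec (const_vec (d * (j' - j)) + a)"
      using that(1,2) by (simp add: zvec_add algebra_simps)
    then have "a' = const_vec (d * (j' - j)) + a" by (simp only: zvec_inject)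
    then show ?thesis
      using descend[of "j' - j" j] that(3) by (simp add: cocycle(2)[OF z(2)])
  qed
  define x where "x g = (SOME c. \<exists>j a. zvec (const_vec (d * j)) = g + zvec a \<and> c = shift a (z j))" for g
  have x: "x g = shift a (z j)" if "zvec (const_vec (d * j)) = g + zvec a" for g j a
    unfolding x_def
  proof (rule some_equality)
    show "\<exists>j' a'. zvec (const_vec (d * j')) = g + zvec a' \<and> shift a (z j) = shift a' (z j')"
      using that by blast
    fix c assume "\<exists>j' a'. zvec (const_vec (d * j')) = g + zvec a' \<and> c = shift a' (z j')"
    then obtain j' a' where c: "zvec (const_vec (d * j')) = g + zvec a'" "c = shift a' (z j')" by blast
    show "c = shift a (z j)"
      using agree[OF that c(1)] agree[OF c(1) that] c(2) by (metis nat_le_linear)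
  qed
  have above: "\<exists>j a. zvec (const_vec (d * j)) = g + zvec a" for g
  proof -
    define j where "j = (\<Sum>i\<in>UNIV. nat \<bar>g $ i\<bar>)"
    have "g $ i \<le> int (d * j)" for i
    proof -
      have "nat \<bar>g $ i\<bar> \<le> j" unfolding j_def by (rule member_le_sum) auto
      moreover have "j \<le> d * j" using z(1) by simp
      ultimately show ?thesis by linarith
    qed
    then have "0 \<le> zvec (const_vec (d * j)) - g" by (simp add: less_eq_vec_def const_vec_def)
    then have "zvec (const_vec (d * j)) = g + zvec (nvec (zvec (const_vec (d * j)) - g))"
      by (simp add: zvec_nvec)
    then show ?thesis by blast
  qed
  have x_closed: "x g \<in> B" for g
  proof -
    obtain j a where "zvec (const_vec (d * j)) = g + zvec a" using above by blast
    then show ?thesis using shift_closed[OF z(2)] by (simp add: x)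
  qed
  have x_shift: "shift n (x g) = x (g - zvec n)" for n g
  proof -
    obtain j a where ja: "zvec (const_vec (d * j)) = g + zvec a" using above by blast
    then have "zvec (const_vec (d * j)) = (g - zvec n) + zvec (a + n)" by (simp add: zvec_add)
    then show ?thesis using x[OF ja] by (simp add: x cocycle(2)[OF z(2)])
  qed
  let ?P = "{p. \<forall>g. same_tail (x (g + p)) (x g)}"
  have "additive_subgroup ?P"
    unfolding additive_subgroup_def
  proof (intro conjI ballI)
    show "0 \<in> ?P" by (simp add: same_tail_def)
    fix p q assume pq: "p \<in> ?P" "q \<in> ?P"
    have "same_tail (x (g + (p - q))) (x g)" for g
    proof -
      have "same_tail (x (g + (p - q) + q)) (x (g + (p - q)))" using pq(2) by blast
      moreover have "same_tail (x (g + p)) (x g)" using pq(1) by blast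
      ultimately show ?thesis by (simp add: same_tail_def)
    qed
    then show "p - q \<in> ?P" by blast
  qed
  moreover have "S \<subseteq> ?P"
  proof
    fix h assume h: "h \<in> S"
    have "same_tail (x (g + h)) (x g)" for g
    proof -
      obtain j e where e: "zvec (const_vec (d * j)) = (g + zvec (nvec h)) + zvec e" using above by blast
      have "x g = shift e (shift (nvec h) (z j))"
        using x[of j g "nvec h + e"] e by (simp add: zvec_add add.assoc cocycle(2)[OF z(2)])
      moreover have "x (g + h) = shift e (shift (nvec (- h)) (z j))"
      proof -
        have "zvec (nvec h) = h + zvec (nvec (- h))" using zvec_parts[of h] by (simp add: algebra_simps)
        then have "zvec (const_vec (d * j)) = (g + h) + zvec (nvec (- h) + e)"
          using e by (simp add: zvec_add add.assoc)
        then show ?thesis by (simp add: x cocycle(2)[OF z(2)])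
      qed
      moreover have "same_tail (shift (nvec h) (z j)) (shift (nvec (- h)) (z j))"
        using z(3) h by (simp add: tail_symmetric_def)
      then have "same_tail (shift e (shift (nvec h) (z j))) (shift e (shift (nvec (- h)) (z j)))"
        by (intro same_tail_shift shift_closed z(2))
      ultimately show ?thesis by (simp add: same_tail_def)
    qed
    then show "h \<in> ?P" by blast
  qed
  ultimately have "periods same_tail b \<subseteq> ?P" by (rule S(3))
  then show ?thesis using that[of x] x_closed x_shift by blast
qed

end

section \<open>Periods and phases of a lattice orbit\<close>

locale lattice_orbit = atomic_star_rep \<Gamma> B \<sigma>
  for \<Gamma> :: "'k::{finite,linorder} presentation" and B :: "'h::complex_hilbert set" and \<sigma> +
  fixes x :: "'k ZZk \<Rightarrow> 'h"
  assumes x_closed: "x g \<in> B"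
    and x_shift: "shift n (x g) = x (g - zvec n)"
    and x_periodic: "p \<in> periods same_tail (x 0) \<Longrightarrow> same_tail (x (g + p)) (x g)"
begin

definition H :: "'k ZZk set" where "H = periods same_tail (x 0)"

definition K :: "'k ZZk set" where "K = periods (=) (x 0)"

lemma K_subset_H: "K \<subseteq> H"
proof
  fix p assume "p \<in> K"
  then obtain m n where "p = zvec m - zvec n" "shift m (x 0) = shift n (x 0)"
    unfolding K_def periods_def by blast
  moreover from this have "same_tail (shift m (x 0)) (shift n (x 0))" by (simp add: same_tail_def)
  ultimately show "p \<in> H" unfolding H_def periods_def by blast
qed

lemma additive_subgroup_H: "additive_subgroup H"
  unfolding H_def by (rule additive_subgroup_periods[OF shift_congruence_same_tail x_closed])

lemma additive_subgroup_K: "additive_subgroup K"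
  unfolding K_def by (rule additive_subgroup_periods[OF shift_congruence_eq x_closed])

lemma common_lower:
  obtains a b where "g - zvec a = g' - zvec b"
proof
  show "g - zvec (nvec (g - g')) = g' - zvec (nvec (- (g - g')))"
    using zvec_parts[of "g - g'"] by (simp add: algebra_simps)
qed

text \<open>The origin and both points of the orbit have a common lower bound, to which the relation can be
  transported.\<close>

lemma related_imp_period:
  assumes R: "shift_congruence R" and r: "R (x (g + p)) (x g)"
  shows "p \<in> periods R (x 0)"
proof -
  obtain a r where a: "g - zvec a = 0 - zvec r" by (rule common_lower)
  obtain b s where b: "g + p - zvec b = 0 - zvec s" by (rule common_lower)
  have za: "zvec a = g + zvec r" and zb: "zvec b = g + p + zvec s"
    using a b by (simp_all add: algebra_simps)
  have "R (shift (a + b) (x (g + p))) (shift (a + b) (x g))"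
    using R r x_closed by (simp add: shift_congruence_def)
  moreover have "shift (a + b) (x (g + p)) = shift (a + s) (x 0)"
    unfolding x_shift zvec_add za zb by (simp add: algebra_simps)
  moreover have "shift (a + b) (x g) = shift (r + b) (x 0)"
    unfolding x_shift zvec_add za zb by (simp add: algebra_simps)
  ultimately have "R (shift (r + b) (x 0)) (shift (a + s) (x 0))"
    using R shift_closed[OF x_closed] by (simp add: shift_congruence_def)
  moreover have "p = zvec (r + b) - zvec (a + s)"
    unfolding zvec_add za zb by (simp add: algebra_simps)
  ultimately show ?thesis unfolding periods_def by blast
qed

lemma same_tail_iff: "same_tail (x (g + p)) (x g) \<longleftrightarrow> p \<in> H"
  using x_periodic related_imp_period[OF shift_congruence_same_tail] unfolding H_def by blast

text \<open>What defines an element of \<open>K\<close> is an equality far enough back on the orbit.  It propagates to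
  all of the orbit because elements of \<open>K\<close> preserve tails, and two basis vectors with the same
  tail and a common backward shift coincide.\<close>

lemma x_eq_iff: "x (g + p) = x g \<longleftrightarrow> p \<in> K"
proof
  show "x (g + p) = x g \<Longrightarrow> p \<in> K"
    unfolding K_def by (rule related_imp_period[OF shift_congruence_eq])
  assume p: "p \<in> K"
  then obtain m n where mn: "p = zvec m - zvec n" "shift m (x 0) = shift n (x 0)"
    unfolding K_def periods_def by blast
  then have low: "x (- zvec m + p) = x (- zvec m)" by (simp add: x_shift)
  obtain a b where ab: "g - zvec a = - zvec m - zvec b" by (rule common_lower)
  then have za: "zvec a = g + zvec m + zvec b" by (simp add: algebra_simps)
  have "shift a (x (g + p)) = shift b (x (- zvec m + p))"
    unfolding x_shift za by (simp add: algebra_simps)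
  also have "\<dots> = shift a (x g)" unfolding low unfolding x_shift using ab by simp
  finally have "shift a (x (g + p)) = shift a (x g)" .
  moreover have "same_tail (x (g + p)) (x g)" using p K_subset_H same_tail_iff by blast
  ultimately show "x (g + p) = x g" using same_tail_shift_inject[OF x_closed x_closed] by blast
qed

text \<open>The phase of going from \<open>g\<close> back to a common lower bound of \<open>g\<close> and the origin and then up to
  the origin.  Its coboundary is the phase cocycle, see \<open>coph_step\<close>.\<close>

definition coph :: "'k ZZk \<Rightarrow> complex" where
  "coph g = phase (nvec g) (x g) / phase (nvec (- g)) (x 0)"

lemma phase_nonzero: "b \<in> B \<Longrightarrow> phase n b \<noteq> 0"
  using phase_unit[of b n] by auto

lemma coph_eq:
  assumes g: "zvec m - zvec n = g"
  shows "coph g = phase m (x g) / phase n (x 0)"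
proof -
  obtain c where c: "m = nvec g + c" "n = nvec (- g) + c" by (rule common_part[OF g])
  have "g - zvec (nvec g) = - zvec (nvec (- g))" using zvec_parts[of g] by (simp add: algebra_simps)
  then have "phase m (x g) / phase n (x 0) = coph g *
      (phase c (x (- zvec (nvec (- g)))) / phase c (x (- zvec (nvec (- g)))))"
    unfolding c cocycle(3)[OF x_closed] x_shift coph_def by simp
  then show ?thesis using phase_nonzero[OF x_closed] by simp
qed

lemma coph_unit: "cmod (coph g) = 1"
  by (simp add: coph_def norm_divide phase_unit x_closed)

lemma coph_nonzero: "coph g \<noteq> 0"
  using coph_unit[of g] by auto

lemma coph_step: "coph g = phase n (x g) * coph (g - zvec n)"
proof -
  obtain m r where mr: "g - zvec n = zvec m - zvec r"
    using zvec_parts[of "g - zvec n"] by metis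
  have "coph g = phase (n + m) (x g) / phase r (x 0)"
    by (rule coph_eq) (use mr in \<open>simp add: zvec_add algebra_simps\<close>)
  also have "\<dots> = phase n (x g) * (phase m (x (g - zvec n)) / phase r (x 0))"
    by (simp add: cocycle(3)[OF x_closed] x_shift)
  also have "phase m (x (g - zvec n)) / phase r (x 0) = coph (g - zvec n)"
    by (rule coph_eq[symmetric]) (simp add: mr)
  finally show ?thesis .
qed

text \<open>The quotient \<open>coph (g + p) / coph g\<close> is unchanged when \<open>g\<close> moves down, since the phases met
  at \<open>x (g + p) = x g\<close> are the same; as any \<open>g\<close> and the origin have a common lower bound, it is constant.\<close>

lemma coph_add:
  assumes p: "p \<in> K"
  shows "coph (g + p) = coph g * coph p"
proof -
  have shift: "coph (g + p) * coph (g - zvec n) = coph (g - zvec n + p) * coph g" for g n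
  proof -
    have "coph (g + p) = phase n (x g) * coph (g - zvec n + p)"
      using coph_step[of "g + p" n] x_eq_iff[of g p] p by (simp add: algebra_simps)
    then show ?thesis using coph_step[of g n] by simp
  qed
  obtain a b where ab: "g - zvec a = 0 - zvec b" by (rule common_lower)
  have zero: "coph 0 = 1" using coph_eq[of 0 0 0] phase_nonzero[OF x_closed] by simp
  have "coph (g + p) * coph (- zvec b) = coph (- zvec b + p) * coph g"
    using shift[of g a] ab by simp
  moreover have "coph p * coph (- zvec b) = coph (- zvec b + p)"
    using shift[of 0 b] zero by simp
  ultimately have "coph (g + p) * coph (- zvec b) = (coph g * coph p) * coph (- zvec b)"
    by simp
  then show ?thesis using coph_nonzero by simp
qed

lemma unit_character_coph: "unit_character_on K coph"
  unfolding unit_character_on_def using coph_unit coph_add by blast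

section \<open>The group construction\<close>

definition ZZ :: "'k ZZk monoid" where "ZZ = \<lparr>carrier = UNIV, mult = (+), one = 0\<rparr>"

lemma comm_group_ZZ: "comm_group ZZ"
proof (rule comm_groupI)
  fix g :: "'k ZZk"
  show "\<exists>h\<in>carrier ZZ. h \<otimes>\<^bsub>ZZ\<^esub> g = \<one>\<^bsub>ZZ\<^esub>"
    by (rule bexI[of _ "- g"]) (simp_all add: ZZ_def)
qed (simp_all add: ZZ_def algebra_simps)

lemma inv_ZZ: "inv\<^bsub>ZZ\<^esub> g = - g"
proof -
  interpret comm_group ZZ by (rule comm_group_ZZ)
  show ?thesis by (rule inv_equality) (simp_all add: ZZ_def)
qed

lemma subgroup_K: "subgroup K ZZ"
proof -
  interpret comm_group ZZ by (rule comm_group_ZZ)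
  note K = additive_subgroupD[OF additive_subgroup_K]
  show ?thesis
  proof (rule subgroupI)
    show "K \<subseteq> carrier ZZ" by (simp add: ZZ_def)
    show "K \<noteq> {}" using K(1) by blast
    show "inv\<^bsub>ZZ\<^esub> a \<in> K" if "a \<in> K" for a using K(3)[OF that] by (simp add: inv_ZZ)
    show "a \<otimes>\<^bsub>ZZ\<^esub> b \<in> K" if "a \<in> K" "b \<in> K" for a b using K(4)[OF that] by (simp add: ZZ_def)
  qed
qed

lemma normal_K: "normal K ZZ"
  using comm_group.normal_iff_subgroup[OF comm_group_ZZ] subgroup_K by blast

definition G :: "'k ZZk set monoid" where "G = ZZ Mod K"

definition coset :: "'k ZZk \<Rightarrow> 'k ZZk set" where "coset g = K #>\<^bsub>ZZ\<^esub> g"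

lemma comm_group_G: "comm_group G"
  unfolding G_def by (rule comm_group.abelian_FactGroup[OF comm_group_ZZ subgroup_K])

lemma carrier_G: "carrier G = range coset"
  by (simp add: G_def carrier_FactGroup coset_def[abs_def] ZZ_def)

lemma coset_in_G: "coset g \<in> carrier G"
  by (simp add: carrier_G)

lemma coset_mult: "coset g \<otimes>\<^bsub>G\<^esub> coset h = coset (g + h)"
  using normal.rcos_sum[OF normal_K, of g h] by (simp add: G_def coset_def ZZ_def)

lemma coset_one: "coset 0 = \<one>\<^bsub>G\<^esub>"
  by (auto simp: G_def coset_def r_coset_def ZZ_def)

lemma coset_inv: "inv\<^bsub>G\<^esub> (coset g) = coset (- g)"
proof -
  interpret comm_group G by (rule comm_group_G)
  show ?thesis by (rule inv_equality) (simp_all add: coset_mult coset_one coset_in_G)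
qed

lemma coset_diff: "coset g \<otimes>\<^bsub>G\<^esub> inv\<^bsub>G\<^esub> (coset h) = coset (g - h)"
  by (simp add: coset_inv coset_mult)

lemma coset_eq_iff: "coset g = coset h \<longleftrightarrow> g - h \<in> K"
proof
  note K = additive_subgroupD[OF additive_subgroup_K]
  have mem: "v \<in> coset w \<longleftrightarrow> v - w \<in> K" for v w
    by (auto simp: coset_def r_coset_def ZZ_def intro!: bexI[of _ "v - w"])
  show "coset g = coset h \<Longrightarrow> g - h \<in> K" using mem[of g g] mem[of g h] K(1) by simp
  assume gh: "g - h \<in> K"
  have "v - g \<in> K \<longleftrightarrow> v - h \<in> K" for v
    using K(4)[OF _ gh, of "v - g"] K(2)[OF _ gh, of "v - h"] by auto
  then show "coset g = coset h" using mem by blast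
qed

definition represent :: "'k ZZk set \<Rightarrow> 'k ZZk" where "represent X = (SOME g. coset g = X)"

lemma represent_coset: "represent (coset g) - g \<in> K"
proof -
  have "coset (represent (coset g)) = coset g"
    unfolding represent_def by (rule someI[of _ g]) simp
  then show ?thesis by (simp add: coset_eq_iff)
qed

lemma represent_invariant:
  assumes "\<And>g p. p \<in> K \<Longrightarrow> f (g + p) = f g"
  shows "f (represent (coset g)) = f g"
  using assms[OF represent_coset, of g g] by simp

lemma canonical_hom_coset: "canonical_hom G (\<lambda>i. coset (axis i 1)) n = coset n"
proof -
  interpret comm_group G by (rule comm_group_G)
  have nat_pow: "coset g [^]\<^bsub>G\<^esub> (k :: nat) = coset (int k *s g)" for g k
  proof (induction k)
    case 0
    then show ?case by (simp add: coset_one)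
  next
    case (Suc k)
    have eq: "int (Suc k) *s g = int k *s g + g" by (simp add: vec_eq_iff algebra_simps)
    show ?case unfolding eq by (simp only: nat_pow_Suc Suc coset_mult)
  qed
  have pow: "coset g [^]\<^bsub>G\<^esub> (k :: int) = coset (k *s g)" for g k
  proof (cases "k \<ge> 0")
    case True
    then obtain m where "k = int m" using nonneg_int_cases by blast
    then show ?thesis by (simp add: int_pow_int nat_pow)
  next
    case False
    then obtain m where m: "k = - int m" by (metis int_cases2 of_nat_0_le_iff)
    have eq: "(- int m) *s g = - (int m *s g)" by (simp add: vec_eq_iff)
    show ?thesis
      unfolding m eq int_pow_neg[OF coset_in_G] int_pow_int nat_pow coset_inv ..
  qed
  have "(\<Otimes>\<^bsub>G\<^esub>i\<in>I. coset (f i)) = coset (\<Sum>i\<in>I. f i)" if "finite I" for I :: "'k set" and f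
    using that by (induction I rule: finite_induct) (simp_all add: coset_one coset_mult coset_in_G Pi_def)
  then show ?thesis
    unfolding canonical_hom_def pow by (simp only: finite_code basis_expansion)
qed

lemma generate_G: "generate G (range (\<lambda>i. coset (axis i 1))) = carrier G"
proof -
  interpret comm_group G by (rule comm_group_G)
  let ?S = "range (\<lambda>i. coset (axis i 1))"
  have S: "?S \<subseteq> carrier G" by (auto simp: coset_in_G)
  interpret S: subgroup "generate G ?S" G by (rule generate_is_subgroup[OF S])
  have "additive_subgroup {g. coset g \<in> generate G ?S}"
    unfolding additive_subgroup_def
  proof (intro conjI ballI)
    show "0 \<in> {g. coset g \<in> generate G ?S}" by (simp add: coset_one)
    fix g h assume "g \<in> {g. coset g \<in> generate G ?S}" "h \<in> {g. coset g \<in> generate G ?S}"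
    then have "coset g \<otimes>\<^bsub>G\<^esub> inv\<^bsub>G\<^esub> (coset h) \<in> generate G ?S" by simp
    then show "g - h \<in> {g. coset g \<in> generate G ?S}" by (simp add: coset_diff)
  qed
  moreover have "axis i 1 \<in> {g. coset g \<in> generate G ?S}" for i
    by (auto intro: generate.incl)
  ultimately have "g \<in> {g. coset g \<in> generate G ?S}" for g by (rule additive_subgroup_UNIV)
  then show ?thesis using S.subset by (auto simp: carrier_G)
qed

definition lab :: "'k \<Rightarrow> 'k ZZk set \<Rightarrow> nat" where "lab i X = label i (x (represent X))"

lemma label_periodic: "p \<in> H \<Longrightarrow> label i (x (g + p)) = label i (x g)"
  using same_tail_iff_label[OF x_closed x_closed, of "g + p" g] same_tail_iff[of g p]
  by (metis at_zero(2) x_closed)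

lemma lab_coset: "lab i (coset g) = label i (x g)"
  unfolding lab_def
  by (rule represent_invariant[where f = "\<lambda>g. label i (x g)"]) (use label_periodic K_subset_H in blast)

text \<open>Scalars that do not vary over the group impose no condition, and a translation that preserves
  all labels preserves all tails of the orbit, so it comes from \<open>H\<close>.\<close>

lemma full_symmetry_group_G:
  "full_symmetry_group G lab (\<lambda>i X. c i) = coset ` H"
  unfolding full_symmetry_group_def
proof (rule Greatest_equality)
  interpret comm_group G by (rule comm_group_G)
  note HH = additive_subgroupD[OF additive_subgroup_H]
  have "subgroup (coset ` H) G"
  proof (rule subgroupI)
    show "coset ` H \<subseteq> carrier G" by (auto simp: coset_in_G)
    show "coset ` H \<noteq> {}" using HH(1) by blast
    show "inv\<^bsub>G\<^esub> a \<in> coset ` H" if "a \<in> coset ` H" for a using that HH(3) by (auto simp: coset_inv)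
    show "a \<otimes>\<^bsub>G\<^esub> b \<in> coset ` H" if "a \<in> coset ` H" "b \<in> coset ` H" for a b
      using that HH(4) by (auto simp: coset_mult)
  qed
  then show "subgroup (coset ` H) G \<and>
      (\<forall>h\<in>coset ` H. \<forall>g\<in>carrier G. \<forall>i. lab i (g \<otimes>\<^bsub>G\<^esub> h) = lab i g \<and> c i = c i)"
    by (auto simp: carrier_G coset_mult lab_coset label_periodic)
  fix H' assume H': "subgroup H' G \<and>
      (\<forall>h\<in>H'. \<forall>g\<in>carrier G. \<forall>i. lab i (g \<otimes>\<^bsub>G\<^esub> h) = lab i g \<and> c i = c i)"
  show "H' \<le> coset ` H"
  proof
    fix X assume X: "X \<in> H'"
    then have "X \<in> carrier G" using H' subgroup.subset by blast
    then obtain p where p: "X = coset p" by (auto simp: carrier_G)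
    have "label i (x (g + p)) = label i (x g)" for i g
    proof -
      have "lab i (coset g \<otimes>\<^bsub>G\<^esub> coset p) = lab i (coset g)"
        using H' X coset_in_G[of g] unfolding p by blast
      then show ?thesis by (simp only: coset_mult lab_coset)
    qed
    from this[of _ "0 - zvec _"] have "same_tail (x (0 + p)) (x 0)"
      unfolding same_tail_iff_label[OF x_closed x_closed] x_shift by (simp add: algebra_simps)
    then show "X \<in> coset ` H" unfolding p using same_tail_iff by blast
  qed
qed

definition M :: "'h set" where "M = closure (cspan (range x))"

lemma closed_csubspace_M: "closed_csubspace M"
  unfolding M_def by (rule closed_csubspace_closure_cspan)

lemma x_in_M: "x g \<in> M"
  unfolding M_def by (rule subsetD[OF closure_cspan_superset rangeI])

text \<open>A basis vector outside the orbit is orthogonal to all of it.\<close>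

lemma cproj_basis: "b \<in> B \<Longrightarrow> b \<notin> range x \<Longrightarrow> cproj M b = 0"
proof (rule cproj_orthogonal[OF closed_csubspace_M])
  fix z assume b: "b \<in> B" "b \<notin> range x" and "z \<in> M"
  have "cinner a b = 0" if "a \<in> range x" for a
    using that b x_closed B_orthonormal[of a b] by auto
  then have "cinner z b = 0" using \<open>z \<in> M\<close> unfolding M_def by (rule orthogonal_closure_cspan)
  then show "cinner b z = 0" using cinner_zero_commute by blast
qed

text \<open>Adjoints move along the shifts, which is why the span of a set of basis vectors that is closed
  under the shifts is invariant under all adjoints.\<close>

lemma adjoint_basis:
  assumes w: "w \<in> F" and b: "b \<in> B"
  shows "\<exists>c. cadjoint UNIV (\<sigma> w) b = c *\<^sub>C shift (deg w) b"
proof (cases "w = seg (deg w) b")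
  case True
  have "cinner (\<sigma> w a) b = cinner a (cnj (phase (deg w) b) *\<^sub>C shift (deg w) b)" for a
  proof -
    let ?\<alpha> = "phase (deg w) b"
    have "?\<alpha> * cnj ?\<alpha> = 1" using phase_unit[OF b, of "deg w"] by (simp add: complex_norm_square[symmetric])
    then have "cnj ?\<alpha> *\<^sub>C (?\<alpha> *\<^sub>C b) = b" by (simp add: scaleC_scaleC mult.commute)
    then have "cinner (\<sigma> w a) b = cinner (\<sigma> w a) (cnj ?\<alpha> *\<^sub>C \<sigma> w (shift (deg w) b))"
      using \<sigma>_seg[OF b, of "deg w"] True by simp
    also have "\<dots> = cinner a (cnj ?\<alpha> *\<^sub>C shift (deg w) b)"
      by (simp add: cinner_scaleC_right cinner_\<sigma>[OF w])
    finally show ?thesis .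
  qed
  then have "cadjoint UNIV (\<sigma> w) b = cnj (phase (deg w) b) *\<^sub>C shift (deg w) b"
    by (intro cadjoint_eq) (auto simp: csubspace_iff)
  then show ?thesis by blast
next
  case False
  have "cinner (\<sigma> w a) b = cinner a 0" for a
  proof -
    have "cinner (\<sigma> w a) (\<sigma> (seg (deg w) b) (shift (deg w) b)) = 0"
      using ranges_orthogonal[OF w seg_closed[OF b]] False by (simp add: deg_seg[OF b])
    then show ?thesis
      using phase_nonzero[OF b] by (simp add: \<sigma>_seg[OF b] cinner_scaleC_right)
  qed
  then have "cadjoint UNIV (\<sigma> w) b = 0" by (intro cadjoint_eq) (auto simp: csubspace_iff)
  then show ?thesis by (intro exI[of _ 0]) simp
qed

lemma adjoint_M:
  assumes w: "w \<in> F" and y: "y \<in> M"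
  shows "cadjoint UNIV (\<sigma> w) y \<in> M"
proof -
  let ?A = "cadjoint UNIV (\<sigma> w)"
  note adj = isometry_adjoint[OF isometry_\<sigma>[OF w]]
  have eqI: "?A u = v" if "\<And>z. cinner (\<sigma> w z) u = cinner z v" for u v
    using that by (intro cadjoint_eq) (auto simp: csubspace_iff)
  have "bounded_operator UNIV ?A"
    unfolding bounded_operator_def
  proof (intro conjI ballI allI)
    show "?A (u + v) = ?A u + ?A v" for u v
      by (rule eqI) (simp add: cinner_add_right adj)
    show "?A (c *\<^sub>C u) = c *\<^sub>C ?A u" for c u
      by (rule eqI) (simp add: cinner_scaleC_right adj)
    show "\<exists>C. \<forall>u\<in>UNIV. norm (?A u) \<le> C * norm u"
    proof (intro exI ballI)
      fix u
      have "(norm (?A u))\<^sup>2 = cmod (cinner (\<sigma> w (?A u)) u)"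
        unfolding adj by (simp add: cinner_self norm_power)
      also have "\<dots> \<le> norm (?A u) * norm u"
        using cinner_Cauchy_Schwarz[of "\<sigma> w (?A u)" u] isometry_\<sigma>[OF w] by (simp add: isometry_def)
      finally have "norm (?A u) * norm (?A u) \<le> norm (?A u) * norm u" by (simp add: power2_eq_square)
      then show "norm (?A u) \<le> 1 * norm u"
        by (cases "?A u = 0") simp_all
    qed
  qed simp
  note D = bounded_operatorD[OF this]
  have "closed_csubspace {u. ?A u \<in> M}"
    unfolding closed_csubspace_def
  proof
    show "csubspace {u. ?A u \<in> M}"
      unfolding csubspace_iff using closed_csubspaceD[OF closed_csubspace_M] by (simp add: D(1-3))
    have "closed M" using closed_csubspace_M by (simp add: closed_csubspace_def)
    then have "closed (?A -` M)"
      using linear_continuous_on[OF D(4)] by (rule closed_vimage[OF _ _, unfolded])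
    then show "closed {u. ?A u \<in> M}" by (simp add: vimage_def)
  qed
  moreover have "range x \<subseteq> {u. ?A u \<in> M}"
  proof
    fix u assume "u \<in> range x"
    then obtain g where g: "u = x g" by blast
    obtain c where "?A (x g) = c *\<^sub>C shift (deg w) (x g)" using adjoint_basis[OF w x_closed] by blast
    then show "u \<in> {u. ?A u \<in> M}"
      unfolding g x_shift by (simp add: closed_csubspaceD(3)[OF closed_csubspace_M x_in_M])
  qed
  ultimately have "M \<subseteq> {u. ?A u \<in> M}" unfolding M_def by (rule closure_cspan_minimal)
  then show ?thesis using y by blast
qed

definition \<rho> :: "'k word set \<Rightarrow> 'h \<Rightarrow> 'h" where "\<rho> w y = cproj M (\<sigma> w y)"

text \<open>Invariance of \<open>M\<close> under the adjoints means that vectors orthogonal to \<open>M\<close> stay orthogonal to it, so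
  the compression is multiplicative.\<close>

lemma \<rho>_cproj:
  assumes w: "w \<in> F"
  shows "cproj M (\<sigma> w (cproj M y)) = cproj M (\<sigma> w y)"
proof (rule cproj_eqI[OF closed_csubspace_M cproj(1)[OF closed_csubspace_M]])
  fix z assume z: "z \<in> M"
  have "cinner (\<sigma> w (cproj M y)) z = cinner (cproj M y) (cadjoint UNIV (\<sigma> w) z)"
    by (rule isometry_adjoint[OF isometry_\<sigma>[OF w]])
  also have "\<dots> = cinner y (cadjoint UNIV (\<sigma> w) z)"
    by (rule cinner_cproj[OF closed_csubspace_M adjoint_M[OF w z]])
  also have "\<dots> = cinner (\<sigma> w y) z"
    by (rule isometry_adjoint[OF isometry_\<sigma>[OF w], symmetric])
  also have "\<dots> = cinner (cproj M (\<sigma> w y)) z"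
    by (rule cinner_cproj[OF closed_csubspace_M z, symmetric])
  finally show "cinner (\<sigma> w (cproj M y)) z = cinner (cproj M (\<sigma> w y)) z" .
qed

lemma representation_\<rho>: "representation \<Gamma> M \<rho>"
  unfolding representation_def
proof (intro conjI ballI)
  note P = closed_csubspace_M
  show "bounded_operator M (\<rho> w)" if w: "w \<in> F" for w
    unfolding bounded_operator_def
  proof (intro conjI ballI allI)
    note D = bounded_operatorD[OF bounded_op[OF w]]
    show "\<rho> w ` M \<subseteq> M" using cproj(1)[OF P] by (auto simp: \<rho>_def)
    show "\<rho> w (u + v) = \<rho> w u + \<rho> w v" for u v by (simp add: \<rho>_def D cproj_add[OF P])
    show "\<rho> w (c *\<^sub>C u) = c *\<^sub>C \<rho> w u" for c u by (simp add: \<rho>_def D cproj_scaleC[OF P])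
    show "\<exists>C. \<forall>u\<in>M. norm (\<rho> w u) \<le> C * norm u"
    proof (intro exI ballI)
      fix u
      show "norm (\<rho> w u) \<le> 1 * norm u"
        using norm_cproj_le[OF P, of "\<sigma> w u"] isometry_\<sigma>[OF w] by (simp add: \<rho>_def isometry_def)
    qed
  qed
  show "\<rho> (v \<star> w) u = \<rho> v (\<rho> w u)" if "v \<in> F" "w \<in> F" for v w u
    using that by (simp add: \<rho>_def \<sigma>_mult \<rho>_cproj)
  show "\<rho> \<one>\<^bsub>FF \<Gamma>\<^esub> u = u" if "u \<in> M" for u
    using that by (simp add: \<rho>_def \<sigma>_one cproj_id[OF P])
qed (rule closed_csubspace_M)

lemma row_contractive_\<rho>: "row_contractive \<Gamma> M \<rho>"
  unfolding row_contractive_def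
proof (intro allI ballI)
  fix i and u :: "nat \<Rightarrow> 'h"
  have "(\<Sum>s=1..num \<Gamma> i. \<rho> (gen \<Gamma> i s) (u s)) = cproj M (\<Sum>s=1..num \<Gamma> i. \<sigma> (gen \<Gamma> i s) (u s))"
    by (simp add: \<rho>_def cproj_sum[OF closed_csubspace_M])
  then have "(norm (\<Sum>s=1..num \<Gamma> i. \<rho> (gen \<Gamma> i s) (u s)))\<^sup>2
      \<le> (norm (\<Sum>s=1..num \<Gamma> i. \<sigma> (gen \<Gamma> i s) (u s)))\<^sup>2"
    using norm_cproj_le[OF closed_csubspace_M] by (simp add: power_mono)
  then show "(norm (\<Sum>s=1..num \<Gamma> i. \<rho> (gen \<Gamma> i s) (u s)))\<^sup>2 \<le> (\<Sum>s=1..num \<Gamma> i. (norm (u s))\<^sup>2)"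
    by (simp only: row_norm)
qed

lemma adjoint_\<rho>:
  assumes w: "w \<in> F" and y: "y \<in> M"
  shows "cadjoint M (\<rho> w) y = cadjoint UNIV (\<sigma> w) y"
proof (rule cadjoint_eq)
  show "csubspace M" using closed_csubspace_M by (simp add: closed_csubspace_def)
  show "cadjoint UNIV (\<sigma> w) y \<in> M" by (rule adjoint_M[OF w y])
  show "cinner (\<rho> w z) y = cinner z (cadjoint UNIV (\<sigma> w) y)" if "z \<in> M" for z
    by (simp add: \<rho>_def cinner_cproj[OF closed_csubspace_M y] isometry_adjoint[OF isometry_\<sigma>[OF w]])
qed

lemma defect_free_\<rho>: "defect_free \<Gamma> M \<rho>"
  unfolding defect_free_def
proof (intro allI ballI)
  fix i y assume y: "y \<in> M"
  have "(\<Sum>s=1..num \<Gamma> i. \<rho> (gen \<Gamma> i s) (cadjoint M (\<rho> (gen \<Gamma> i s)) y))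
      = (\<Sum>s=1..num \<Gamma> i. cproj M (\<sigma> (gen \<Gamma> i s) (cadjoint UNIV (\<sigma> (gen \<Gamma> i s)) y)))"
    by (intro sum.cong) (simp_all add: adjoint_\<rho>[OF gen_carrier y] \<rho>_def)
  also have "\<dots> = cproj M (\<Sum>s=1..num \<Gamma> i. \<sigma> (gen \<Gamma> i s) (cadjoint UNIV (\<sigma> (gen \<Gamma> i s)) y))"
    by (rule cproj_sum[OF closed_csubspace_M, symmetric])
  also have "\<dots> = y" using defect y by (simp add: defect_free_def cproj_id[OF closed_csubspace_M])
  finally show "(\<Sum>s=1..num \<Gamma> i. \<rho> (gen \<Gamma> i s) (cadjoint M (\<rho> (gen \<Gamma> i s)) y)) = y" .
qed

text \<open>By connectedness every basis vector has a backward shift in common with the orbit, so a word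
  applied to a vector of the orbit gives it up to a scalar.\<close>

lemma dilation_minimal: "closure (cspan {\<sigma> w y |w y. w \<in> F \<and> y \<in> M}) = UNIV"
proof -
  let ?X = "{\<sigma> w y |w y. w \<in> F \<and> y \<in> M}"
  have "b \<in> ?X" if b: "b \<in> B" for b
  proof -
    obtain m n where mn: "shift m b = shift n (x 0)" by (rule shifts_meet[OF b x_closed])
    have "b = \<sigma> (seg m b) ((1 / phase m b) *\<^sub>C shift m b)"
      using phase_nonzero[OF b, of m]
      by (simp add: \<sigma>_scaleC[OF seg_closed[OF b]] \<sigma>_seg[OF b] scaleC_scaleC)
    moreover have "(1 / phase m b) *\<^sub>C shift m b \<in> M"
      unfolding mn x_shift by (rule closed_csubspaceD(3)[OF closed_csubspace_M x_in_M])
    ultimately show ?thesis using seg_closed[OF b] by blast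
  qed
  then have "B \<subseteq> ?X" by (rule subsetI)
  then have "B \<subseteq> closure (cspan ?X)" by (rule order_trans[OF _ closure_cspan_superset])
  then have "closure (cspan B) \<subseteq> closure (cspan ?X)"
    by (rule closure_cspan_minimal[OF closed_csubspace_closure_cspan])
  then show ?thesis unfolding B_dense by (rule top_le)
qed

lemma minimal_star_dilation_\<rho>: "minimal_star_dilation \<Gamma> M \<rho> \<sigma>"
  unfolding minimal_star_dilation_def
  using representation_\<rho> row_contractive_\<rho> defect_free_\<rho> star adjoint_M dilation_minimal
  by (simp add: \<rho>_def)

text \<open>If the character \<open>L\<close> of the lattice agrees with \<open>coph\<close> on \<open>K\<close>, then \<open>coph / L\<close> is \<open>K\<close>-periodic,
  so it rescales the orbit consistently; the factor \<open>coph\<close> cancels the phases of \<open>\<sigma>\<close> and \<open>L\<close> leaves its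
  values at the unit vectors.\<close>

lemma group_construction:
  assumes L: "unit_character_on UNIV L" "\<And>p. p \<in> K \<Longrightarrow> L p = coph p"
  defines "\<xi> \<equiv> \<lambda>X. (coph (represent X) / L (represent X)) *\<^sub>C x (represent X)"
  shows "group_construction_rep \<Gamma> G (\<lambda>i. coset (axis i 1)) lab (\<lambda>i X. L (axis i 1)) M \<xi> \<rho>"
proof -
  have L_unit: "cmod (L g) = 1" for g using L(1) by (simp add: unit_character_on_def)
  then have L_nonzero: "L g \<noteq> 0" for g by (metis norm_zero zero_neq_one)
  have L_add: "L (g + h) = L g * L h" for g h using L(1) by (simp add: unit_character_on_def)
  have \<xi>: "\<xi> (coset g) = (coph g / L g) *\<^sub>C x g" for g
    unfolding \<xi>_def
  proof (rule represent_invariant[where f = "\<lambda>g. (coph g / L g) *\<^sub>C x g"])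
    fix g p assume p: "p \<in> K"
    then show "(coph (g + p) / L (g + p)) *\<^sub>C x (g + p) = (coph g / L g) *\<^sub>C x g"
      using L(2)[OF p] coph_nonzero[of p] x_eq_iff[of g p] by (simp add: coph_add L_add)
  qed
  have \<xi>_unit: "cmod (coph g / L g) = 1" for g by (simp add: norm_divide coph_unit L_unit)
  have data: "group_construction_data \<Gamma> G (\<lambda>i. coset (axis i 1)) lab (\<lambda>i X. L (axis i 1))"
    unfolding group_construction_data_def
  proof (intro conjI allI ballI impI)
    show "comm_group G" by (rule comm_group_G)
    show "range (\<lambda>i. coset (axis i 1)) \<subseteq> carrier G" by (auto simp: coset_in_G)
    show "generate G (range (\<lambda>i. coset (axis i 1))) = carrier G" by (rule generate_G)
    show "lab i X \<in> {1..num \<Gamma> i}" for i X unfolding lab_def by (rule label(1)[OF x_closed])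
    show "cmod (L (axis i 1)) = 1" for i by (rule L_unit)
    show "L (axis i 1) * L (axis j 1) = L (axis j 1) * L (axis i 1)" for i j by simp
    fix i j X assume "X \<in> carrier G"
    then obtain g where X: "X = coset g" by (auto simp: carrier_G)
    \<comment> \<open>Both sides of the commutation relation are the segment of degree \<open>axis i 1 + axis j 1\<close>.\<close>
    have two: "seg (axis i 1 + axis j 1) (x g)
        = gen \<Gamma> i (lab i X) \<star> gen \<Gamma> j (lab j (X \<otimes>\<^bsub>G\<^esub> inv\<^bsub>G\<^esub> coset (axis i 1)))" for i j
      unfolding X coset_diff lab_coset seg_add_axis[OF x_closed] label(2)[OF x_closed] x_shift zvec_axis ..
    show "gen \<Gamma> i (lab i X) \<star> gen \<Gamma> j (lab j (X \<otimes>\<^bsub>G\<^esub> inv\<^bsub>G\<^esub> coset (axis i 1)))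
        = gen \<Gamma> j (lab j X) \<star> gen \<Gamma> i (lab i (X \<otimes>\<^bsub>G\<^esub> inv\<^bsub>G\<^esub> coset (axis j 1)))"
      unfolding two[symmetric] by (simp only: add.commute)
  qed
  have onb: "orthonormal_basis M (carrier G) \<xi>"
    unfolding orthonormal_basis_def
  proof (intro conjI ballI)
    fix X Y assume "X \<in> carrier G" "Y \<in> carrier G"
    then obtain g h where X: "X = coset g" and Y: "Y = coset h" by (auto simp: carrier_G)
    show "cinner (\<xi> X) (\<xi> Y) = (if X = Y then 1 else 0)"
    proof (cases "X = Y")
      case True
      have "cinner (\<xi> X) (\<xi> X) = 1"
        by (simp only: X cinner_self \<xi> norm_scaleC \<xi>_unit B_norm[OF x_closed]) simp
      then show ?thesis using True by simp
    next
      case False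
      then have "x g \<noteq> x h" using x_eq_iff[of h "g - h"] by (simp add: X Y coset_eq_iff)
      then show ?thesis
        using False B_orthonormal[OF x_closed x_closed, of g h]
        by (simp add: X Y \<xi> cinner_scaleC_left cinner_scaleC_right)
    qed
  next
    have "\<xi> ` carrier G = range (\<lambda>g. (coph g / L g) *\<^sub>C x g)"
      by (auto simp: carrier_G \<xi> image_image)
    moreover have "cspan (range (\<lambda>g. (coph g / L g) *\<^sub>C x g)) = cspan (range x)"
    proof (rule antisym)
      show "cspan (range (\<lambda>g. (coph g / L g) *\<^sub>C x g)) \<subseteq> cspan (range x)"
        by (intro complex_hilbert.span_minimal csubspace_cspan)
          (auto intro: complex_hilbert.span_scale complex_hilbert.span_base)
      show "cspan (range x) \<subseteq> cspan (range (\<lambda>g. (coph g / L g) *\<^sub>C x g))"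
      proof (intro complex_hilbert.span_minimal csubspace_cspan subsetI)
        fix u assume "u \<in> range x"
        then obtain g where u: "u = x g" by blast
        have "u = (L g / coph g) *\<^sub>C ((coph g / L g) *\<^sub>C x g)"
          using coph_nonzero[of g] L_nonzero[of g] by (simp add: u scaleC_scaleC)
        also have "\<dots> \<in> cspan (range (\<lambda>g. (coph g / L g) *\<^sub>C x g))"
          by (intro complex_hilbert.span_scale complex_hilbert.span_base) blast
        finally show "u \<in> cspan (range (\<lambda>g. (coph g / L g) *\<^sub>C x g))" .
      qed
    qed
    ultimately show "closure (cspan (\<xi> ` carrier G)) = M" by (simp add: M_def)
  qed
  have act: "\<rho> (gen \<Gamma> i s) (\<xi> (X \<otimes>\<^bsub>G\<^esub> inv\<^bsub>G\<^esub> coset (axis i 1)))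
      = (if s = lab i X then L (axis i 1) *\<^sub>C \<xi> X else 0)"
    if s: "s \<in> {1..num \<Gamma> i}" and X: "X \<in> carrier G" for i s X
  proof -
    obtain g where g: "X = coset g" using X by (auto simp: carrier_G)
    let ?e = "axis i 1 :: 'k ZZk" and ?n = "axis i 1 :: 'k NNk"
    have below: "shift ?n (x g) = x (g - ?e)" by (simp only: x_shift zvec_axis)
    have \<xi>_below: "\<xi> (X \<otimes>\<^bsub>G\<^esub> inv\<^bsub>G\<^esub> coset ?e) = (coph (g - ?e) / L (g - ?e)) *\<^sub>C x (g - ?e)"
      by (simp only: g coset_diff \<xi>)
    have \<rho>_below: "\<rho> (gen \<Gamma> i s) (\<xi> (X \<otimes>\<^bsub>G\<^esub> inv\<^bsub>G\<^esub> coset ?e))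
        = (coph (g - ?e) / L (g - ?e)) *\<^sub>C cproj M (\<sigma> (gen \<Gamma> i s) (x (g - ?e)))"
      unfolding \<xi>_below \<rho>_def
      by (simp only: \<sigma>_scaleC[OF gen_carrier[OF s]] cproj_scaleC[OF closed_csubspace_M])
    show ?thesis
    proof (cases "s = lab i X")
      case True
      then have "gen \<Gamma> i s = seg ?n (x g)" by (simp only: g lab_coset label(2)[OF x_closed])
      then have "\<sigma> (gen \<Gamma> i s) (x (g - ?e)) = phase ?n (x g) *\<^sub>C x g"
        using \<sigma>_seg[OF x_closed, of ?n g] by (simp only: below)
      then have "\<rho> (gen \<Gamma> i s) (\<xi> (X \<otimes>\<^bsub>G\<^esub> inv\<^bsub>G\<^esub> coset ?e))
          = (phase ?n (x g) * coph (g - ?e) / L (g - ?e)) *\<^sub>C x g"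
        unfolding \<rho>_below
        by (simp add: cproj_scaleC[OF closed_csubspace_M] cproj_id[OF closed_csubspace_M x_in_M]
            scaleC_scaleC mult.commute)
      also have "phase ?n (x g) * coph (g - ?e) = coph g"
        using coph_step[of g ?n] by (simp only: zvec_axis)
      also have "coph g / L (g - ?e) = L ?e * (coph g / L g)"
        using L_add[of "g - ?e" ?e] L_nonzero[of ?e] by simp
      finally show ?thesis using True by (simp add: g \<xi> scaleC_scaleC)
    next
      case False
      obtain b \<alpha> where b: "b \<in> B" "cmod \<alpha> = 1" "\<sigma> (gen \<Gamma> i s) (x (g - ?e)) = \<alpha> *\<^sub>C b"
        by (rule \<sigma>_basis[OF gen_carrier[OF s] x_closed])
      then have "comes_from ?n b (gen \<Gamma> i s) (x (g - ?e)) \<alpha>"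
        using gen_carrier[OF s] deg_gen[OF s] x_closed by (simp add: comes_from_def)
      then have seg_b: "gen \<Gamma> i s = seg ?n b" and shift_b: "x (g - ?e) = shift ?n b"
        by (simp_all add: comes_from_iff[OF b(1)])
      \<comment> \<open>On the orbit, \<open>x g\<close> is the only vector that the shift of colour \<open>i\<close> sends to
        \<open>x (g - axis i 1)\<close>, and the first letter of colour \<open>i\<close> of its tail would have to be \<open>s\<close>.\<close>
      have "b \<notin> range x"
      proof
        assume "b \<in> range x"
        then obtain h where h: "b = x h" by blast
        have "x (h - ?e) = x (g - ?e)" using shift_b unfolding h by (simp only: x_shift zvec_axis)
        then have "h - g \<in> K" using x_eq_iff[of "g - ?e" "h - g"] by simp
        then have "b = x g" unfolding h using x_eq_iff[of g "h - g"] by simp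
        then have "gen \<Gamma> i s = gen \<Gamma> i (label i (x g))"
          using seg_b label(2)[OF x_closed, of i g] by simp
        then have "s = lab i X" using gen_inject[OF s label(1)[OF x_closed]] by (simp only: g lab_coset)
        then show False using False by simp
      qed
      then have "cproj M (\<sigma> (gen \<Gamma> i s) (x (g - ?e))) = 0"
        using b by (simp add: cproj_scaleC[OF closed_csubspace_M] cproj_basis)
      then show ?thesis using False by (simp add: \<rho>_below)
    qed
  qed
  show ?thesis
    unfolding group_construction_rep_def
    using data onb representation_\<rho> act by blast
qed

lemma symmetry_group_eq_preimage:
  assumes "b \<in> B"
  shows "symmetry_group \<Gamma> \<sigma> b =
    {n. canonical_hom G (\<lambda>i. coset (axis i 1)) n \<in> full_symmetry_group G lab (\<lambda>i X. c i)}"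
proof -
  have "symmetry_group \<Gamma> \<sigma> b = H"
    unfolding H_def symmetry_group_eq_periods[OF assms]
    by (rule periods_independent[OF shift_congruence_same_tail assms x_closed])
  moreover have "coset n \<in> coset ` H \<longleftrightarrow> n \<in> H" for n
  proof
    assume "coset n \<in> coset ` H"
    then obtain h where h: "h \<in> H" "coset n = coset h" by blast
    then have "n - h \<in> H" using K_subset_H by (auto simp: coset_eq_iff)
    then show "n \<in> H" using additive_subgroupD(4)[OF additive_subgroup_H _ h(1), of "n - h"] by simp
  qed blast
  ultimately show ?thesis unfolding full_symmetry_group_G canonical_hom_coset by blast
qed

end

theorem theorem5p3:
  fixes \<Gamma> :: "'k::{finite,linorder} presentation"
    and B :: "'h::complex_hilbert set"
    and \<sigma> :: "'k word set \<Rightarrow> 'h \<Rightarrow> 'h"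
  assumes "single_vertex_kgraph \<Gamma>"
    and "star_representation \<Gamma> UNIV \<sigma>"
    and "atomic \<Gamma> B \<sigma>"
    and "connected_graph \<Gamma> B \<sigma>"
  shows "\<exists>(G :: 'k ZZk set monoid) \<gg> t \<alpha> M \<xi> \<rho>.
           group_construction_rep \<Gamma> G \<gg> t \<alpha> M \<xi> \<rho> \<and>
           minimal_star_dilation \<Gamma> M \<rho> \<sigma> \<and>
           (\<forall>\<eta>\<in>B. symmetry_group \<Gamma> \<sigma> \<eta> =
              {n. canonical_hom G \<gg> n \<in> full_symmetry_group G t \<alpha>})"
proof -
  interpret atomic_star_rep \<Gamma> B \<sigma> by (rule atomic_star_rep.intro) (rule assms)+
  obtain b where b: "b \<in> B" using assms(4) by (auto simp: connected_graph_def)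
  obtain x where x: "\<And>g. x g \<in> B" "\<And>g n. shift n (x g) = x (g - zvec n)"
      "\<And>g p. p \<in> periods same_tail b \<Longrightarrow> same_tail (x (g + p)) (x g)"
    by (rule lattice_orbit_exists[OF b]) blast
  have "periods same_tail (x 0) = periods same_tail b"
    by (rule periods_independent[OF shift_congruence_same_tail x(1) b])
  then interpret lattice_orbit \<Gamma> B \<sigma> x
    using x by unfold_locales auto
  obtain L where L: "unit_character_on UNIV L" "\<And>p. p \<in> K \<Longrightarrow> L p = coph p"
    by (rule unit_character_extends[OF additive_subgroup_K unit_character_coph]) blast
  have "\<exists>\<xi>. group_construction_rep \<Gamma> G (\<lambda>i. coset (axis i 1)) lab (\<lambda>i X. L (axis i 1)) M \<xi> \<rho>"
    by (rule exI, rule group_construction[OF L(1)], erule L(2))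
  then obtain \<xi> where \<xi>:
    "group_construction_rep \<Gamma> G (\<lambda>i. coset (axis i 1)) lab (\<lambda>i X. L (axis i 1)) M \<xi> \<rho>" ..
  show ?thesis
    by (rule exI[of _ G], rule exI[of _ "\<lambda>i. coset (axis i 1)"], rule exI[of _ lab],
        rule exI[of _ "\<lambda>i X. L (axis i 1)"], rule exI[of _ M], rule exI[of _ \<xi>], rule exI[of _ \<rho>])
      (intro conjI ballI \<xi> minimal_star_dilation_\<rho> symmetry_group_eq_preimage)
qed

end
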